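(* Let $\ell\in\mathbb Z_+$, $k\ge 1$ and $\mathbf n=(n_1,\dots,n_k)\in\mathbb Z_+^k$ with $2k\ge\sum_i i\,n_i$. Then $$M^{(k)}_{\ell;\mathbf n}(q^{-1})=q^{-\frac12\sum_i n_i-\frac14(\ell+\mathbf n\cdot A\mathbf n)}\;\mathrm{CT}_{\widehat Q_1}\Big(\widehat Q_1\widehat Q_0^{-1}\prod_{i=1}^k\widehat Q_i^{\,n_i}\;z^{\ell+1}\Big)\Big|_{\widehat Q_0=1}.$$ In particular the value does not depend on $k$ in this range (when $\mathbf n$ is completed by zero entries) and may be denoted $M_{\ell;\mathbf n}(q^{-1})$; letting $k\to\infty$ and completing $\mathbf n$ by zero entries, $M_{\ell;\mathbf n}(q^{-1})=M_{\ell\omega_1;\mathbf n}(q^{-1})$.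
   Context: $\mathbb Z_+=\{0,1,2,\dots\}$. For $a\in\mathbb Z_+$, $b\in\mathbb Z$, $\left[\begin{matrix}a+b\\ a\end{matrix}\right]_q$ is the coefficient of $x^a$ in $\prod_{i=0}^{b}(1-q^ix)^{-1}$ if $b\ge0$, and in $\prod_{i=0}^{-b-1}(1-q^{i+b+1}x)$ if $b<0$. $A$ is the $k\times k$ matrix $A_{i,j}=\min(i,j)$. For $\mathbf m,\mathbf n\in\mathbb Z_+^k$, $p_j=\sum_{i}\min(i,j)(n_i-2m_i)$, $q_0=\ell+\sum_i i(2m_i-n_i)$, $Q(\mathbf m,\mathbf n)=\mathbf m^tA(\mathbf m-\mathbf n)$ and $$M^{(k)}_{\ell;\mathbf n}(q^{-1})=\sum_{\substack{m_1,\dots,m_k\in\mathbb Z_+\\ q_0=0;\ p_1,\dots,p_k\ge0}}q^{Q(\mathbf m,\mathbf n)}\prod_{i=1}^k\left[\begin{matrix}m_i+p_i\\ m_i\end{matrix}\right]_q.$$ $M_{\ell\omega_1;\mathbf n}(q^{-1})$ denotes the corresponding fermionic sum with no truncation: for finitely supported $\mathbf n=(n_i)_{i\ge1}$, the sum of $q^{Q(\mathbf m,\mathbf n)}\prod_{i\ge1}\left[\begin{matrix}m_i+p_i\\ m_i\end{matrix}\right]_q$ over finitely supported $\mathbf m=(m_i)_{i\ge1}$ in $\mathbb Z_+$ with $p_i\ge0$ for all $i\ge1$ and $\lim_{i\to\infty}p_i=\ell$ ($A$, $p_i$, $Q$ given by the same formulas with all indices $\geq 1$). Let $u$ be an indeterminate,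 $q=u^4$, $t=u^{-2}$ (so $q=t^{-2}$). Let $\widehat Q_0,\widehat Q_1$ be invertible variables with $\widehat Q_0\widehat Q_1=t\,\widehat Q_1\widehat Q_0$, and define $\widehat Q_j$, $j\in\mathbb Z$, by the $A_1$ quantum $Q$-system $t\,\widehat Q_{j+1}\widehat Q_{j-1}=\widehat Q_j^2-1$; they satisfy $\widehat Q_j\widehat Q_{j+1}=t\,\widehat Q_{j+1}\widehat Q_j$ and are Laurent polynomials in $\widehat Q_0,\widehat Q_1$. Let $\mathcal R$ be the ring of formal Laurent series in $\widehat Q_1^{-1}$ with coefficients in $\mathbb C[u^{\pm1}][\widehat Q_0^{\pm1}]$; inverses of the $\widehat Q_j$ are taken in $\mathcal R$. Writing $f\in\mathcal R$ in normal-ordered form $f=\sum_{a,b}f_{a,b}\widehat Q_0^a\widehat Q_1^b$, set $\mathrm{CT}_{\widehat Q_1}(f)=\sum_af_{a,0}\widehat Q_0^a$ and $f|_{\widehat Q_0=1}=\sum_b\widehat Q_1^b\sum_af_{a,b}$, so that $\mathrm{CT}_{\widehat Q_1}(f)|_{\widehat Q_0=1}=\sum_af_{a,0}$. All products of non-commuting factors are ordered with indices increasing from left to right. The element $z\in\mathcal R$ is $$z=\lim_{k\to\infty}\widehat Q_k\widehat Q_{k+1}^{-1}=\widehat Q_0\widehat Q_1^{-1}\prod_{k=1}^\infty(1-\widehat Q_k^{-2})^{-1},$$ the limit being coefficientwise as series in $\widehat Q_1^{-1}$. *)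

theory Defs
  imports
    "HOL-Library.Poly_Mapping"
    "HOL-Computational_Algebra.Formal_Power_Series"
begin

section \<open>The ring of Laurent polynomials in u, and quantum binomials\<close>

text \<open>
  Laurent polynomials are group algebras of the additive group of integers: multiplication on
  \<^typ>\<open>int \<Rightarrow>\<^sub>0 'a\<close> is convolution. The type \<open>laurent\<close> is C[u, 1/u].
\<close>

type_synonym laurent = "int \<Rightarrow>\<^sub>0 complex"

definition u_pow :: "int \<Rightarrow> laurent" where
  "u_pow e = Poly_Mapping.single e 1"

text \<open>Here \<open>q = u^4\<close>; a fractional power \<open>q^(e/4)\<close> is \<open>u_pow e\<close>.\<close>

definition q_pow :: "int \<Rightarrow> laurent" where
  "q_pow e = u_pow (4 * e)"

text \<open>
  \<open>q_binom a b\<close> is the quantum binomial with top entry \<open>a + b\<close> and bottom entry \<open>a\<close>.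
  The power series \<^term>\<open>fps_right_inverse f 1\<close> is the inverse of a power series \<open>f\<close> with constant
  term 1 over a commutative ring. Only the case \<open>b \<ge> 0\<close> occurs in the fermionic sums below.
\<close>

definition q_binom :: "nat \<Rightarrow> int \<Rightarrow> laurent" where
  "q_binom a b =
    (if b \<ge> 0
     then fps_nth (\<Prod>i=0..nat b. fps_right_inverse (1 - fps_const (q_pow (int i)) * fps_X) 1) a
     else fps_nth (\<Prod>i=0..nat (- b - 1). 1 - fps_const (q_pow (int i + b + 1)) * fps_X) a)"


section \<open>Fermionic sums\<close>

text \<open>
  Vectors indexed by \<open>1, \<dots>, k\<close> (or by \<open>1, 2, \<dots>\<close> in the version without truncation) are functions
  on the natural numbers that vanish at all other indices.
\<close>

definition p_trunc :: "nat \<Rightarrow> (nat \<Rightarrow> nat) \<Rightarrow> (nat \<Rightarrow> nat) \<Rightarrow> nat \<Rightarrow> int" where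
  "p_trunc k m n j = (\<Sum>i=1..k. int (min i j) * (int (n i) - 2 * int (m i)))"

definition q_zero :: "nat \<Rightarrow> nat \<Rightarrow> (nat \<Rightarrow> nat) \<Rightarrow> (nat \<Rightarrow> nat) \<Rightarrow> int" where
  "q_zero k l m n = int l + (\<Sum>i=1..k. int i * (2 * int (m i) - int (n i)))"

text \<open>\<open>bilin_A k x y\<close> is the bilinear form of the matrix \<open>A\<close> with entries \<open>min i j\<close>.\<close>

definition bilin_A :: "nat \<Rightarrow> (nat \<Rightarrow> int) \<Rightarrow> (nat \<Rightarrow> int) \<Rightarrow> int" where
  "bilin_A k x y = (\<Sum>i=1..k. \<Sum>j=1..k. x i * int (min i j) * y j)"

definition Q_trunc :: "nat \<Rightarrow> (nat \<Rightarrow> nat) \<Rightarrow> (nat \<Rightarrow> nat) \<Rightarrow> int" where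
  "Q_trunc k m n = bilin_A k (\<lambda>i. int (m i)) (\<lambda>i. int (m i) - int (n i))"

definition fermionic_index :: "nat \<Rightarrow> nat \<Rightarrow> (nat \<Rightarrow> nat) \<Rightarrow> (nat \<Rightarrow> nat) set" where
  "fermionic_index k l n =
    {m. (\<forall>i. i \<notin> {1..k} \<longrightarrow> m i = 0) \<and> q_zero k l m n = 0 \<and> (\<forall>j\<in>{1..k}. p_trunc k m n j \<ge> 0)}"

text \<open>The truncated sum \<open>M\<^sup>(\<^sup>k\<^sup>)\<close> with arguments \<open>l\<close> and \<open>n\<close>, evaluated at the inverse of \<open>q\<close>.\<close>

definition fermionic_sum :: "nat \<Rightarrow> nat \<Rightarrow> (nat \<Rightarrow> nat) \<Rightarrow> laurent" where
  "fermionic_sum k l n =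
    (\<Sum>m\<in>fermionic_index k l n.
      q_pow (Q_trunc k m n) * (\<Prod>i=1..k. q_binom (m i) (p_trunc k m n i)))"


text \<open>
  In the sums without truncation the index 0 contributes nothing, since \<open>min 0 j = 0\<close> and
  \<open>m 0 = 0\<close>; \<^const>\<open>Sum_any\<close> and \<^const>\<open>Prod_any\<close> are sums and products with finite support.
  In particular \<open>q_binom 0 b = 1\<close>.
\<close>

definition p_full :: "(nat \<Rightarrow> nat) \<Rightarrow> (nat \<Rightarrow> nat) \<Rightarrow> nat \<Rightarrow> int" where
  "p_full m n j = Sum_any (\<lambda>i. int (min i j) * (int (n i) - 2 * int (m i)))"

definition Q_full :: "(nat \<Rightarrow> nat) \<Rightarrow> (nat \<Rightarrow> nat) \<Rightarrow> int" where
  "Q_full m n =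
    Sum_any (\<lambda>i. Sum_any (\<lambda>j. int (m i) * int (min i j) * (int (m j) - int (n j))))"

definition fermionic_index_full :: "nat \<Rightarrow> (nat \<Rightarrow> nat) \<Rightarrow> (nat \<Rightarrow> nat) set" where
  "fermionic_index_full l n =
    {m. m 0 = 0 \<and> finite {i. m i \<noteq> 0} \<and> (\<forall>i\<ge>1. p_full m n i \<ge> 0) \<and> p_full m n \<longlonglongrightarrow> int l}"

definition fermionic_sum_full :: "nat \<Rightarrow> (nat \<Rightarrow> nat) \<Rightarrow> laurent" where
  "fermionic_sum_full l n =
    (\<Sum>m\<in>fermionic_index_full l n.
      q_pow (Q_full m n) * Prod_any (\<lambda>i. q_binom (m i) (p_full m n i)))"

text \<open>Both index sets are finite, so that the sums above are what they seem to be.\<close>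

lemma finite_fermionic_index: "finite (fermionic_index k l n)"
proof -
  define B where "B = nat (\<Sum>i=1..k. int i * int (n i))"
  have "fermionic_index k l n \<subseteq> {m. \<forall>i. (i \<in> {1..k} \<longrightarrow> m i \<in> {0..B}) \<and> (i \<notin> {1..k} \<longrightarrow> m i = 0)}"
  proof (safe, goal_cases)
    case (1 m i)
    hence q: "(\<Sum>i=1..k. int i * (2 * int (m i))) \<le> (\<Sum>i=1..k. int i * int (n i))"
      by (auto simp: fermionic_index_def q_zero_def right_diff_distrib sum_subtractf)
    have "int (m i) \<le> int i * (2 * int (m i))"
    proof -
      have "1 * int (m i) \<le> int i * int (m i)"
        using 1 by (intro mult_right_mono) auto
      thus ?thesis by (simp add: algebra_simps)
    qed
    also have "\<dots> \<le> (\<Sum>i=1..k. int i * (2 * int (m i)))"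
      using 1 by (intro member_le_sum) auto
    finally have "int (m i) \<le> (\<Sum>i=1..k. int i * int (n i))" using q by linarith
    thus ?case by (simp add: B_def)
  next
    case (2 m i)
    thus ?case by (auto simp: fermionic_index_def)
  qed
  moreover have "finite {m. \<forall>i. (i \<in> {1..k} \<longrightarrow> m i \<in> {0..B}) \<and> (i \<notin> {1..k} \<longrightarrow> m i = (0::nat))}"
    by (rule finite_set_of_finite_funs) auto
  ultimately show ?thesis by (rule finite_subset)
qed

lemma finite_fermionic_index_full:
  assumes "finite {i. n i \<noteq> 0}"
  shows "finite (fermionic_index_full l n)"
proof -
  define B where "B = nat (Sum_any (\<lambda>i. int i * int (n i)))"
  have "fermionic_index_full l n \<subseteq>
    {m. \<forall>i. (i \<in> {1..B} \<longrightarrow> m i \<in> {0..B}) \<and> (i \<notin> {1..B} \<longrightarrow> m i = 0)}"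
  proof
    fix m assume m: "m \<in> fermionic_index_full l n"
    define S where "S = {i. m i \<noteq> 0} \<union> {i. n i \<noteq> 0}"
    have fS: "finite S" using m assms by (auto simp: S_def fermionic_index_full_def)
    then obtain N where N: "\<And>i. i \<in> S \<Longrightarrow> i \<le> N"
      by (meson finite_nat_set_iff_bounded_le)
    have p: "p_full m n j = (\<Sum>i\<in>S. int (min i j) * (int (n i) - 2 * int (m i)))" for j
      unfolding p_full_def by (rule Sum_any.expand_superset[OF fS]) (auto simp: S_def)
    have "p_full m n (Suc N) \<ge> 0" using m by (auto simp: fermionic_index_full_def)
    also have "p_full m n (Suc N) = (\<Sum>i\<in>S. int i * (int (n i) - 2 * int (m i)))"
      unfolding p using N by (intro sum.cong) (auto simp: min_def dest: N)
    finally have q: "(\<Sum>i\<in>S. int i * (2 * int (m i))) \<le> (\<Sum>i\<in>S. int i * int (n i))"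
      by (simp add: right_diff_distrib sum_subtractf)
    have Bn: "(\<Sum>i\<in>S. int i * int (n i)) = Sum_any (\<lambda>i. int i * int (n i))"
      by (rule Sum_any.expand_superset[OF fS, symmetric]) (auto simp: S_def)
    have *: "i \<le> B \<and> m i \<le> B" if "m i \<noteq> 0" for i
    proof -
      have i: "i \<noteq> 0" "i \<in> S" using that m by (auto simp: fermionic_index_full_def S_def intro: gr0I)
      have "int i * (2 * int (m i)) \<le> (\<Sum>i\<in>S. int i * (2 * int (m i)))"
        using i by (intro member_le_sum[OF _ _ fS]) auto
      hence le: "int i * (2 * int (m i)) \<le> int B" using q Bn by (simp add: B_def)
      have "int i * 1 \<le> int i * int (m i)" using that by (intro mult_left_mono) auto
      moreover have "1 * int (m i) \<le> int i * int (m i)" using i by (intro mult_right_mono) auto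
      ultimately show ?thesis using le by (simp add: algebra_simps)
    qed
    have "m 0 = 0" using m by (auto simp: fermionic_index_full_def)
    have "(i \<in> {1..B} \<longrightarrow> m i \<in> {0..B}) \<and> (i \<notin> {1..B} \<longrightarrow> m i = 0)" for i
      using *[of i] \<open>m 0 = 0\<close> by (cases "i = 0"; cases "m i = 0") auto
    thus "m \<in> {m. \<forall>i. (i \<in> {1..B} \<longrightarrow> m i \<in> {0..B}) \<and> (i \<notin> {1..B} \<longrightarrow> m i = 0)}" by blast
  qed
  moreover have "finite {m. \<forall>i. (i \<in> {1..B} \<longrightarrow> m i \<in> {0..B}) \<and> (i \<notin> {1..B} \<longrightarrow> m i = (0::nat))}"
    by (rule finite_set_of_finite_funs) auto
  ultimately show ?thesis by (rule finite_subset)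
qed


section \<open>Skew Laurent series in the inverse of \<open>Q\<^sub>1\<close>\<close>

text \<open>
  A series is the family of its coefficients: the entry of \<open>f\<close> at \<open>b\<close> is the coefficient of
  \<open>Q\<^sub>1^b\<close> in normal order (\<open>Q\<^sub>0\<close> to the left), a Laurent polynomial in \<open>Q\<^sub>0\<close> over \<^typ>\<open>laurent\<close>.
\<close>

typedef skew_series = "{f :: int \<Rightarrow> (int \<Rightarrow>\<^sub>0 laurent). \<exists>N. \<forall>b>N. f b = 0}"
  morphisms coeff_Q1 Abs_skew_series
  by (rule exI[of _ "\<lambda>_. 0"]) auto

setup_lifting type_definition_skew_series

text \<open>
  From \<open>Q\<^sub>0 Q\<^sub>1 = t Q\<^sub>1 Q\<^sub>0\<close> and \<open>t = u^(-2)\<close> one gets \<open>Q\<^sub>1^b Q\<^sub>0^a = u^(2ab) Q\<^sub>0^a Q\<^sub>1^b\<close>;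
  hence moving \<open>Q\<^sub>1^b\<close> to the right past a Laurent polynomial in \<open>Q\<^sub>0\<close> acts on the latter by
  \<open>twist b\<close>.
\<close>

definition twist :: "int \<Rightarrow> (int \<Rightarrow>\<^sub>0 laurent) \<Rightarrow> (int \<Rightarrow>\<^sub>0 laurent)" where
  "twist b p = Poly_Mapping.mapp (\<lambda>a c. u_pow (2 * a * b) * c) p"

lemma u_pow_0 [simp]: "u_pow 0 = 1"
  by (simp add: u_pow_def)

lemma u_pow_mult: "u_pow a * u_pow b = u_pow (a + b)"
  by (simp add: u_pow_def mult_single)

lemma u_pow_nonzero [simp]: "u_pow a \<noteq> 0"
proof
  assume "u_pow a = 0"
  hence "Poly_Mapping.lookup (u_pow a) a = 0" by simp
  thus False by (simp add: u_pow_def)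
qed

lemma u_pow_eq_iff [simp]: "u_pow a = u_pow b \<longleftrightarrow> a = b"
proof
  assume "u_pow a = u_pow b"
  hence "Poly_Mapping.lookup (u_pow a) a = Poly_Mapping.lookup (u_pow b) a" by simp
  thus "a = b" by (simp add: u_pow_def lookup_single when_def split: if_splits)
qed simp

lemma lookup_twist: "Poly_Mapping.lookup (twist b p) a = u_pow (2 * a * b) * Poly_Mapping.lookup p a"
  by (auto simp: twist_def lookup_mapp in_keys_iff when_def)

lemma twist_0 [simp]: "twist b 0 = 0"
  by (rule poly_mapping_eqI) (simp add: lookup_twist)

lemma twist_eq_0_iff [simp]: "twist b p = 0 \<longleftrightarrow> p = 0"
proof
  assume "twist b p = 0"
  hence "u_pow (2 * a * b) * Poly_Mapping.lookup p a = 0" for a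
    by (metis lookup_twist lookup_zero)
  thus "p = 0" by (intro poly_mapping_eqI) simp
qed simp

lemma twist_by_0 [simp]: "twist 0 p = p"
  by (rule poly_mapping_eqI) (simp add: lookup_twist)

lemma twist_add: "twist b (p + r) = twist b p + twist b r"
  by (rule poly_mapping_eqI) (simp add: lookup_twist lookup_add algebra_simps)

lemma twist_sum: "twist b (\<Sum>x\<in>A. f x) = (\<Sum>x\<in>A. twist b (f x))"
  by (induction A rule: infinite_finite_induct) (auto simp: twist_add)

lemma twist_twist: "twist b (twist c p) = twist (b + c) p"
  by (rule poly_mapping_eqI)
    (simp add: lookup_twist distrib_left flip: mult.assoc u_pow_mult)

lemma twist_single: "twist b (Poly_Mapping.single a c) = Poly_Mapping.single a (u_pow (2 * a * b) * c)"
  by (rule poly_mapping_eqI) (auto simp: lookup_twist lookup_single when_def)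

lemma twist_one [simp]: "twist b 1 = 1"
  using twist_single[of b 0 1] by simp

lemma poly_mapping_expand:
  "p = (\<Sum>a\<in>Poly_Mapping.keys p. Poly_Mapping.single a (Poly_Mapping.lookup p a))"
proof (rule poly_mapping_eqI)
  fix b
  have "(\<Sum>a\<in>Poly_Mapping.keys p. Poly_Mapping.lookup (Poly_Mapping.single a (Poly_Mapping.lookup p a)) b) =
      (\<Sum>a\<in>Poly_Mapping.keys p. if a = b then Poly_Mapping.lookup p a else 0)"
    by (intro sum.cong) (auto simp: lookup_single when_def)
  also have "\<dots> = Poly_Mapping.lookup p b"
    by (simp add: in_keys_iff)
  finally show "Poly_Mapping.lookup p b =
      Poly_Mapping.lookup (\<Sum>a\<in>Poly_Mapping.keys p. Poly_Mapping.single a (Poly_Mapping.lookup p a)) b"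
    by (simp add: lookup_sum)
qed

lemma twist_mult: "twist b (p * r) = twist b p * twist b r"
proof -
  have *: "twist b (Poly_Mapping.single a c * Poly_Mapping.single a' c') =
      twist b (Poly_Mapping.single a c) * twist b (Poly_Mapping.single a' c')" for a a' c c'
    by (simp add: twist_single mult_single u_pow_mult[symmetric] algebra_simps)
  have "twist b (p * r) =
    twist b ((\<Sum>a\<in>Poly_Mapping.keys p. Poly_Mapping.single a (Poly_Mapping.lookup p a)) *
      (\<Sum>a\<in>Poly_Mapping.keys r. Poly_Mapping.single a (Poly_Mapping.lookup r a)))"
    by (simp flip: poly_mapping_expand)
  also have "\<dots> =
    twist b (\<Sum>a\<in>Poly_Mapping.keys p. Poly_Mapping.single a (Poly_Mapping.lookup p a)) *
    twist b (\<Sum>a\<in>Poly_Mapping.keys r. Poly_Mapping.single a (Poly_Mapping.lookup r a))"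
    by (simp add: sum_product twist_sum *)
  finally show ?thesis by (simp flip: poly_mapping_expand)
qed

definition skew_mult ::
  "(int \<Rightarrow> (int \<Rightarrow>\<^sub>0 laurent)) \<Rightarrow> (int \<Rightarrow> (int \<Rightarrow>\<^sub>0 laurent)) \<Rightarrow> int \<Rightarrow> (int \<Rightarrow>\<^sub>0 laurent)" where
  "skew_mult f g d = Sum_any (\<lambda>b. f b * twist b (g (d - b)))"

lemma skew_mult_eq_sum:
  assumes "finite S" "\<And>b. f b \<noteq> 0 \<Longrightarrow> g (d - b) \<noteq> 0 \<Longrightarrow> b \<in> S"
  shows "skew_mult f g d = (\<Sum>b\<in>S. f b * twist b (g (d - b)))"
  unfolding skew_mult_def using assms by (intro Sum_any.expand_superset) auto

lemma skew_mult_bounded: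
  assumes "\<And>b. b > N \<Longrightarrow> f b = 0" "\<And>b. b > N' \<Longrightarrow> g b = 0"
  shows "skew_mult f g d = (\<Sum>b\<in>{d - N'..N}. f b * twist b (g (d - b)))"
    and "d > N + N' \<Longrightarrow> skew_mult f g d = 0"
proof -
  show *: "skew_mult f g d = (\<Sum>b\<in>{d - N'..N}. f b * twist b (g (d - b)))"
  proof (rule skew_mult_eq_sum)
    fix b assume "f b \<noteq> 0" "g (d - b) \<noteq> 0"
    thus "b \<in> {d - N'..N}" using assms(1)[of b] assms(2)[of "d - b"] by force
  qed auto
  assume "d > N + N'"
  thus "skew_mult f g d = 0" unfolding * by simp
qed

lemma skew_mult_assoc:
  assumes f: "\<And>b. b > Nf \<Longrightarrow> f b = 0" and g: "\<And>b. b > Ng \<Longrightarrow> g b = 0"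
    and h: "\<And>b. b > Nh \<Longrightarrow> h b = 0"
  shows "skew_mult (skew_mult f g) h e = skew_mult f (skew_mult g h) e"
proof -
  define A where "A = {e - Nh - Ng..Nf}"
  define B where "B = {e - Nh..Nf + Ng}"
  have fg: "skew_mult f g b = 0" if "b > Nf + Ng" for b
    using that by (intro skew_mult_bounded(2)[OF f g])
  have gh: "skew_mult g h b = 0" if "b > Ng + Nh" for b
    using that by (intro skew_mult_bounded(2)[OF g h])
  have "skew_mult (skew_mult f g) h e = (\<Sum>b\<in>B. skew_mult f g b * twist b (h (e - b)))"
    unfolding B_def by (rule skew_mult_bounded(1)[OF fg h])
  also have "\<dots> = (\<Sum>b\<in>B. (\<Sum>a\<in>A. f a * twist a (g (b - a))) * twist b (h (e - b)))"
  proof (intro sum.cong refl arg_cong2[where f = "(*)"] skew_mult_eq_sum)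
    fix b a assume "b \<in> B" "f a \<noteq> 0" "g (b - a) \<noteq> 0"
    thus "a \<in> A" using f[of a] g[of "b - a"] by (force simp: A_def B_def)
  qed (auto simp: A_def)
  also have "\<dots> = (\<Sum>a\<in>A. \<Sum>b\<in>B. f a * twist a (g (b - a)) * twist b (h (e - b)))"
    unfolding sum_distrib_right by (rule sum.swap)
  also have "\<dots> = (\<Sum>a\<in>A. f a * twist a (skew_mult g h (e - a)))"
  proof (intro sum.cong refl)
    fix a assume a: "a \<in> A"
    have "skew_mult g h (e - a) =
      (\<Sum>c\<in>(\<lambda>b. b - a) ` B. g c * twist c (h (e - a - c)))"
    proof (rule skew_mult_eq_sum)
      fix c assume "g c \<noteq> 0" "h (e - a - c) \<noteq> 0"
      hence "c + a \<in> B" using a g[of c] h[of "e - a - c"] by (force simp: A_def B_def)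
      thus "c \<in> (\<lambda>b. b - a) ` B" by force
    qed (auto simp: B_def)
    also have "\<dots> = (\<Sum>b\<in>B. g (b - a) * twist (b - a) (h (e - b)))"
      by (subst sum.reindex) (auto simp: inj_on_def)
    finally show "(\<Sum>b\<in>B. f a * twist a (g (b - a)) * twist b (h (e - b))) =
        f a * twist a (skew_mult g h (e - a))"
      by (simp add: twist_sum twist_mult twist_twist sum_distrib_left mult.assoc)
  qed
  also have "\<dots> = skew_mult f (skew_mult g h) e"
  proof (rule skew_mult_eq_sum[symmetric])
    fix a assume "f a \<noteq> 0" "skew_mult g h (e - a) \<noteq> 0"
    thus "a \<in> A" using f[of a] gh[of "e - a"] by (force simp: A_def)
  qed (auto simp: A_def)
  finally show ?thesis .
qed

instantiation skew_series :: ring_1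
begin

lift_definition zero_skew_series :: skew_series is "\<lambda>_. 0" by auto

lift_definition one_skew_series :: skew_series is "\<lambda>b. if b = 0 then 1 else 0"
  by (auto intro: exI[of _ 0])

lift_definition plus_skew_series :: "skew_series \<Rightarrow> skew_series \<Rightarrow> skew_series"
  is "\<lambda>f g b. f b + g b"
proof -
  fix f g :: "int \<Rightarrow> (int \<Rightarrow>\<^sub>0 laurent)"
  assume "\<exists>N. \<forall>b>N. f b = 0" "\<exists>N. \<forall>b>N. g b = 0"
  then obtain N N' where "\<forall>b>N. f b = 0" "\<forall>b>N'. g b = 0" by blast
  thus "\<exists>N. \<forall>b>N. f b + g b = 0" by (intro exI[of _ "max N N'"]) auto
qed

lift_definition uminus_skew_series :: "skew_series \<Rightarrow> skew_series" is "\<lambda>f b. - f b" by auto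

lift_definition minus_skew_series :: "skew_series \<Rightarrow> skew_series \<Rightarrow> skew_series"
  is "\<lambda>f g b. f b - g b"
proof -
  fix f g :: "int \<Rightarrow> (int \<Rightarrow>\<^sub>0 laurent)"
  assume "\<exists>N. \<forall>b>N. f b = 0" "\<exists>N. \<forall>b>N. g b = 0"
  then obtain N N' where "\<forall>b>N. f b = 0" "\<forall>b>N'. g b = 0" by blast
  thus "\<exists>N. \<forall>b>N. f b - g b = 0" by (intro exI[of _ "max N N'"]) auto
qed

lift_definition times_skew_series :: "skew_series \<Rightarrow> skew_series \<Rightarrow> skew_series" is skew_mult
proof -
  fix f g :: "int \<Rightarrow> (int \<Rightarrow>\<^sub>0 laurent)"
  assume "\<exists>N. \<forall>b>N. f b = 0" "\<exists>N. \<forall>b>N. g b = 0"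
  then obtain N N' where "\<And>b. b > N \<Longrightarrow> f b = 0" "\<And>b. b > N' \<Longrightarrow> g b = 0" by blast
  from skew_mult_bounded(2)[of N f N' g, OF this] show "\<exists>N. \<forall>b>N. skew_mult f g b = 0"
    by blast
qed

instance
proof
  fix f g h :: skew_series
  show "f * g * h = f * (g * h)"
  proof transfer
    fix f g h :: "int \<Rightarrow> (int \<Rightarrow>\<^sub>0 laurent)"
    assume "\<exists>N. \<forall>b>N. f b = 0" "\<exists>N. \<forall>b>N. g b = 0" "\<exists>N. \<forall>b>N. h b = 0"
    then obtain Nf Ng Nh where "\<And>b. b > Nf \<Longrightarrow> f b = 0" "\<And>b. b > Ng \<Longrightarrow> g b = 0"
      "\<And>b. b > Nh \<Longrightarrow> h b = 0" by blast
    from skew_mult_assoc[of Nf f Ng g Nh h, OF this] show "skew_mult (skew_mult f g) h = skew_mult f (skew_mult g h)"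
      by blast
  qed
  show "(f + g) * h = f * h + g * h"
  proof transfer
    fix f g h :: "int \<Rightarrow> (int \<Rightarrow>\<^sub>0 laurent)"
    assume "\<exists>N. \<forall>b>N. f b = 0" "\<exists>N. \<forall>b>N. g b = 0" "\<exists>N. \<forall>b>N. h b = 0"
    then obtain Nf Ng Nh where N: "\<And>b. b > Nf \<Longrightarrow> f b = 0" "\<And>b. b > Ng \<Longrightarrow> g b = 0"
      "\<And>b. b > Nh \<Longrightarrow> h b = 0" by blast
    have *: "b \<in> {d - Nh..max Nf Ng}" if "f b \<noteq> 0 \<or> g b \<noteq> 0" "h (d - b) \<noteq> 0" for b d
      using N(1,2)[of b] N(3)[of "d - b"] that by force
    show "skew_mult (\<lambda>b. f b + g b) h = (\<lambda>b. skew_mult f h b + skew_mult g h b)"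
    proof
      fix d
      have "skew_mult (\<lambda>b. f b + g b) h d =
          (\<Sum>b\<in>{d - Nh..max Nf Ng}. (f b + g b) * twist b (h (d - b)))"
        by (intro skew_mult_eq_sum *) auto
      moreover have "skew_mult f h d = (\<Sum>b\<in>{d - Nh..max Nf Ng}. f b * twist b (h (d - b)))"
        by (intro skew_mult_eq_sum *) auto
      moreover have "skew_mult g h d = (\<Sum>b\<in>{d - Nh..max Nf Ng}. g b * twist b (h (d - b)))"
        by (intro skew_mult_eq_sum *) auto
      ultimately show "skew_mult (\<lambda>b. f b + g b) h d = skew_mult f h d + skew_mult g h d"
        by (simp add: distrib_right sum.distrib)
    qed
  qed
  show "h * (f + g) = h * f + h * g"
  proof transfer
    fix f g h :: "int \<Rightarrow> (int \<Rightarrow>\<^sub>0 laurent)"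
    assume "\<exists>N. \<forall>b>N. f b = 0" "\<exists>N. \<forall>b>N. g b = 0" "\<exists>N. \<forall>b>N. h b = 0"
    then obtain Nf Ng Nh where N: "\<And>b. b > Nf \<Longrightarrow> f b = 0" "\<And>b. b > Ng \<Longrightarrow> g b = 0"
      "\<And>b. b > Nh \<Longrightarrow> h b = 0" by blast
    have *: "b \<in> {d - max Nf Ng..Nh}" if "h b \<noteq> 0" "f (d - b) \<noteq> 0 \<or> g (d - b) \<noteq> 0" for b d
      using N(1,2)[of "d - b"] N(3)[of b] that by force
    show "skew_mult h (\<lambda>b. f b + g b) = (\<lambda>b. skew_mult h f b + skew_mult h g b)"
    proof
      fix d
      have "skew_mult h (\<lambda>b. f b + g b) d =
          (\<Sum>b\<in>{d - max Nf Ng..Nh}. h b * twist b (f (d - b) + g (d - b)))"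
        by (intro skew_mult_eq_sum *) auto
      moreover have "skew_mult h f d = (\<Sum>b\<in>{d - max Nf Ng..Nh}. h b * twist b (f (d - b)))"
        by (intro skew_mult_eq_sum *) auto
      moreover have "skew_mult h g d = (\<Sum>b\<in>{d - max Nf Ng..Nh}. h b * twist b (g (d - b)))"
        by (intro skew_mult_eq_sum *) auto
      ultimately show "skew_mult h (\<lambda>b. f b + g b) d = skew_mult h f d + skew_mult h g d"
        by (simp add: distrib_left sum.distrib twist_add)
    qed
  qed
  show "1 * f = f"
  proof transfer
    fix f :: "int \<Rightarrow> (int \<Rightarrow>\<^sub>0 laurent)"
    show "skew_mult (\<lambda>b. if b = 0 then 1 else 0) f = f"
    proof
      fix d
      show "skew_mult (\<lambda>b. if b = 0 then 1 else 0) f d = f d"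
        by (subst skew_mult_eq_sum[of "{0}"]) (auto split: if_splits)
    qed
  qed
  show "f * 1 = f"
  proof transfer
    fix f :: "int \<Rightarrow> (int \<Rightarrow>\<^sub>0 laurent)"
    show "skew_mult f (\<lambda>b. if b = 0 then 1 else 0) = f"
    proof
      fix d
      show "skew_mult f (\<lambda>b. if b = 0 then 1 else 0) d = f d"
        by (subst skew_mult_eq_sum[of "{d}"]) (auto split: if_splits)
    qed
  qed
  show "(0::skew_series) \<noteq> 1"
    by transfer (auto simp: fun_eq_iff)
qed (transfer; simp add: fun_eq_iff algebra_simps)+

end

instance skew_series :: ring_1_no_zero_divisors
proof
  fix f g :: skew_series
  assume "f \<noteq> 0" "g \<noteq> 0"
  thus "f * g \<noteq> 0"
  proof transfer
    fix f g :: "int \<Rightarrow> (int \<Rightarrow>\<^sub>0 laurent)"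
    assume *: "\<exists>N. \<forall>b>N. f b = 0" "\<exists>N. \<forall>b>N. g b = 0" "f \<noteq> (\<lambda>_. 0)" "g \<noteq> (\<lambda>_. 0)"
    have lead: "\<exists>d. h d \<noteq> 0 \<and> (\<forall>b>d. h b = 0)"
      if "\<exists>N. \<forall>b>N. h b = 0" "h \<noteq> (\<lambda>_. 0)" for h :: "int \<Rightarrow> (int \<Rightarrow>\<^sub>0 laurent)"
    proof -
      from that obtain N c where N: "\<And>b. b > N \<Longrightarrow> h b = 0" and c: "h c \<noteq> 0" by (auto simp: fun_eq_iff)
      let ?S = "{b. h b \<noteq> 0 \<and> b \<ge> c}"
      have "?S \<subseteq> {c..N}" using N by force
      hence fin: "finite ?S" by (rule finite_subset) auto
      have "Max ?S \<in> ?S" using c by (intro Max_in[OF fin]) auto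
      moreover have "h b = 0" if "b > Max ?S" for b
      proof (rule ccontr)
        assume "h b \<noteq> 0"
        moreover have "c \<le> Max ?S" using c by (intro Max_ge[OF fin]) auto
        ultimately have "b \<in> ?S" using that by auto
        thus False using Max_ge[OF fin] that by fastforce
      qed
      ultimately show ?thesis by blast
    qed
    obtain d where d: "f d \<noteq> 0" "\<And>b. b > d \<Longrightarrow> f b = 0" using lead[of f] * by blast
    obtain e where e: "g e \<noteq> 0" "\<And>b. b > e \<Longrightarrow> g b = 0" using lead[of g] * by blast
    have "skew_mult f g (d + e) = f d * twist d (g e)"
      by (subst skew_mult_bounded(1)[OF d(2) e(2)]) auto
    also have "\<dots> \<noteq> 0" using d e by simp
    finally show "skew_mult f g \<noteq> (\<lambda>_. 0)" by auto
  qed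
qed

text \<open>\<open>skew_monom c a b\<close> is the normal-ordered monomial \<open>c Q\<^sub>0^a Q\<^sub>1^b\<close>.\<close>

definition skew_monom :: "laurent \<Rightarrow> int \<Rightarrow> int \<Rightarrow> skew_series" where
  "skew_monom c a b = Abs_skew_series (\<lambda>d. if d = b then Poly_Mapping.single a c else 0)"

lemma coeff_Q1_monom:
  "coeff_Q1 (skew_monom c a b) = (\<lambda>d. if d = b then Poly_Mapping.single a c else 0)"
  unfolding skew_monom_def by (rule Abs_skew_series_inverse) (auto intro!: exI[of _ b])

lemma skew_monom_mult:
  "skew_monom c a b * skew_monom c' a' b' = skew_monom (c * c' * u_pow (2 * b * a')) (a + a') (b + b')"
proof -
  have "coeff_Q1 (skew_monom c a b * skew_monom c' a' b') d =
      coeff_Q1 (skew_monom (c * c' * u_pow (2 * b * a')) (a + a') (b + b')) d" for d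
    unfolding times_skew_series.rep_eq coeff_Q1_monom
    by (subst skew_mult_eq_sum[of "{b}"])
      (auto simp: twist_single mult_single algebra_simps split: if_splits)
  thus ?thesis by (simp add: coeff_Q1_inject[symmetric] fun_eq_iff)
qed

lemma skew_monom_one: "skew_monom 1 0 0 = 1"
  by (simp add: coeff_Q1_inject[symmetric] fun_eq_iff coeff_Q1_monom one_skew_series.rep_eq)

lemma skew_monom_minus: "- skew_monom c a b = skew_monom (- c) a b"
  by (simp add: coeff_Q1_inject[symmetric] fun_eq_iff coeff_Q1_monom uminus_skew_series.rep_eq
      single_uminus)

definition t_elem :: skew_series where
  "t_elem = skew_monom (u_pow (- 2)) 0 0"

lemma t_elem_central: "f * t_elem = t_elem * f"
proof -
  have "coeff_Q1 (f * t_elem) d = coeff_Q1 f d * Poly_Mapping.single 0 (u_pow (- 2))" for d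
    unfolding times_skew_series.rep_eq coeff_Q1_monom t_elem_def
    by (subst skew_mult_eq_sum[of "{d}"]) (auto simp: twist_single split: if_splits)
  moreover have "coeff_Q1 (t_elem * f) d = Poly_Mapping.single 0 (u_pow (- 2)) * coeff_Q1 f d" for d
    unfolding times_skew_series.rep_eq coeff_Q1_monom t_elem_def
    by (subst skew_mult_eq_sum[of "{0}"]) (auto simp: twist_single split: if_splits)
  ultimately show ?thesis
    by (simp add: coeff_Q1_inject[symmetric] fun_eq_iff mult.commute)
qed

lemma t_elem_inv: "t_elem * skew_monom (u_pow 2) 0 0 = 1"
  by (simp add: t_elem_def skew_monom_mult u_pow_mult skew_monom_one)

lemma t_elem_nonzero: "t_elem \<noteq> 0"
  using t_elem_inv by auto

lemma t_elem_square: "t_elem * t_elem \<noteq> 1"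
proof
  assume "t_elem * t_elem = 1"
  hence "coeff_Q1 (skew_monom (u_pow (- 4)) 0 0) 0 = coeff_Q1 (skew_monom (u_pow 0) 0 0) 0"
    by (simp add: t_elem_def skew_monom_mult u_pow_mult skew_monom_one)
  hence "Poly_Mapping.lookup (Poly_Mapping.single 0 (u_pow (- 4))) (0::int) =
      Poly_Mapping.lookup (Poly_Mapping.single 0 (u_pow 0)) 0"
    unfolding coeff_Q1_monom by simp
  thus False unfolding lookup_single_eq u_pow_eq_iff by simp
qed


section \<open>The quantum Q-system\<close>

definition quantum_Q_system :: "(int \<Rightarrow> skew_series) \<Rightarrow> bool" where
  "quantum_Q_system Q \<longleftrightarrow>
    Q 0 = skew_monom 1 1 0 \<and> Q 1 = skew_monom 1 0 1 \<and>
    (\<forall>j. t_elem * Q (j + 1) * Q (j - 1) = Q j ^ 2 - 1)"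

definition Qhat :: "int \<Rightarrow> skew_series" where
  "Qhat = (THE Q. quantum_Q_system Q)"

text \<open>
  Existence and uniqueness of the solution. Existence rests on the linear recurrence
  \<open>Q (j + 1) = C Q j - t Q (j - 1)\<close> with a conserved quantity \<open>C\<close>, a Laurent polynomial.
\<close>

context
  fixes t ti C :: "'a :: ring_1"
  assumes t_central: "\<And>x. x * t = t * x" and t_inv: "t * ti = 1"
begin

definition consecutive :: "'a \<times> 'a \<Rightarrow> bool" where
  "consecutive = (\<lambda>(x, y). x * y = t * y * x \<and> y * C = t * C * y - t * t * x + x \<and>
    C * x = t * x * C - t * t * y + y \<and> C * x * y = y * y + t * t * x * x - 1)"

lemma ti_t: "ti * t = 1"
  using t_inv t_central[of ti] by simp

lemma consecutive_up:
  assumes "consecutive (x, y)"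
  shows "consecutive (y, C * y - t * x)"
proof -
  note c = t_central[of x] t_central[of y] t_central[of C]
  have c': "x * (t * z) = t * (x * z)" "y * (t * z) = t * (y * z)" "C * (t * z) = t * (C * z)" for z
    by (simp_all add: mult.assoc[symmetric] c)
  from assms have a: "x * y = t * (y * x)" "y * C = t * (C * y) - t * (t * x) + x"
      "C * x = t * (x * C) - t * (t * y) + y" "C * (x * y) = y * y + t * (t * (x * x)) - 1"
    unfolding consecutive_def prod.case mult.assoc by blast+
  have a3: "t * (x * C) = C * x + t * (t * y) - y" using a(3) by simp
  have a': "x * (y * z) = t * (y * (x * z))" "y * (C * z) = t * (C * (y * z)) - t * (t * (x * z)) + x * z"
      "t * (x * (C * z)) = C * (x * z) + t * (t * (y * z)) - y * z"
      for z
    using arg_cong[OF a(1), of "\<lambda>w. w * z"] arg_cong[OF a(2), of "\<lambda>w. w * z"]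
      arg_cong[OF a3, of "\<lambda>w. w * z"] by (simp_all add: algebra_simps)
  have 1: "y * (C * y - t * x) = t * (C * y - t * x) * y"
    by (simp add: algebra_simps c c' a(1) a')
  have "(C * y - t * x) * C = C * (y * C) - t * (x * C)"
    by (simp add: algebra_simps)
  also have "\<dots> = C * (t * (C * y) - t * (t * x) + x) - (C * x + t * (t * y) - y)"
    unfolding a(2) a3 ..
  finally have 2: "(C * y - t * x) * C = t * C * (C * y - t * x) - t * t * y + y"
    by (simp add: algebra_simps c c')
  have "t * y * C = t * (t * (C * y) - t * (t * x) + x)"
    using a(2) by (simp add: mult.assoc)
  hence 3: "C * y = t * y * C - t * t * (C * y - t * x) + (C * y - t * x)"
    by (simp add: algebra_simps c c')
  have "t * (x * (C * y - t * x)) = t * (x * (C * y)) - t * (t * (t * (x * x))) + t * (t * (t * (x * x)))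
     - t * (t * (x * x))"
    by (simp add: algebra_simps c c')
  also have "\<dots> = t * (t * (y * y)) - 1"
    using a(4) unfolding a'(3) by (simp add: algebra_simps)
  finally have "(C * y - t * x) * (C * y - t * x) = C * y * (C * y - t * x) - (t * (t * (y * y)) - 1)"
    by (simp add: left_diff_distrib mult.assoc)
  hence 4: "C * y * (C * y - t * x) = (C * y - t * x) * (C * y - t * x) + t * t * y * y - 1"
    by (simp add: mult.assoc)
  show ?thesis using 1 2 3 4 by (simp add: consecutive_def)
qed

lemma consecutive_down:
  assumes "consecutive (x, y)"
  shows "consecutive (ti * (C * x - y), x)"
proof -
  define v where "v = ti * (C * x - y)"
  have tv: "C * x = t * v + y"
    unfolding v_def mult.assoc[symmetric] t_inv by simp
  note c = t_central[of x] t_central[of y] t_central[of C] t_central[of v]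
  have c': "x * (t * z) = t * (x * z)" "y * (t * z) = t * (y * z)" "C * (t * z) = t * (C * z)"
     "v * (t * z) = t * (v * z)" for z
    by (simp_all add: mult.assoc[symmetric] c)
  have cancel: "p = r" if "t * p = t * r" for p r
    using arg_cong[OF that, of "\<lambda>w. ti * w"] by (simp add: mult.assoc[symmetric] ti_t)
  from assms have a: "x * y = t * (y * x)" "y * C = t * (C * y) - t * (t * x) + x"
      "C * x = t * (x * C) - t * (t * y) + y" "C * (x * y) = y * y + t * (t * (x * x)) - 1"
    unfolding consecutive_def prod.case mult.assoc by blast+
  have xC: "x * C = v + t * y"
    by (rule cancel) (use a(3) tv in \<open>simp add: algebra_simps\<close>)
  have xCx: "(x * C) * x = x * (C * x)" by (simp add: mult.assoc)
  have 1: "v * x = t * x * v"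
    using xCx unfolding xC tv
    by (simp add: algebra_simps a(1) c c')
  have 2: "x * C = t * C * x - t * t * v + v"
    unfolding xC mult.assoc tv by (simp add: algebra_simps)
  have "t * v * C = (C * x - y) * C" by (simp add: tv)
  also have "\<dots> = C * (x * C) - y * C" by (simp add: algebra_simps)
  also have "\<dots> = C * v + t * t * x - x"
    unfolding xC a(2) by (simp add: algebra_simps c c')
  finally have 3: "C * v = t * v * C - t * t * x + x" by simp
  have "(C * v + t * t * x - x) * x = t * v * (C * x)"
    using 3 by (simp add: mult.assoc)
  also have "\<dots> = t * t * v * v + t * v * y"
    unfolding tv by (simp add: algebra_simps c c')
  also have "t * v * y = C * (x * y) - y * y"
    using tv by (simp add: algebra_simps flip: mult.assoc)
  finally have 4: "C * v * x = x * x + t * t * v * v - 1"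
    unfolding a(4) by (simp add: algebra_simps)
  show ?thesis unfolding v_def[symmetric] using 1 2 3 4 by (simp add: consecutive_def)
qed

definition step_up :: "'a \<times> 'a \<Rightarrow> 'a \<times> 'a" where
  "step_up = (\<lambda>(x, y). (y, C * y - t * x))"

definition step_down :: "'a \<times> 'a \<Rightarrow> 'a \<times> 'a" where
  "step_down = (\<lambda>(x, y). (ti * (C * x - y), x))"

definition iterate_pair :: "'a \<times> 'a \<Rightarrow> int \<Rightarrow> 'a \<times> 'a" where
  "iterate_pair s j = (if j \<ge> 0 then (step_up ^^ nat j) s else (step_down ^^ nat (- j)) s)"

lemma iterate_pair_Suc: "iterate_pair s (j + 1) = step_up (iterate_pair s j)"
proof (cases "j \<ge> 0")
  case True
  hence "nat (j + 1) = Suc (nat j)" by simp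
  thus ?thesis using True by (simp add: iterate_pair_def)
next
  case False
  have *: "step_up (step_down p) = p" for p
    by (simp add: step_up_def step_down_def case_prod_unfold t_inv mult.assoc[symmetric])
  have "iterate_pair s j = step_down (iterate_pair s (j + 1))"
  proof (cases "j = -1")
    case True
    thus ?thesis by (simp add: iterate_pair_def)
  next
    case neq: False
    hence "nat (- j) = Suc (nat (- (j + 1)))" using False by simp
    thus ?thesis using False neq by (simp add: iterate_pair_def)
  qed
  thus ?thesis by (simp add: *)
qed

lemma consecutive_iterate:
  assumes "consecutive s"
  shows "consecutive (iterate_pair s j)"
proof -
  have up: "consecutive ((step_up ^^ n) s)" for n
    by (induction n) (use assms consecutive_up in \<open>auto simp: step_up_def split: prod.splits\<close>)
  have down: "consecutive ((step_down ^^ n) s)" for n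
    by (induction n) (use assms consecutive_down in \<open>auto simp: step_down_def split: prod.splits\<close>)
  show ?thesis using up down by (simp add: iterate_pair_def)
qed

lemma iterate_pair_Q_system:
  assumes "consecutive s"
  defines "Q \<equiv> \<lambda>j. fst (iterate_pair s j)"
  shows "t * Q (j + 1) * Q (j - 1) = Q j ^ 2 - 1"
    and "consecutive (Q (j - 1), Q j)"
proof -
  obtain x y where xy: "iterate_pair s (j - 1) = (x, y)" by fastforce
  have j: "iterate_pair s j = (y, C * y - t * x)"
    using iterate_pair_Suc[of s "j - 1"] by (simp add: xy step_up_def)
  have j1: "fst (iterate_pair s (j + 1)) = C * y - t * x"
    using iterate_pair_Suc[of s j] by (simp add: j step_up_def)
  have con: "consecutive (x, y)"
    using consecutive_iterate[OF assms(1), of "j - 1"] by (simp add: xy)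
  thus "consecutive (Q (j - 1), Q j)" by (simp add: Q_def xy j)
  from con have xy': "x * y = t * y * x" "C * x * y = y * y + t * t * x * x - 1"
    unfolding consecutive_def prod.case by blast+
  have "t * (C * y - t * x) * x = C * (t * y * x) - t * t * x * x"
    by (simp add: algebra_simps t_central[of C])
      (simp add: t_central[of C] flip: mult.assoc)
  also have "C * (t * y * x) = C * x * y"
    by (simp only: mult.assoc xy'(1))
  finally have "t * (C * y - t * x) * x = y * y - 1"
    unfolding xy'(2) by simp
  thus "t * Q (j + 1) * Q (j - 1) = Q j ^ 2 - 1"
    by (simp add: Q_def xy j j1 power2_eq_square)
qed

end

lemma ex_quantum_Q_system:
  "\<exists>Q. quantum_Q_system Q \<and> (\<forall>j. Q j \<noteq> 0)"
proof -
  define x y where "x = skew_monom 1 1 0" and "y = skew_monom 1 0 1"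
  define ti where "ti = skew_monom (u_pow 2) 0 0"
  define C where "C = skew_monom (u_pow (- 2)) (- 1) 1 + skew_monom (u_pow (- 2)) 1 (- 1)
    - skew_monom (u_pow 2) (- 1) (- 1)"
  have t: "\<And>z. z * t_elem = t_elem * z" "t_elem * ti = 1"
    by (simp_all add: t_elem_central t_elem_inv ti_def)
  note con_def = consecutive_def[OF t, of C]
  have con: "consecutive t_elem C (x, y)"
    unfolding con_def prod.case
    by (simp add: x_def y_def C_def t_elem_def skew_monom_mult u_pow_mult algebra_simps skew_monom_one)
  define Q where "Q = (\<lambda>j. fst (iterate_pair t_elem ti C (x, y) j))"
  have sys: "t_elem * Q (j + 1) * Q (j - 1) = Q j ^ 2 - 1"
    "consecutive t_elem C (Q (j - 1), Q j)" for j
    unfolding Q_def by (rule iterate_pair_Q_system[OF t con])+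
  have "Q 0 = x" "Q 1 = y"
    using iterate_pair_Suc[OF t, of C "(x, y)" 0]
    by (simp_all add: Q_def iterate_pair_def[OF t] step_up_def[OF t])
  hence "quantum_Q_system Q"
    unfolding quantum_Q_system_def using sys(1) x_def y_def by blast
  moreover have "Q j \<noteq> 0" for j
  proof
    assume 0: "Q j = 0"
    from sys(2)[of j]
    have f: "Q j * C = t_elem * C * Q j - t_elem * t_elem * Q (j - 1) + Q (j - 1)"
      "C * Q (j - 1) * Q j = Q j * Q j + t_elem * t_elem * Q (j - 1) * Q (j - 1) - 1"
      unfolding con_def prod.case by blast+
    have 1: "t_elem * t_elem * Q (j - 1) = Q (j - 1)"
      using f(1) unfolding 0 by (simp add: algebra_simps)
    have 2: "t_elem * t_elem * Q (j - 1) * Q (j - 1) = 1"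
      using f(2) unfolding 0 by simp
    have "(t_elem * t_elem - 1) * Q (j - 1) = 0" using 1 by (simp add: algebra_simps)
    with t_elem_square have "Q (j - 1) = 0" by simp
    with 2 show False by simp
  qed
  ultimately show ?thesis by blast
qed

lemma quantum_Q_system_unique:
  assumes Q: "quantum_Q_system Q" "\<And>j. Q j \<noteq> 0" and Q': "quantum_Q_system Q'"
  shows "Q' = Q"
proof -
  have rec: "t_elem * P (j + 1) * P (j - 1) = P j ^ 2 - 1" if "P = Q \<or> P = Q'" for P j
    using that Q(1) Q' unfolding quantum_Q_system_def by blast
  have up: "Q' (j + 1) = Q (j + 1)" if "Q' j = Q j" "Q' (j - 1) = Q (j - 1)" for j
  proof -
    have "t_elem * Q' (j + 1) * Q (j - 1) = t_elem * Q (j + 1) * Q (j - 1)"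
      using rec[of Q j] rec[of Q' j] that by simp
    thus ?thesis using Q(2) t_elem_nonzero by simp
  qed
  have down: "Q' (j - 1) = Q (j - 1)" if "Q' j = Q j" "Q' (j + 1) = Q (j + 1)" for j
  proof -
    have "t_elem * Q (j + 1) * Q' (j - 1) = t_elem * Q (j + 1) * Q (j - 1)"
      using rec[of Q j] rec[of Q' j] that by simp
    thus ?thesis using Q(2) t_elem_nonzero by simp
  qed
  have "Q' j = Q j \<and> Q' (j + 1) = Q (j + 1)" for j
  proof (induction j rule: int_induct[where k = 0])
    case base
    thus ?case using Q(1) Q' by (simp add: quantum_Q_system_def)
  next
    case (step1 i)
    thus ?case using up[of "i + 1"] by simp
  next
    case (step2 i)
    thus ?case using down[of i] by simp
  qed
  thus ?thesis by blast
qed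

lemma quantum_Q_system_Qhat: "quantum_Q_system Qhat"
  unfolding Qhat_def
  using ex_quantum_Q_system quantum_Q_system_unique by (metis theI)

lemma Qhat_nonzero: "Qhat j \<noteq> 0"
  using ex_quantum_Q_system quantum_Q_system_unique quantum_Q_system_Qhat by metis


section \<open>Inverses, the limit \<open>z\<close> and the constant term\<close>

definition ring_inv :: "'a::ring_1 \<Rightarrow> 'a" where
  "ring_inv x = (THE y. x * y = 1 \<and> y * x = 1)"

lemma ring_inv_unique: "x * y = 1 \<Longrightarrow> y * x = 1 \<Longrightarrow> ring_inv x = y"
  unfolding ring_inv_def by (rule the_equality) (auto, metis mult.assoc mult.left_neutral mult.right_neutral)

text \<open>
  Coefficientwise convergence as series in the inverse of \<open>Q\<^sub>1\<close>: every coefficient is eventually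
  constant.
\<close>

definition coeffwise_limit :: "(nat \<Rightarrow> skew_series) \<Rightarrow> skew_series \<Rightarrow> bool" where
  "coeffwise_limit X f \<longleftrightarrow> (\<forall>b. eventually (\<lambda>k. coeff_Q1 (X k) b = coeff_Q1 f b) sequentially)"

lemma coeffwise_limit_unique:
  assumes "coeffwise_limit X f" "coeffwise_limit X g"
  shows "f = g"
proof -
  have "coeff_Q1 f b = coeff_Q1 g b" for b
  proof -
    have "eventually (\<lambda>k. coeff_Q1 f b = coeff_Q1 g b) sequentially"
      using assms[unfolded coeffwise_limit_def, rule_format, of b] by eventually_elim simp
    thus ?thesis by simp
  qed
  thus ?thesis by (simp add: coeff_Q1_inject[symmetric] fun_eq_iff)
qed

definition zhat :: skew_series where
  "zhat = (THE f. coeffwise_limit (\<lambda>k. Qhat (int k) * ring_inv (Qhat (int k + 1))) f)"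

text \<open>
  The constant term in \<open>Q\<^sub>1\<close> is a Laurent polynomial in \<open>Q\<^sub>0\<close>, whose value at \<open>Q\<^sub>0 = 1\<close> is the sum
  of its coefficients.
\<close>

definition CT_Q1 :: "skew_series \<Rightarrow> (int \<Rightarrow>\<^sub>0 laurent)" where
  "CT_Q1 f = coeff_Q1 f 0"

definition at_Q0_one :: "(int \<Rightarrow>\<^sub>0 laurent) \<Rightarrow> laurent" where
  "at_Q0_one p = (\<Sum>a\<in>Poly_Mapping.keys p. Poly_Mapping.lookup p a)"

end

theory Submission
  imports Defs
begin

text \<open>
  Both sides satisfy the same two recurrences in \<open>n\<close>, with \<open>e\<^sub>j\<close> the unit vectors. The first one, for
  \<open>n\<^sub>j \<ge> 2\<close>, replaces \<open>n\<close> by \<open>n + e\<^sub>j\<^sub>-\<^sub>1 + e\<^sub>j\<^sub>+\<^sub>1 - 2 e\<^sub>j\<close> and \<open>n - 2 e\<^sub>j\<close>; it is the \<open>Q\<close>-system relation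
  for the constant term and the \<open>q\<close>-Pascal rule for the binomial with index \<open>j\<close> in the fermionic sum.
  The second one raises the largest part of \<open>n\<close> at the cost of changing \<open>l\<close> by one. For the constant
  term it comes from the conserved quantity \<open>C\<close> of the \<open>Q\<close>-system, which satisfies
  \<open>Q\<^sub>k C = t Q\<^sub>k\<^sub>+\<^sub>1 + Q\<^sub>k\<^sub>-\<^sub>1\<close> and \<open>C z = 1 + t z\<^sup>2\<close>. For the fermionic sum it is obtained by applying the
  Pascal recurrence along a chain of vectors with one negative entry that moves off to infinity.
  The two recurrences reduce every \<open>n\<close> to the trivial cases of weight \<open>\<Sum>i. i n\<^sub>i \<le> 1\<close>. The level
  \<open>l = -1\<close>, where the fermionic sum is empty, occurs on the way; there the constant term vanishes since
  right multiplication by \<open>C\<close> preserves the series that have no powers \<open>Q\<^sub>1^b\<close>, \<open>b \<le> 0\<close>, at \<open>Q\<^sub>0 = 1\<close>.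

  The condition \<open>\<Sum>i. i n\<^sub>i \<le> 2 k\<close> forces \<open>m\<^sub>i = 0\<close> for \<open>i > k\<close>, so \<open>k\<close> may be replaced by any larger
  number, which gives the recurrences the room they need.
\<close>

section \<open>Quantum binomials\<close>

lemma q_pow_add: "q_pow (a + b) = q_pow a * q_pow b"
  by (simp add: q_pow_def u_pow_mult algebra_simps)

lemma q_pow_0 [simp]: "q_pow 0 = 1"
  by (simp add: q_pow_def)

text \<open>Multiplying the generating product for \<open>b + 1\<close> by its last denominator
  \<open>1 - q^(b+1) x\<close> gives the product for \<open>b\<close>; the rule compares the
  coefficients of \<open>x^(a+1)\<close>.\<close>

lemma q_binom_recurrence_bottom:
  "q_binom (Suc a) (int (Suc b)) =
     q_binom (Suc a) (int b) + q_pow (int (Suc b)) * q_binom a (int (Suc b))"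
proof -
  define g where "g = (\<lambda>i::nat. 1 - fps_const (q_pow (int i)) * fps_X)"
  define F where "F = (\<lambda>b. \<Prod>i=0..b. fps_right_inverse (g i) 1)"
  have F: "q_binom a (int b) = fps_nth (F b) a" for a b
    by (simp add: q_binom_def F_def g_def)
  have "g (Suc b) * fps_right_inverse (g (Suc b)) 1 = 1"
    by (rule fps_right_inverse) (simp add: g_def)
  hence "g (Suc b) * F (Suc b) = F b"
    by (simp add: F_def mult.left_commute)
  hence "fps_nth (g (Suc b) * F (Suc b)) (Suc a) = fps_nth (F b) (Suc a)" by simp
  hence "fps_nth (F (Suc b)) (Suc a) - q_pow (int (Suc b)) * fps_nth (F (Suc b)) a =
      fps_nth (F b) (Suc a)"
    by (simp add: g_def left_diff_distrib mult.assoc)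
  thus ?thesis unfolding F by (simp add: algebra_simps)
qed

lemma q_binom_0_left: "b \<ge> 0 \<Longrightarrow> q_binom 0 b = 1"
proof -
  have "fps_nth (\<Prod>i\<in>I. fps_right_inverse (1 - fps_const (q_pow (int i)) * fps_X) 1) 0 = 1" for I
    by (induction I rule: infinite_finite_induct) simp_all
  thus "b \<ge> 0 \<Longrightarrow> q_binom 0 b = 1" by (simp add: q_binom_def)
qed

lemma q_binom_0_right: "q_binom a 0 = 1"
proof -
  define f where "f = (1 - fps_X :: laurent fps)"
  have *: "f * fps_right_inverse f 1 = 1"
    by (rule fps_right_inverse) (simp add: f_def)
  have "fps_nth (fps_right_inverse f 1) a = 1"
  proof (induction a)
    case (Suc a)
    from * have "fps_nth (f * fps_right_inverse f 1) (Suc a) = 0" by simp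
    thus ?case using Suc by (simp add: f_def left_diff_distrib)
  qed simp
  thus ?thesis by (simp add: q_binom_def f_def)
qed

text \<open>This is the Pascal rule with the power of \<open>q\<close> on the other summand. It
  follows from \<open>q_binom_recurrence_bottom\<close> by induction on
  \<open>a + b\<close>.\<close>

lemma q_binom_recurrence:
  "q_binom (Suc a) (int (Suc b)) =
     q_pow (int (Suc a)) * q_binom (Suc a) (int b) + q_binom a (int (Suc b))"
proof (induction "a + b" arbitrary: a b rule: less_induct)
  case less
  note P = q_binom_recurrence_bottom
  \<comment> \<open>\<open>left\<close> and \<open>right\<close> are the induction hypotheses at
    \<open>(a, b - 1)\<close> and \<open>(a - 1, b)\<close>, with boundary values where a
    predecessor does not exist.\<close>
  have left: "q_binom (Suc a) (int b) =
      (if b = 0 then 1 else q_pow (int (Suc a)) * q_binom (Suc a) (int (b - 1)) + q_binom a (int b))"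
    using less[of a "b - 1"] by (cases b) (simp_all add: q_binom_0_right)
  have right: "q_binom a (int (Suc b)) =
      (if a = 0 then 1 else q_pow (int a) * q_binom a (int b) + q_binom (a - 1) (int (Suc b)))"
    using less[of "a - 1" b] by (cases a) (simp_all add: q_binom_0_left)
  show ?case
  proof (cases a)
    case 0
    show ?thesis
    proof (cases b)
      case 0
      thus ?thesis using \<open>a = 0\<close> P[of a b] by (simp add: q_binom_0_left q_binom_0_right)
    next
      case (Suc b')
      have "q_pow 1 * (q_binom 1 (int b') + q_pow (1 + int b')) =
          q_pow 1 * (1 + q_pow 1 * q_binom 1 (int b'))"
        using P[of 0 b'] left \<open>a = 0\<close> Suc by (simp add: q_binom_0_left algebra_simps)
      thus ?thesis
        using P[of 0 b] P[of 0 b'] left \<open>a = 0\<close> Suc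
        by (simp add: q_binom_0_left algebra_simps flip: q_pow_add)
    qed
  next
    case (Suc a')
    show ?thesis
    proof (cases b)
      case 0
      thus ?thesis using P[of a b] P[of a' b] right Suc
        by (simp add: q_binom_0_right algebra_simps flip: q_pow_add)
    next
      case (Suc b')
      \<comment> \<open>By this identity the two Pascal rules give the same result in either
        order.\<close>
      have "q_pow (int (Suc a)) * q_pow (int b) = q_pow (int (Suc b)) * q_pow (int a)"
        by (simp add: algebra_simps flip: q_pow_add)
      moreover have "q_binom (Suc a) (int b) =
          q_pow (int (Suc a)) * q_binom (Suc a) (int b') + q_binom a (int b)"
        using left Suc by simp
      moreover have "q_binom a (int (Suc b)) =
          q_pow (int a) * q_binom a (int b) + q_binom a' (int (Suc b))"
        using right \<open>a = Suc a'\<close> by simp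
      moreover have "q_binom (Suc a) (int b) =
          q_binom (Suc a) (int b') + q_pow (int b) * q_binom a (int b)"
        using P[of a b'] Suc by simp
      moreover have "q_binom a (int (Suc b)) =
          q_binom a (int b) + q_pow (int (Suc b)) * q_binom a' (int (Suc b))"
        using P[of a' b] \<open>a = Suc a'\<close> by simp
      ultimately show ?thesis
        using P[of a b] by algebra
    qed
  qed
qed

section \<open>The form with matrix \<open>min i j\<close>\<close>

text \<open>The index 0 is allowed. Since the sums in \<open>A_apply\<close> and
  \<open>bilin_A\<close> start at 1, \<open>unit_vec 0\<close> is invisible there, so the neighbour
  \<open>j - 1\<close> of \<open>j = 1\<close> needs no separate case.\<close>

definition unit_vec :: "nat \<Rightarrow> nat \<Rightarrow> int" where
  "unit_vec a i = (if i = a then 1 else 0)"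

definition A_apply :: "nat \<Rightarrow> (nat \<Rightarrow> int) \<Rightarrow> nat \<Rightarrow> int" where
  "A_apply K x j = (\<Sum>i=1..K. int (min i j) * x i)"

lemma A_apply_add: "A_apply K (\<lambda>i. x i + y i) j = A_apply K x j + A_apply K y j"
  by (simp add: A_apply_def distrib_left sum.distrib)

lemma A_apply_diff: "A_apply K (\<lambda>i. x i - y i) j = A_apply K x j - A_apply K y j"
  by (simp add: A_apply_def right_diff_distrib sum_subtractf)

lemma A_apply_scale: "A_apply K (\<lambda>i. c * x i) j = c * A_apply K x j"
  by (simp add: A_apply_def sum_distrib_left algebra_simps)

lemma A_apply_unit_vec:
  assumes "a \<le> K"
  shows "A_apply K (unit_vec a) j = int (min a j)"
proof -
  have "A_apply K (unit_vec a) j = (\<Sum>i=1..K. if i = a then int (min i j) else 0)"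
    unfolding A_apply_def by (intro sum.cong) (auto simp: unit_vec_def)
  thus ?thesis using assms by auto
qed

lemma A_apply_0 [simp]: "A_apply K x 0 = 0"
  by (simp add: A_apply_def)

lemma A_apply_top: "K \<le> j \<Longrightarrow> A_apply K x j = (\<Sum>i=1..K. int i * x i)"
  unfolding A_apply_def by (intro sum.cong) auto

lemma A_apply_eventually_const:
  assumes "\<And>i. i > k \<Longrightarrow> i \<le> K \<Longrightarrow> x i = 0" "k \<le> j"
  shows "A_apply K x j = A_apply K x K"
  unfolding A_apply_def
proof (intro sum.cong refl)
  fix i assume "i \<in> {1..K}"
  thus "int (min i j) * x i = int (min i K) * x i"
    using assms by (cases "i \<le> k") auto
qed

text \<open>As a function of \<open>j\<close>, \<open>min i j\<close> is piecewise linear with a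
  single kink at \<open>j = i\<close>, so \<open>A\<close> inverts minus the second
  difference.\<close>

lemma A_apply_second_difference:
  assumes "1 \<le> j" "j \<le> K"
  shows "A_apply K x (j - 1) + A_apply K x (j + 1) - 2 * A_apply K x j = - x j"
proof -
  have "A_apply K x (j - 1) + A_apply K x (j + 1) - 2 * A_apply K x j =
      (\<Sum>i=1..K. (int (min i (j - 1)) + int (min i (j + 1)) - 2 * int (min i j)) * x i)"
    by (simp add: A_apply_def sum.distrib sum_subtractf sum_distrib_left algebra_simps)
  also have "\<dots> = (\<Sum>i=1..K. if i = j then - x i else 0)"
    using assms by (intro sum.cong) (auto simp: min_def)
  finally show ?thesis using assms by simp
qed

lemma bilin_A_apply_left: "bilin_A K x y = (\<Sum>j=1..K. A_apply K x j * y j)"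
  unfolding bilin_A_def A_apply_def
  by (subst sum.swap) (simp add: sum_distrib_left algebra_simps)

lemma bilin_A_commute: "bilin_A K x y = bilin_A K y x"
  unfolding bilin_A_def by (subst sum.swap) (simp add: algebra_simps min.commute)

lemma bilin_A_add_right: "bilin_A K x (\<lambda>i. y i + z i) = bilin_A K x y + bilin_A K x z"
  by (simp add: bilin_A_apply_left distrib_left sum.distrib)

lemma bilin_A_diff_right: "bilin_A K x (\<lambda>i. y i - z i) = bilin_A K x y - bilin_A K x z"
  by (simp add: bilin_A_apply_left right_diff_distrib sum_subtractf)

lemma bilin_A_scale_right: "bilin_A K x (\<lambda>i. c * y i) = c * bilin_A K x y"
  by (simp add: bilin_A_apply_left sum_distrib_left algebra_simps)

lemma bilin_A_add_left: "bilin_A K (\<lambda>i. y i + z i) x = bilin_A K y x + bilin_A K z x"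
  by (simp add: bilin_A_commute[of K _ x] bilin_A_add_right)

lemma bilin_A_diff_left: "bilin_A K (\<lambda>i. y i - z i) x = bilin_A K y x - bilin_A K z x"
  by (simp add: bilin_A_commute[of K _ x] bilin_A_diff_right)

lemma bilin_A_scale_left: "bilin_A K (\<lambda>i. c * y i) x = c * bilin_A K y x"
  by (simp add: bilin_A_commute[of K _ x] bilin_A_scale_right)

lemma bilin_A_unit_vec_right:
  assumes "a \<le> K"
  shows "bilin_A K x (unit_vec a) = A_apply K x a"
proof -
  have "bilin_A K x (unit_vec a) = (\<Sum>j=1..K. if j = a then A_apply K x j else 0)"
    unfolding bilin_A_apply_left by (intro sum.cong) (auto simp: unit_vec_def)
  thus ?thesis using assms by (cases "a = 0") auto
qed

lemma bilin_A_unit_vec_left: "a \<le> K \<Longrightarrow> bilin_A K (unit_vec a) x = A_apply K x a"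
  by (subst bilin_A_commute) (rule bilin_A_unit_vec_right)

lemmas bilin_A_simps = bilin_A_add_left bilin_A_add_right bilin_A_diff_left bilin_A_diff_right
  bilin_A_scale_left bilin_A_scale_right bilin_A_unit_vec_left bilin_A_unit_vec_right

lemmas A_apply_simps = A_apply_add A_apply_diff A_apply_scale A_apply_unit_vec

section \<open>Recurrences for fermionic sums\<close>

text \<open>Negative entries of \<open>n\<close> occur in the chain of recurrences in \<open>M_sum_level_recurrence\<close>.\<close>

definition vacancy :: "nat \<Rightarrow> (nat \<Rightarrow> nat) \<Rightarrow> (nat \<Rightarrow> int) \<Rightarrow> nat \<Rightarrow> int" where
  "vacancy K m n j = A_apply K n j - 2 * A_apply K (\<lambda>i. int (m i)) j"

text \<open>Row \<open>K\<close> of \<open>A\<close> is \<open>(1, ..., K)\<close>, so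
  \<open>q_zero = 0\<close> becomes the condition that the last vacancy equals \<open>l\<close>. The
  level is an integer because \<open>- 1\<close> occurs.\<close>

definition M_index :: "nat \<Rightarrow> int \<Rightarrow> (nat \<Rightarrow> int) \<Rightarrow> (nat \<Rightarrow> nat) set" where
  "M_index K l n = {m. (\<forall>i. i \<notin> {1..K} \<longrightarrow> m i = 0) \<and> vacancy K m n K = l \<and>
     (\<forall>j\<in>{1..K}. vacancy K m n j \<ge> 0)}"

definition M_term :: "nat \<Rightarrow> (nat \<Rightarrow> int) \<Rightarrow> (nat \<Rightarrow> nat) \<Rightarrow> laurent" where
  "M_term K n m = q_pow (bilin_A K (\<lambda>i. int (m i)) (\<lambda>i. int (m i) - n i)) *
     (\<Prod>i=1..K. q_binom (m i) (vacancy K m n i))"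

definition M_sum :: "nat \<Rightarrow> int \<Rightarrow> (nat \<Rightarrow> int) \<Rightarrow> laurent" where
  "M_sum K l n = (\<Sum>m\<in>M_index K l n. M_term K n m)"

section \<open>Bounds on the summation vectors\<close>

lemma vacancy_top: "vacancy K m n K = (\<Sum>i=1..K. int i * n i) - 2 * (\<Sum>i=1..K. int i * int (m i))"
  by (simp add: vacancy_def A_apply_top)

lemma M_index_bound:
  assumes "m \<in> M_index K l n" "1 \<le> i" "i \<le> K"
  shows "2 * (int i * int (m i)) \<le> (\<Sum>i=1..K. int i * n i) - l"
proof -
  have "int i * int (m i) \<le> (\<Sum>i=1..K. int i * int (m i))"
    using assms by (intro member_le_sum) auto
  thus ?thesis using assms(1) by (simp add: M_index_def vacancy_top)
qed

lemma finite_M_index: "finite (M_index K l n)"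
proof -
  define B where "B = nat ((\<Sum>i=1..K. int i * n i) - l)"
  have "M_index K l n \<subseteq> {m. \<forall>i. (i \<in> {1..K} \<longrightarrow> m i \<in> {0..B}) \<and> (i \<notin> {1..K} \<longrightarrow> m i = 0)}"
  proof safe
    fix m i assume m: "m \<in> M_index K l n" and i: "i \<in> {1..K}"
    have "1 * int (m i) \<le> int i * int (m i)" using i by (intro mult_right_mono) auto
    thus "m i \<in> {0..B}" using M_index_bound[OF m, of i] i by (simp add: B_def)
  qed (auto simp: M_index_def)
  moreover have "finite {m. \<forall>i. (i \<in> {1..K} \<longrightarrow> m i \<in> {0..B}) \<and> (i \<notin> {1..K} \<longrightarrow> m i = (0::nat))}"
    by (rule finite_set_of_finite_funs) auto
  ultimately show ?thesis by (rule finite_subset)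
qed

lemma M_sum_negative: "1 \<le> K \<Longrightarrow> l < 0 \<Longrightarrow> M_sum K l n = 0"
  by (force simp: M_sum_def M_index_def intro: sum.neutral)

text \<open>The boundary of the Pascal rule is absorbed into the conditionals. Only
  \<open>a = b = 0\<close> is excluded: there the value 1 has no predecessor.\<close>

lemma q_binom_pascal:
  assumes "b \<ge> 0" "a \<noteq> 0 \<or> b \<noteq> 0"
  shows "q_binom a b = (if b = 0 then 0 else q_pow (int a) * q_binom a (b - 1)) +
    (if a = 0 then 0 else q_binom (a - 1) b)"
proof -
  obtain b' where b': "b = int b'" using assms(1) nonneg_int_cases by blast
  show ?thesis
  proof (cases "a = 0 \<or> b' = 0")
    case True
    thus ?thesis using assms by (auto simp: q_binom_0_left q_binom_0_right b')
  next
    case False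
    then obtain a'' b'' where "a = Suc a''" "b' = Suc b''"
      by (metis not0_implies_Suc)
    thus ?thesis using q_binom_recurrence[of a'' b''] b' by simp
  qed
qed

text \<open>The Pascal rule is applied to the binomial with index \<open>j\<close> in every term.
  One summand lowers the vacancy at \<open>j\<close>, which amounts to passing to \<open>n'\<close>;
  the other lowers \<open>m j\<close>, which amounts to passing to \<open>n''\<close>. Only the
  entry at \<open>j\<close> is required to be positive, so the other entries may be
  negative.\<close>

lemma M_sum_recurrence:
  fixes n :: "nat \<Rightarrow> int"
  assumes j: "1 \<le> j" "j < K" and nj: "n j \<ge> 1"
  shows "M_sum K l n =
    M_sum K l (\<lambda>i. n i + (unit_vec (j - 1) i + unit_vec (j + 1) i - 2 * unit_vec j i)) +
    q_pow (int j - A_apply K n j) * M_sum K l (\<lambda>i. n i - 2 * unit_vec j i)"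
proof -
  define n' where "n' = (\<lambda>i. n i + (unit_vec (j - 1) i + unit_vec (j + 1) i - 2 * unit_vec j i))"
  define n'' where "n'' = (\<lambda>i. n i - 2 * unit_vec j i)"
  define mi where "mi = (\<lambda>m i. int ((m :: nat \<Rightarrow> nat) i))"
  \<comment> \<open>\<open>n'\<close> adds a second difference of unit vectors to \<open>n\<close>,
    and \<open>A\<close> turns it into a change at the index \<open>j\<close> alone.\<close>
  have An': "A_apply K n' i = A_apply K n i - unit_vec j i" for i
    using j unfolding n'_def by (simp add: A_apply_simps) (auto simp: unit_vec_def min_def)
  have An'': "A_apply K n'' i = A_apply K n i - 2 * int (min j i)" for i
    using j unfolding n''_def by (simp add: A_apply_simps)
  have vac': "vacancy K m n' i = vacancy K m n i - unit_vec j i" for m i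
    by (simp add: vacancy_def An')
  have up: "mi (m(j := Suc (m j))) = (\<lambda>i. mi m i + unit_vec j i)" for m
    by (auto simp: mi_def unit_vec_def)
  have vac'': "vacancy K (m(j := Suc (m j))) n i = vacancy K m n'' i" for m i
    using j up[of m] by (simp add: vacancy_def An'' mi_def A_apply_simps)
  \<comment> \<open>The extra \<open>m j\<close> in the exponent accounts for the factor
    \<open>q^(m j)\<close> of the Pascal rule.\<close>
  have Q': "bilin_A K (mi m) (\<lambda>i. mi m i - n' i) = bilin_A K (mi m) (\<lambda>i. mi m i - n i) + int (m j)" for m
  proof -
    have "bilin_A K (mi m) (\<lambda>i. mi m i - n' i) = bilin_A K (mi m) (\<lambda>i. mi m i - n i) -
      (A_apply K (mi m) (j - 1) + A_apply K (mi m) (j + 1) - 2 * A_apply K (mi m) j)"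
      using j unfolding n'_def by (simp add: bilin_A_simps)
    thus ?thesis using A_apply_second_difference[of j K "mi m"] j by (simp add: mi_def)
  qed
  have Q'': "bilin_A K (mi (m(j := Suc (m j)))) (\<lambda>i. mi (m(j := Suc (m j))) i - n i) =
      int j - A_apply K n j + bilin_A K (mi m) (\<lambda>i. mi m i - n'' i)" for m
    using j unfolding up n''_def by (simp add: bilin_A_simps A_apply_simps)
  have prod_split: "(\<Prod>i=1..K. f i) = f j * (\<Prod>i\<in>{1..K} - {j}. f i)" for f :: "nat \<Rightarrow> laurent"
    using j by (subst prod.remove[of _ j]) auto
  have T: "M_term K n m = (if vacancy K m n j = 0 then 0 else M_term K n' m) +
      (if m j = 0 then 0 else q_pow (int j - A_apply K n j) * M_term K n'' (m(j := m j - 1)))"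
    if m: "m \<in> M_index K l n" for m
  proof -
    have nonneg: "vacancy K m n i \<ge> 0" if "i \<le> K" for i
      using m that by (cases "i = 0") (auto simp: M_index_def vacancy_def)
    \<comment> \<open>The exceptional case of the Pascal rule cannot occur, by concavity of the vacancy numbers.\<close>
    have "m j \<noteq> 0 \<or> vacancy K m n j \<noteq> 0"
    proof (rule ccontr)
      assume *: "\<not> ?thesis"
      have "vacancy K m n (j - 1) + vacancy K m n (j + 1) - 2 * vacancy K m n j =
          (A_apply K n (j - 1) + A_apply K n (j + 1) - 2 * A_apply K n j) -
          2 * (A_apply K (mi m) (j - 1) + A_apply K (mi m) (j + 1) - 2 * A_apply K (mi m) j)"
        by (simp add: vacancy_def mi_def)
      also have "\<dots> = - n j + 2 * mi m j"
        using A_apply_second_difference[of j K n] A_apply_second_difference[of j K "mi m"] j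
        by simp
      finally have "vacancy K m n (j - 1) + vacancy K m n (j + 1) = - n j"
        using * by (simp add: mi_def)
      moreover have "vacancy K m n (j - 1) \<ge> 0" "vacancy K m n (j + 1) \<ge> 0"
        using j by (auto intro: nonneg)
      ultimately show False using nj by linarith
    qed
    hence pascal: "q_binom (m j) (vacancy K m n j) =
      (if vacancy K m n j = 0 then 0 else q_pow (int (m j)) * q_binom (m j) (vacancy K m n j - 1)) +
      (if m j = 0 then 0 else q_binom (m j - 1) (vacancy K m n j))"
      using j by (intro q_binom_pascal nonneg) auto
    define R where "R = (\<Prod>i\<in>{1..K} - {j}. q_binom (m i) (vacancy K m n i))"
    define c where "c = q_pow (bilin_A K (mi m) (\<lambda>i. mi m i - n i))"
    have "M_term K n m = c * (q_binom (m j) (vacancy K m n j) * R)"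
      unfolding M_term_def prod_split c_def R_def mi_def ..
    moreover have "M_term K n' m = c * (q_pow (int (m j)) * q_binom (m j) (vacancy K m n j - 1) * R)"
    proof -
      have "(\<Prod>i\<in>{1..K} - {j}. q_binom (m i) (vacancy K m n' i)) = R"
        unfolding R_def vac' by (intro prod.cong) (auto simp: unit_vec_def)
      thus ?thesis
        unfolding M_term_def prod_split using Q'[of m]
        by (simp add: vac' unit_vec_def c_def mi_def q_pow_add)
    qed
    moreover have "q_pow (int j - A_apply K n j) * M_term K n'' (m(j := m j - 1)) =
        c * (q_binom (m j - 1) (vacancy K m n j) * R)" if "m j \<noteq> 0"
    proof -
      define \<mu> where "\<mu> = m(j := m j - 1)"
      have m_eq: "m = \<mu>(j := Suc (\<mu> j))" using that by (auto simp: \<mu>_def)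
      have "(\<Prod>i\<in>{1..K} - {j}. q_binom (\<mu> i) (vacancy K \<mu> n'' i)) = R"
        unfolding R_def vac''[symmetric] m_eq[symmetric] by (intro prod.cong) (auto simp: \<mu>_def)
      moreover have "vacancy K \<mu> n'' j = vacancy K m n j" using vac''[of \<mu> j] m_eq by simp
      moreover have "c = q_pow (int j - A_apply K n j) *
          q_pow (bilin_A K (mi \<mu>) (\<lambda>i. mi \<mu> i - n'' i))"
        using Q''[of \<mu>] unfolding c_def m_eq[symmetric] by (simp add: q_pow_add)
      moreover have "\<mu> j = m j - 1" by (simp add: \<mu>_def)
      ultimately have "q_pow (int j - A_apply K n j) * M_term K n'' \<mu> =
          c * (q_binom (m j - 1) (vacancy K m n j) * R)"
        unfolding M_term_def prod_split by (simp add: mi_def mult.assoc)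
      thus ?thesis by (simp add: \<mu>_def)
    qed
    ultimately show ?thesis unfolding pascal by (auto simp: algebra_simps)
  qed
  let ?I = "M_index K l n"
  have "M_sum K l n = (\<Sum>m\<in>?I. if vacancy K m n j = 0 then 0 else M_term K n' m) +
     (\<Sum>m\<in>?I. if m j = 0 then 0 else q_pow (int j - A_apply K n j) * M_term K n'' (m(j := m j - 1)))"
    unfolding M_sum_def by (simp add: T sum.distrib cong: sum.cong)
  \<comment> \<open>Since \<open>j < K\<close>, the top condition is untouched, and the index set
    for \<open>n'\<close> is exactly the part of \<open>?I\<close> with nonzero vacancy at
    \<open>j\<close>.\<close>
  also have "(\<Sum>m\<in>?I. if vacancy K m n j = 0 then 0 else M_term K n' m) = M_sum K l n'"
  proof -
    have "M_index K l n' \<subseteq> ?I"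
      using j by (auto simp: M_index_def vac' unit_vec_def split: if_splits)
    moreover have "m \<in> M_index K l n'" if "m \<in> ?I" "vacancy K m n j \<noteq> 0" for m
    proof -
      have "vacancy K m n j > 0" using that j by (force simp: M_index_def)
      thus ?thesis using that j by (auto simp: M_index_def vac' unit_vec_def)
    qed
    moreover have "vacancy K m n j \<noteq> 0" if "m \<in> M_index K l n'" for m
      using that j by (auto simp: M_index_def vac' unit_vec_def split: if_splits)
    ultimately show ?thesis
      unfolding M_sum_def by (intro sum.mono_neutral_cong_right finite_M_index) auto
  qed
  also have "(\<Sum>m\<in>?I. if m j = 0 then 0 else q_pow (int j - A_apply K n j) * M_term K n'' (m(j := m j - 1))) =
      (\<Sum>m\<in>{m\<in>?I. m j \<noteq> 0}. q_pow (int j - A_apply K n j) * M_term K n'' (m(j := m j - 1)))"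
    by (intro sum.mono_neutral_cong_right finite_M_index) auto
  also have "\<dots> = (\<Sum>m\<in>M_index K l n''. q_pow (int j - A_apply K n j) * M_term K n'' m)"
  \<comment> \<open>Vacancies depend on \<open>n - 2 m\<close> only, so lowering \<open>m j\<close>
    by one matches subtracting \<open>2\<close> from \<open>n j\<close>.\<close>
  proof (rule sum.reindex_bij_witness[of _ "\<lambda>m. m(j := Suc (m j))" "\<lambda>m. m(j := m j - 1)"])
    fix m assume m: "m \<in> {m \<in> ?I. m j \<noteq> 0}"
    define \<mu> where "\<mu> = m(j := m j - 1)"
    have m_eq: "m = \<mu>(j := Suc (\<mu> j))" using m by (auto simp: \<mu>_def)
    have "vacancy K \<mu> n'' i = vacancy K m n i" for i using vac''[of \<mu> i] m_eq by simp
    thus "m(j := m j - 1) \<in> M_index K l n''"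
      unfolding \<mu>_def[symmetric] using m by (auto simp: M_index_def \<mu>_def)
  next
    fix m assume "m \<in> M_index K l n''"
    thus "m(j := Suc (m j)) \<in> {m \<in> ?I. m j \<noteq> 0}"
      using j by (auto simp: M_index_def vac'')
  qed auto
  also have "\<dots> = q_pow (int j - A_apply K n j) * M_sum K l n''"
    by (simp add: M_sum_def sum_distrib_left)
  finally show ?thesis by (simp add: n'_def n''_def)
qed

text \<open>The bound on the weight forces \<open>m i = 0\<close> for \<open>i \<ge> a\<close>.
  Adding \<open>d\<close> moves only the vacancies from \<open>a\<close> on, from \<open>l\<close>
  to \<open>l + c\<close>, and the binomials there are 1 before and after. Hence a change of
  \<open>n\<close> near the top is the same as a change of level.\<close>

lemma M_sum_perturb_top:
  assumes a: "2 \<le> a" "a \<le> K"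
    and n: "\<And>i. a \<le> i \<Longrightarrow> i \<le> K \<Longrightarrow> n i = 0"
    and d: "\<And>i. i \<le> K \<Longrightarrow> A_apply K d i = (if a \<le> i then c else 0)"
    and size: "(\<Sum>i=1..K. int i * n i) - l < 2 * int a"
    and c: "l \<ge> 0 \<Longrightarrow> l + c \<ge> 0"
  shows "M_sum K (l + c) (\<lambda>i. n i + d i) = M_sum K l n"
proof -
  have vac: "vacancy K m (\<lambda>i. n i + d i) j = vacancy K m n j + (if a \<le> j then c else 0)"
    if "j \<le> K" for m j
    using that by (simp add: vacancy_def A_apply_add d)
  have m0: "m i = 0" if "\<forall>i. i \<notin> {1..K} \<longrightarrow> m i = 0" "vacancy K m n K = l" "a \<le> i" for m i
  proof (cases "i \<le> K")
    case True
    have "int i * int (m i) \<le> (\<Sum>i=1..K. int i * int (m i))"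
      using True a that by (intro member_le_sum) auto
    hence "2 * (int i * int (m i)) \<le> (\<Sum>i=1..K. int i * n i) - l"
      using that by (simp add: vacancy_top)
    hence *: "int i * int (m i) < int i" using size that by linarith
    show ?thesis
    proof (rule ccontr)
      assume "m i \<noteq> 0"
      hence "int i * 1 \<le> int i * int (m i)" by (intro mult_left_mono) auto
      with * show False by simp
    qed
  qed (use that in auto)
  \<comment> \<open>Both \<open>n\<close> and \<open>m\<close> vanish from \<open>a\<close> on, so
    the vacancies are constant already from \<open>a - 1\<close> on.\<close>
  have const: "vacancy K m n j = l"
    if m: "\<forall>i. i \<notin> {1..K} \<longrightarrow> m i = 0" "vacancy K m n K = l" and j: "a - 1 \<le> j" for m j
  proof -
    have "A_apply K n j = A_apply K n K"
      by (rule A_apply_eventually_const[OF _ j]) (use n in auto)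
    moreover have "A_apply K (\<lambda>i. int (m i)) j = A_apply K (\<lambda>i. int (m i)) K"
      by (rule A_apply_eventually_const[OF _ j]) (use m0[OF m] in auto)
    ultimately show ?thesis using m(2) by (simp add: vacancy_def)
  qed
  have "m \<in> M_index K (l + c) (\<lambda>i. n i + d i) \<longleftrightarrow> m \<in> M_index K l n" for m
  proof (cases "(\<forall>i. i \<notin> {1..K} \<longrightarrow> m i = 0) \<and> vacancy K m n K = l")
    case True
    hence T: "\<forall>i. i \<notin> {1..K} \<longrightarrow> m i = 0" "vacancy K m n K = l" by auto
    note co = const[OF T]
    have "(\<forall>j\<in>{1..K}. vacancy K m (\<lambda>i. n i + d i) j \<ge> 0) \<longleftrightarrow> (\<forall>j\<in>{1..K}. vacancy K m n j \<ge> 0)"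
    proof
      assume *: "\<forall>j\<in>{1..K}. vacancy K m (\<lambda>i. n i + d i) j \<ge> 0"
      \<comment> \<open>The vacancy at \<open>a - 1\<close> is \<open>l\<close> and is not affected
        by \<open>d\<close>, so \<open>l \<ge> 0\<close> is forced on both sides. This settles the
        level \<open>- 1\<close>, where both index sets are empty.\<close>
      have "a - 1 \<in> {1..K}" "\<not> a \<le> a - 1" "a - 1 \<le> K" using a by auto
      hence "l \<ge> 0" using *[rule_format, of "a - 1"] co[of "a - 1"] vac[of "a - 1" m] by simp
      thus "\<forall>j\<in>{1..K}. vacancy K m n j \<ge> 0"
        using * co by (fastforce simp: vac split: if_splits)
    next
      assume *: "\<forall>j\<in>{1..K}. vacancy K m n j \<ge> 0"
      have "l \<ge> 0" using *[rule_format, of K] a T by simp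
      thus "\<forall>j\<in>{1..K}. vacancy K m (\<lambda>i. n i + d i) j \<ge> 0"
        using * co c by (auto simp: vac)
    qed
    thus ?thesis using T a by (simp add: M_index_def vac)
  next
    case False
    thus ?thesis using a by (auto simp: M_index_def vac)
  qed
  hence "M_index K (l + c) (\<lambda>i. n i + d i) = M_index K l n" by blast
  moreover have "M_term K (\<lambda>i. n i + d i) m = M_term K n m" if m: "m \<in> M_index K l n" for m
  proof -
    have m': "\<forall>i. i \<notin> {1..K} \<longrightarrow> m i = 0" "vacancy K m n K = l" and l: "l \<ge> 0"
      using m a by (auto simp: M_index_def)
    \<comment> \<open>The exponent does not change, because \<open>A d\<close> lives on
      \<open>{a..K}\<close> and \<open>m\<close> lives below \<open>a\<close>.\<close>
    have "bilin_A K (\<lambda>i. int (m i)) d = (\<Sum>j=1..K. A_apply K d j * int (m j))"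
      by (subst bilin_A_commute) (rule bilin_A_apply_left)
    also have "\<dots> = 0" using m0[OF m'] by (intro sum.neutral) (auto simp: d)
    finally have "bilin_A K (\<lambda>i. int (m i)) d = 0" .
    hence "bilin_A K (\<lambda>i. int (m i)) (\<lambda>i. int (m i) - (n i + d i)) =
        bilin_A K (\<lambda>i. int (m i)) (\<lambda>i. int (m i) - n i)"
      by (simp add: bilin_A_simps)
    moreover have "q_binom (m i) (vacancy K m (\<lambda>i. n i + d i) i) = q_binom (m i) (vacancy K m n i)"
      if "i \<in> {1..K}" for i
      using that m0[OF m', of i] const[OF m', of i] c l by (auto simp: vac q_binom_0_left)
    ultimately show ?thesis by (simp add: M_term_def)
  qed
  ultimately show ?thesis by (simp add: M_sum_def)
qed

text \<open>The left side is \<open>X (k + 1) + Z (k - 1)\<close>. Moving the index up to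
  \<open>K\<close> gives \<open>X K + Z (K - 2)\<close>, where the perturbation of \<open>N\<close>
  sits at the top and \<open>M_sum_perturb_top\<close> trades it for a change of level, with
  \<open>c = 1\<close> and \<open>c = - 1\<close>.\<close>

lemma M_sum_level_recurrence:
  fixes N :: "nat \<Rightarrow> int"
  assumes k: "1 \<le> k" "k + 2 \<le> K" and l: "l \<ge> 0"
    and N: "\<And>i. i > k \<Longrightarrow> i \<le> K \<Longrightarrow> N i = 0" "\<And>i. N i \<ge> 0"
    and size: "(\<Sum>i=1..K. int i * N i) + 3 < 2 * int K"
  shows "M_sum K l (\<lambda>i. N i + (unit_vec (k + 1) i - unit_vec k i)) +
      M_sum K l (\<lambda>i. N i + (unit_vec (k - 1) i - unit_vec k i)) =
    M_sum K (l - 1) N + M_sum K (l + 1) N"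
proof -
  \<comment> \<open>\<open>X j + Z (j - 2)\<close> does not depend on \<open>j\<close>: the lower order terms of the Pascal recurrences for
    \<open>X j\<close> and \<open>Z (j - 1)\<close> agree.\<close>
  define X where "X = (\<lambda>j. M_sum K l (\<lambda>i. N i + (unit_vec j i - unit_vec (j - 1) i)))"
  define Z where "Z = (\<lambda>j. M_sum K l (\<lambda>i. N i + (unit_vec j i - unit_vec (j + 1) i)))"
  have step: "X j + Z (j - 2) = X (j + 1) + Z (j - 1)" if j: "k < j" "j < K" for j
  proof -
    define W where "W = M_sum K l (\<lambda>i. N i - unit_vec j i - unit_vec (j - 1) i)"
    \<comment> \<open>The two Pascal recurrences have exponents \<open>j - (A N + 1)\<close> and
      \<open>(j - 1) - A N\<close>, where \<open>A N\<close> is constant from \<open>k\<close> on;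
      hence one \<open>c\<close> serves both.\<close>
    define c where "c = q_pow (int j - 1 - A_apply K N K)"
    have const: "A_apply K N i = A_apply K N K" if "k \<le> i" for i
      by (rule A_apply_eventually_const[OF _ that]) (use N(1) in auto)
    have AN: "A_apply K N j = A_apply K N K" "A_apply K N (j - Suc 0) = A_apply K N K"
      by (rule const, use j in simp)+
    have "X j = X (j + 1) + c * W"
    proof -
      let ?n = "\<lambda>i. N i + (unit_vec j i - unit_vec (j - 1) i)"
      have 1: "(\<lambda>i. ?n i + (unit_vec (j - 1) i + unit_vec (j + 1) i - 2 * unit_vec j i)) =
          (\<lambda>i. N i + (unit_vec (j + 1) i - unit_vec (j + 1 - 1) i))"
        by auto
      have 2: "(\<lambda>i. ?n i - 2 * unit_vec j i) = (\<lambda>i. N i - unit_vec j i - unit_vec (j - 1) i)"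
        by auto
      have 3: "int j - A_apply K ?n j = int j - 1 - A_apply K N K"
        using j k by (simp add: A_apply_simps AN)
      have "?n j \<ge> 1" using N(2)[of j] j by (auto simp: unit_vec_def)
      thus ?thesis
        using M_sum_recurrence[of j K ?n l] j k unfolding 1 2 3 by (simp add: X_def W_def c_def)
    qed
    moreover have "Z (j - 1) = Z (j - 2) + c * W"
    proof -
      let ?n = "\<lambda>i. N i + (unit_vec (j - 1) i - unit_vec j i)"
      have j2: "j - 1 - 1 = j - 2" "j - 1 + 1 = j" "j - 2 + 1 = j - 1" using j k by auto
      have 1: "(\<lambda>i. ?n i + (unit_vec (j - 1 - 1) i + unit_vec (j - 1 + 1) i - 2 * unit_vec (j - 1) i)) =
          (\<lambda>i. N i + (unit_vec (j - 2) i - unit_vec (j - 1) i))"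
        unfolding j2 by auto
      have 2: "(\<lambda>i. ?n i - 2 * unit_vec (j - 1) i) = (\<lambda>i. N i - unit_vec j i - unit_vec (j - 1) i)"
        by auto
      have 3: "int (j - 1) - A_apply K ?n (j - 1) = int j - 1 - A_apply K N K"
        using j k by (simp add: A_apply_simps AN)
      have "?n (j - 1) \<ge> 1" using N(2)[of "j - 1"] j by (auto simp: unit_vec_def)
      thus ?thesis
        using M_sum_recurrence[of "j - 1" K ?n l] j k unfolding 1 2 3
        by (simp add: Z_def W_def c_def j2(3)[simplified])
    qed
    ultimately show ?thesis by simp
  qed
  have "X (k + 1) + Z (k - 1) = X j + Z (j - 2)" if "k + 1 \<le> j" "j \<le> K" for j
    using that
  proof (induction j rule: dec_induct)
    case (step j)
    thus ?case using \<open>\<And>j. k < j \<Longrightarrow> j < K \<Longrightarrow> X j + Z (j - 2) = X (j + 1) + Z (j - 1)\<close>[of j] by simp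
  qed simp
  hence "X (k + 1) + Z (k - 1) = X K + Z (K - 2)" using k by simp
  also have "X K = M_sum K (l - 1 + 1) (\<lambda>i. N i + (unit_vec K i - unit_vec (K - 1) i))"
    by (simp add: X_def)
  also have "\<dots> = M_sum K (l - 1) N"
    using k l size N(1) by (intro M_sum_perturb_top[of K]) (auto simp: A_apply_simps min_def)
  also have "Z (K - 2) = M_sum K (l + 1 + (- 1)) (\<lambda>i. N i + (unit_vec (K - 2) i - unit_vec (K - 1) i))"
  proof -
    have "Suc (K - 2) = K - Suc 0" using k by simp
    thus ?thesis by (simp add: Z_def)
  qed
  also have "\<dots> = M_sum K (l + 1) N"
    using k l size N(1) by (intro M_sum_perturb_top[of "K - 1"]) (auto simp: A_apply_simps min_def)
  finally show ?thesis using k by (simp add: X_def Z_def)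
qed

text \<open>Weight at most 1 and \<open>l \<ge> 0\<close> leave only \<open>m = 0\<close>, whose
  term is 1 and whose last vacancy is the weight.\<close>

lemma M_sum_base:
  fixes n :: "nat \<Rightarrow> int"
  assumes n: "\<And>i. n i \<ge> 0" and K: "1 \<le> K" and l: "l \<ge> 0"
    and size: "(\<Sum>i=1..K. int i * n i) \<le> 1"
  shows "M_sum K l n = (if l = (\<Sum>i=1..K. int i * n i) then 1 else 0)"
proof -
  have A0: "A_apply K (\<lambda>i. 0) j = 0" for j by (simp add: A_apply_def)
  have m0: "m = (\<lambda>_. 0)" if m: "m \<in> M_index K l n" for m
  proof
    fix i
    show "m i = 0"
    proof (cases "i \<in> {1..K}")
      case True
      hence "2 * (int i * int (m i)) \<le> 1" using M_index_bound[OF m, of i] l size by simp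
      moreover have "int i * 1 \<le> int i * int (m i)" if "m i \<noteq> 0"
        using that by (intro mult_left_mono) auto
      ultimately show ?thesis using True by fastforce
    qed (use m in \<open>auto simp: M_index_def\<close>)
  qed
  have vac: "vacancy K (\<lambda>_. 0) n j \<ge> 0" for j
    unfolding vacancy_def of_nat_0 A0 using n by (auto simp: A_apply_def intro: sum_nonneg)
  have top: "vacancy K (\<lambda>_. 0) n K = (\<Sum>i=1..K. int i * n i)"
    by (simp add: vacancy_top)
  have "M_index K l n = (if l = (\<Sum>i=1..K. int i * n i) then {\<lambda>_. 0} else {})"
  proof (cases "l = (\<Sum>i=1..K. int i * n i)")
    case True
    hence "(\<lambda>_. 0) \<in> M_index K l n" using vac top by (simp add: M_index_def)
    moreover have "M_index K l n \<subseteq> {\<lambda>_. 0}" using m0 by blast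
    ultimately have "M_index K l n = {\<lambda>_. 0}" by blast
    thus ?thesis using True by simp
  next
    case False
    have "m \<notin> M_index K l n" for m
    proof
      assume m: "m \<in> M_index K l n"
      with m0 have "(\<lambda>_. 0) \<in> M_index K l n" by metis
      thus False using False top by (simp add: M_index_def)
    qed
    thus ?thesis using False by auto
  qed
  moreover have "M_term K n (\<lambda>_. 0) = 1"
    using vac by (simp add: M_term_def bilin_A_def q_binom_0_left)
  ultimately show ?thesis by (simp add: M_sum_def)
qed

section \<open>Independence of the truncation\<close>

lemma A_apply_extend:
  assumes "k \<le> K" "\<And>i. i \<notin> {1..k} \<Longrightarrow> x i = 0"
  shows "A_apply K x j = A_apply k x j"
  unfolding A_apply_def using assms by (intro sum.mono_neutral_right) auto

lemma bilin_A_extend: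
  assumes "k \<le> K" "\<And>i. i \<notin> {1..k} \<Longrightarrow> x i = 0" "\<And>i. i \<notin> {1..k} \<Longrightarrow> y i = 0"
  shows "bilin_A K x y = bilin_A k x y"
proof -
  have "A_apply K x j = A_apply k x j" for j by (rule A_apply_extend[OF assms(1,2)])
  thus ?thesis
    unfolding bilin_A_apply_left using assms by simp (intro sum.mono_neutral_right, auto)
qed

context
  fixes k l :: nat and n :: "nat \<Rightarrow> nat"
  assumes k: "1 \<le> k" and n: "\<And>i. i \<notin> {1..k} \<Longrightarrow> n i = 0"
    and size: "(\<Sum>i=1..k. i * n i) \<le> 2 * k"
begin

lemma vacancy_extend:
  assumes "k \<le> K" "\<And>i. i \<notin> {1..k} \<Longrightarrow> m i = 0"
  shows "vacancy K m (\<lambda>i. int (n i)) j = vacancy k m (\<lambda>i. int (n i)) j"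
  using A_apply_extend[of k K "\<lambda>i. int (n i)"] A_apply_extend[of k K "\<lambda>i. int (m i)"] assms n
  by (simp add: vacancy_def)

text \<open>For \<open>i > k\<close> the weight bound gives \<open>i * m i \<le> k < i\<close>,
  hence \<open>m i = 0\<close>; the vacancies beyond \<open>k\<close> then repeat the one at
  \<open>k\<close>. This is where \<open>2 * k\<close> enters.\<close>

lemma M_index_extend:
  assumes K: "k \<le> K"
  shows "M_index K (int l) (\<lambda>i. int (n i)) = M_index k (int l) (\<lambda>i. int (n i))"
proof (rule set_eqI)
  fix m
  have supp: "\<forall>i. i \<notin> {1..k} \<longrightarrow> m i = 0" if m: "m \<in> M_index K (int l) (\<lambda>i. int (n i))"
  proof (intro allI impI)
    fix i assume i: "i \<notin> {1..k}"
    show "m i = 0"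
    proof (cases "i \<in> {1..K}")
      case True
      have "(\<Sum>i=1..K. int i * int (n i)) = (\<Sum>i=1..k. int i * int (n i))"
        using K n by (intro sum.mono_neutral_right) auto
      also have "\<dots> = int (\<Sum>i=1..k. i * n i)" by simp
      also have "\<dots> \<le> 2 * int k" using size by linarith
      finally have "int i * int (m i) \<le> int k"
        using M_index_bound[OF m, of i] True by simp
      also have "int k < int i" using True i by auto
      finally have *: "int i * int (m i) < int i" .
      show ?thesis
      proof (rule ccontr)
        assume "m i \<noteq> 0"
        hence "int i * 1 \<le> int i * int (m i)" by (intro mult_left_mono) auto
        with * show False by simp
      qed
    qed (use m in \<open>auto simp: M_index_def\<close>)
  qed
  have "m \<in> M_index K (int l) (\<lambda>i. int (n i)) \<longleftrightarrow> m \<in> M_index k (int l) (\<lambda>i. int (n i))"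
    if m: "\<forall>i. i \<notin> {1..k} \<longrightarrow> m i = 0"
  proof -
    have ext: "vacancy K m (\<lambda>i. int (n i)) j = vacancy k m (\<lambda>i. int (n i)) j" for j
      by (rule vacancy_extend[OF K]) (use m in auto)
    have const: "vacancy k m (\<lambda>i. int (n i)) j = vacancy k m (\<lambda>i. int (n i)) k" if "j \<ge> k" for j
      using that by (simp add: vacancy_def A_apply_top)
    have "(\<forall>j\<in>{1..K}. vacancy k m (\<lambda>i. int (n i)) j \<ge> 0) \<longleftrightarrow>
        (\<forall>j\<in>{1..k}. vacancy k m (\<lambda>i. int (n i)) j \<ge> 0)"
    proof
      assume *: "\<forall>j\<in>{1..k}. vacancy k m (\<lambda>i. int (n i)) j \<ge> 0"
      show "\<forall>j\<in>{1..K}. vacancy k m (\<lambda>i. int (n i)) j \<ge> 0"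
      proof
        fix j assume "j \<in> {1..K}"
        thus "vacancy k m (\<lambda>i. int (n i)) j \<ge> 0"
          using * const[of j] k by (cases "j \<le> k") auto
      qed
    qed (use K in auto)
    moreover have "\<forall>i. i \<notin> {1..K} \<longrightarrow> m i = 0" using m K by auto
    ultimately show ?thesis using m K const[of K] by (simp add: M_index_def ext)
  qed
  moreover have "\<forall>i. i \<notin> {1..k} \<longrightarrow> m i = 0" if "m \<in> M_index k (int l) (\<lambda>i. int (n i))"
    using that by (simp add: M_index_def)
  ultimately show "m \<in> M_index K (int l) (\<lambda>i. int (n i)) \<longleftrightarrow> m \<in> M_index k (int l) (\<lambda>i. int (n i))"
    using supp by blast
qed

text \<open>The additional binomials have \<open>m i = 0\<close> and a nonnegative vacancy, so they
  are 1.\<close>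

lemma M_sum_extend:
  assumes K: "k \<le> K"
  shows "M_sum K (int l) (\<lambda>i. int (n i)) = M_sum k (int l) (\<lambda>i. int (n i))"
proof -
  have "M_term K (\<lambda>i. int (n i)) m = M_term k (\<lambda>i. int (n i)) m"
    if m: "m \<in> M_index k (int l) (\<lambda>i. int (n i))" for m
  proof -
    have supp: "m i = 0" if "i \<notin> {1..k}" for i using m that by (auto simp: M_index_def)
    have ext: "vacancy K m (\<lambda>i. int (n i)) j = vacancy k m (\<lambda>i. int (n i)) j" for j
      by (rule vacancy_extend[OF K supp])
    have "bilin_A K (\<lambda>i. int (m i)) (\<lambda>i. int (m i) - int (n i)) =
        bilin_A k (\<lambda>i. int (m i)) (\<lambda>i. int (m i) - int (n i))"
      by (rule bilin_A_extend[OF K]) (simp_all add: supp n)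
    moreover have "(\<Prod>i=1..K. q_binom (m i) (vacancy k m (\<lambda>i. int (n i)) i)) =
        (\<Prod>i=1..k. q_binom (m i) (vacancy k m (\<lambda>i. int (n i)) i))"
    proof (rule prod.mono_neutral_right)
      show "\<forall>i\<in>{1..K} - {1..k}. q_binom (m i) (vacancy k m (\<lambda>i. int (n i)) i) = 1"
      proof
        fix i assume i: "i \<in> {1..K} - {1..k}"
        hence "k \<le> i" by auto
        hence "vacancy k m (\<lambda>i. int (n i)) i = vacancy k m (\<lambda>i. int (n i)) k"
          by (simp add: vacancy_def A_apply_top)
        also have "\<dots> \<ge> 0" using m by (simp add: M_index_def)
        finally show "q_binom (m i) (vacancy k m (\<lambda>i. int (n i)) i) = 1"
          using supp[of i] i by (simp add: q_binom_0_left)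
      qed
    qed (use K in auto)
    ultimately show ?thesis by (simp add: M_term_def ext)
  qed
  thus ?thesis by (simp add: M_sum_def M_index_extend[OF K])
qed

section \<open>Comparison with the sum without truncation\<close>

lemma p_full_vacancy:
  assumes "k \<le> K" "\<And>i. i \<notin> {1..K} \<Longrightarrow> m i = 0"
  shows "p_full m n j = vacancy K m (\<lambda>i. int (n i)) j"
proof -
  have "p_full m n j = (\<Sum>i=1..K. int (min i j) * (int (n i) - 2 * int (m i)))"
    unfolding p_full_def
  proof (rule Sum_any.expand_superset)
    show "{i. int (min i j) * (int (n i) - 2 * int (m i)) \<noteq> 0} \<subseteq> {1..K}"
    proof
      fix i assume "i \<in> {i. int (min i j) * (int (n i) - 2 * int (m i)) \<noteq> 0}"
      thus "i \<in> {1..K}" using assms n[of i] by (intro ccontr[of "i \<in> {1..K}"]) auto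
    qed
  qed simp
  thus ?thesis
    by (simp add: vacancy_def A_apply_def right_diff_distrib sum_subtractf sum_distrib_left algebra_simps)
qed

text \<open>A vector of the untruncated sum may a priori reach beyond \<open>k\<close>. Some
  \<open>K\<close> contains its support, and \<open>M_index_extend\<close> then brings it back to
  \<open>k\<close>.\<close>

lemma fermionic_index_full_eq: "fermionic_index_full l n = M_index k (int l) (\<lambda>i. int (n i))"
proof (rule set_eqI)
  fix m
  show "m \<in> fermionic_index_full l n \<longleftrightarrow> m \<in> M_index k (int l) (\<lambda>i. int (n i))"
  proof
    assume m: "m \<in> fermionic_index_full l n"
    then obtain N where N: "\<And>i. m i \<noteq> 0 \<Longrightarrow> i \<le> N"
      unfolding fermionic_index_full_def by (auto simp: finite_nat_set_iff_bounded_le)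
    define K where "K = max k N"
    have supp: "m i = 0" if "i \<notin> {1..K}" for i
    proof (rule ccontr)
      assume "m i \<noteq> 0"
      hence "i \<le> N" "i \<noteq> 0" using N[of i] m by (auto simp: fermionic_index_full_def intro: ccontr)
      thus False using that by (simp add: K_def)
    qed
    have K: "k \<le> K" by (simp add: K_def)
    have p: "p_full m n j = vacancy K m (\<lambda>i. int (n i)) j" for j
      by (rule p_full_vacancy[OF K supp])
    have "\<forall>\<^sub>F j in sequentially. p_full m n j = vacancy K m (\<lambda>i. int (n i)) K"
      \<comment> \<open>From \<open>K\<close> on all vacancies agree, so the limit is the vacancy at
        \<open>K\<close>.\<close>
      unfolding eventually_sequentially
      by (intro exI[of _ K]) (simp add: p vacancy_def A_apply_top)
    hence "p_full m n \<longlonglongrightarrow> vacancy K m (\<lambda>i. int (n i)) K" by (rule tendsto_eventually)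
    hence "vacancy K m (\<lambda>i. int (n i)) K = int l"
      using m LIMSEQ_unique by (auto simp: fermionic_index_full_def)
    hence "m \<in> M_index K (int l) (\<lambda>i. int (n i))"
      using m supp p by (auto simp: M_index_def fermionic_index_full_def)
    thus "m \<in> M_index k (int l) (\<lambda>i. int (n i))" by (simp add: M_index_extend[OF K])
  next
    assume m: "m \<in> M_index k (int l) (\<lambda>i. int (n i))"
    hence supp: "m i = 0" if "i \<notin> {1..k}" for i using that by (auto simp: M_index_def)
    have p: "p_full m n j = vacancy k m (\<lambda>i. int (n i)) j" for j
      by (rule p_full_vacancy[OF order_refl supp])
    have top: "p_full m n j = int l" if "j \<ge> k" for j
    proof -
      have "vacancy k m (\<lambda>i. int (n i)) j = vacancy k m (\<lambda>i. int (n i)) k"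
        using that by (simp add: vacancy_def A_apply_top)
      thus ?thesis using m by (simp add: p M_index_def)
    qed
    have "{i. m i \<noteq> 0} \<subseteq> {1..k}"
    proof
      fix i assume "i \<in> {i. m i \<noteq> 0}"
      thus "i \<in> {1..k}" using supp[of i] by (intro ccontr[of "i \<in> {1..k}"]) simp
    qed
    hence "finite {i. m i \<noteq> 0}" by (rule finite_subset) simp
    moreover have "p_full m n i \<ge> 0" if "i \<ge> 1" for i
    proof (cases "i \<le> k")
      case True
      thus ?thesis using that m by (simp add: p M_index_def)
    next
      case False
      thus ?thesis by (simp add: top)
    qed
    moreover have "p_full m n \<longlonglongrightarrow> int l"
      by (rule tendsto_eventually) (use top in \<open>auto simp: eventually_sequentially\<close>)
    ultimately show "m \<in> fermionic_index_full l n"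
      using supp by (simp add: fermionic_index_full_def)
  qed
qed

lemma fermionic_sum_full_eq: "fermionic_sum_full l n = M_sum k (int l) (\<lambda>i. int (n i))"
  unfolding fermionic_sum_full_def M_sum_def fermionic_index_full_eq
proof (rule sum.cong[OF refl])
  fix m assume m: "m \<in> M_index k (int l) (\<lambda>i. int (n i))"
  hence supp: "m i = 0" if "i \<notin> {1..k}" for i using that by (auto simp: M_index_def)
  have p: "p_full m n j = vacancy k m (\<lambda>i. int (n i)) j" for j
    by (rule p_full_vacancy[OF order_refl supp])
  have "m \<in> fermionic_index_full l n" using m by (simp add: fermionic_index_full_eq)
  hence "p_full m n i \<ge> 0" for i
    by (cases "i = 0") (simp_all add: p[of 0] fermionic_index_full_def vacancy_def)
  hence "Prod_any (\<lambda>i. q_binom (m i) (p_full m n i)) = (\<Prod>i=1..k. q_binom (m i) (p_full m n i))"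
    using supp by (intro Prod_any.expand_superset) (force simp: q_binom_0_left)+
  moreover have "Q_full m n = bilin_A k (\<lambda>i. int (m i)) (\<lambda>i. int (m i) - int (n i))"
  proof -
    have inner: "Sum_any (\<lambda>j. int (m i) * int (min i j) * (int (m j) - int (n j))) =
        (\<Sum>j=1..k. int (m i) * int (min i j) * (int (m j) - int (n j)))" for i
      using supp n by (intro Sum_any.expand_superset) force+
    show ?thesis unfolding Q_full_def inner bilin_A_def
      using supp by (intro Sum_any.expand_superset) (auto intro: ccontr)
  qed
  ultimately show "q_pow (Q_full m n) * Prod_any (\<lambda>i. q_binom (m i) (p_full m n i)) =
      M_term k (\<lambda>i. int (n i)) m"
    by (simp add: M_term_def p)
qed

end

lemma fermionic_sum_eq: "fermionic_sum k l n = M_sum k (int l) (\<lambda>i. int (n i))"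
proof -
  have p: "p_trunc k m n j = vacancy k m (\<lambda>i. int (n i)) j" for m j
    by (simp add: p_trunc_def vacancy_def A_apply_def right_diff_distrib sum_subtractf
      sum_distrib_left algebra_simps)
  have "q_zero k l m n = int l - vacancy k m (\<lambda>i. int (n i)) k" for m
    by (simp add: q_zero_def vacancy_top right_diff_distrib sum_subtractf sum_distrib_left algebra_simps)
  hence "fermionic_index k l n = M_index k (int l) (\<lambda>i. int (n i))"
    by (auto simp: fermionic_index_def M_index_def p)
  thus ?thesis
    by (simp add: fermionic_sum_def M_sum_def M_term_def Q_trunc_def p)
qed

section \<open>Degree and convergence in skew Laurent series\<close>

definition scal :: "int \<Rightarrow> skew_series" where
  "scal e = skew_monom (u_pow e) 0 0"

lemma skew_series_eqI: "(\<And>b. coeff_Q1 f b = coeff_Q1 g b) \<Longrightarrow> f = g"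
  by (simp add: coeff_Q1_inject[symmetric] fun_eq_iff)

lemma scal_0 [simp]: "scal 0 = 1"
  by (simp add: scal_def skew_monom_one)

lemma scal_mult: "scal a * scal b = scal (a + b)"
  by (simp add: scal_def skew_monom_mult u_pow_mult)

lemma scal_mult_left: "scal a * (scal b * f) = scal (a + b) * f"
  by (simp add: scal_mult flip: mult.assoc)

lemma t_elem_scal: "t_elem = scal (- 2)"
  by (simp add: scal_def t_elem_def)

lemma coeff_monom_mult_left:
  "coeff_Q1 (skew_monom c a 0 * f) d = Poly_Mapping.single a c * coeff_Q1 f d"
  unfolding times_skew_series.rep_eq coeff_Q1_monom
  by (subst skew_mult_eq_sum[of "{0}"]) (auto split: if_splits)

lemma coeff_mult_monom:
  "coeff_Q1 (f * skew_monom c a b) d =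
    coeff_Q1 f (d - b) * Poly_Mapping.single a (u_pow (2 * a * (d - b)) * c)"
  unfolding times_skew_series.rep_eq coeff_Q1_monom
  by (subst skew_mult_eq_sum[of "{d - b}"]) (auto simp: twist_single split: if_splits)

lemma scal_central: "f * scal e = scal e * f"
  unfolding scal_def
  by (rule skew_series_eqI) (simp add: coeff_monom_mult_left coeff_mult_monom mult.commute)

lemma scal_left_commute: "f * (scal e * g) = scal e * (f * g)"
  by (simp add: scal_central flip: mult.assoc)

text \<open>The guard keeps the simplifier from permuting nested scalars.\<close>

lemma scal_pull: "NO_MATCH (scal a) f \<Longrightarrow> f * (scal e * g) = scal e * (f * g)"
  by (rule scal_left_commute)

section \<open>The filtration by degree in \<open>Q_1\<close>\<close>

definition deg_le :: "skew_series \<Rightarrow> int \<Rightarrow> bool" where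
  "deg_le f d \<longleftrightarrow> (\<forall>b>d. coeff_Q1 f b = 0)"

lemma deg_le_mono: "deg_le f d \<Longrightarrow> d \<le> e \<Longrightarrow> deg_le f e"
  by (auto simp: deg_le_def)

lemma deg_le_ex: "\<exists>d. deg_le f d"
  using coeff_Q1[of f] by (auto simp: deg_le_def)

lemma deg_le_add: "deg_le f d \<Longrightarrow> deg_le g d \<Longrightarrow> deg_le (f + g) d"
  by (auto simp: deg_le_def plus_skew_series.rep_eq)

lemma deg_le_diff: "deg_le f d \<Longrightarrow> deg_le g d \<Longrightarrow> deg_le (f - g) d"
  by (auto simp: deg_le_def minus_skew_series.rep_eq)

lemma deg_le_mult: "deg_le f d \<Longrightarrow> deg_le g e \<Longrightarrow> deg_le (f * g) (d + e)"
  unfolding deg_le_def times_skew_series.rep_eq using skew_mult_bounded(2) by blast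

lemma deg_le_monom: "b \<le> d \<Longrightarrow> deg_le (skew_monom c a b) d"
  by (auto simp: deg_le_def coeff_Q1_monom)

lemma deg_le_one: "0 \<le> d \<Longrightarrow> deg_le 1 d"
  using deg_le_monom[of 0 d 1 0] by (simp add: skew_monom_one)

lemma deg_le_scal: "deg_le f d \<Longrightarrow> deg_le (scal e * f) d"
  using deg_le_mult[OF deg_le_monom[of 0 0 "u_pow e" 0], of f d] by (simp add: scal_def)

lemma deg_le_power:
  assumes "deg_le f (- 1)"
  shows "deg_le (f ^ n) (- int n)"
proof (induction n)
  case (Suc n)
  show ?case using deg_le_mult[OF assms Suc] by (simp add: algebra_simps)
qed (simp add: deg_le_one)

text \<open>All coefficients above any given degree agree eventually and simultaneously. This is
  stronger than \<open>coeffwise_limit\<close>, under which \<open>Q_1^k\<close> would tend to 0,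
  and it makes multiplication continuous.\<close>

definition deg_converges :: "(nat \<Rightarrow> skew_series) \<Rightarrow> skew_series \<Rightarrow> bool" where
  "deg_converges X f \<longleftrightarrow> (\<forall>d. \<forall>\<^sub>F k in sequentially. deg_le (X k - f) d)"

lemma deg_converges_coeffwise_limit:
  assumes "deg_converges X f"
  shows "coeffwise_limit X f"
  unfolding coeffwise_limit_def
proof
  fix b
  from assms have "\<forall>\<^sub>F k in sequentially. deg_le (X k - f) (b - 1)" by (simp add: deg_converges_def)
  thus "\<forall>\<^sub>F k in sequentially. coeff_Q1 (X k) b = coeff_Q1 f b"
    by eventually_elim (auto simp: deg_le_def minus_skew_series.rep_eq)
qed

lemma deg_converges_unique: "deg_converges X f \<Longrightarrow> deg_converges X g \<Longrightarrow> f = g"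
  using deg_converges_coeffwise_limit coeffwise_limit_unique by blast

lemma deg_converges_const: "deg_converges (\<lambda>_. f) f"
  by (simp add: deg_converges_def deg_le_def zero_skew_series.rep_eq)

lemma deg_converges_add:
  assumes "deg_converges X f" "deg_converges Y g"
  shows "deg_converges (\<lambda>k. X k + Y k) (f + g)"
  unfolding deg_converges_def
proof
  fix d
  have "\<forall>\<^sub>F k in sequentially. deg_le (X k - f) d" "\<forall>\<^sub>F k in sequentially. deg_le (Y k - g) d"
    using assms by (auto simp: deg_converges_def)
  thus "\<forall>\<^sub>F k in sequentially. deg_le (X k + Y k - (f + g)) d"
  proof eventually_elim
    case (elim k)
    thus ?case using deg_le_add[of "X k - f" d "Y k - g"] by (simp add: algebra_simps)
  qed
qed

lemma deg_converges_mult: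
  assumes "deg_converges X f" "deg_converges Y g"
  shows "deg_converges (\<lambda>k. X k * Y k) (f * g)"
  unfolding deg_converges_def
proof
  fix d
  obtain a where a: "deg_le f a" using deg_le_ex by blast
  obtain c where c: "deg_le g c" using deg_le_ex by blast
  \<comment> \<open>The bound \<open>c\<close> keeps the degree of \<open>Y k\<close> below that of
    \<open>g\<close>'s bound; \<open>d - a\<close> takes care of the product with
    \<open>f\<close>.\<close>
  have "\<forall>\<^sub>F k in sequentially. deg_le (X k - f) (d - c)"
    "\<forall>\<^sub>F k in sequentially. deg_le (Y k - g) (min c (d - a))"
    using assms by (auto simp: deg_converges_def)
  thus "\<forall>\<^sub>F k in sequentially. deg_le (X k * Y k - f * g) d"
  proof eventually_elim
    case (elim k)
    have "deg_le (Y k - g + g) c"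
      using elim(2) c by (intro deg_le_add) (auto elim: deg_le_mono)
    hence "deg_le ((X k - f) * Y k) (d - c + c)"
      using elim(1) by (intro deg_le_mult) auto
    moreover have "deg_le (f * (Y k - g)) (a + (d - a))"
      using elim(2) a by (intro deg_le_mult) (auto elim: deg_le_mono)
    ultimately have "deg_le ((X k - f) * Y k + f * (Y k - g)) d"
      by (intro deg_le_add) auto
    thus ?case by (simp add: algebra_simps)
  qed
qed

lemma deg_converges_Suc:
  assumes "deg_converges X f"
  shows "deg_converges (\<lambda>k. X (Suc k)) f"
  using assms unfolding deg_converges_def eventually_sequentially by (meson le_SucI)

text \<open>Such a sequence is Cauchy for the degree filtration, and the ring is complete. The
  explicit error bound is kept for degree estimates of the limit.\<close>

lemma deg_converges_exists:
  assumes "\<And>k. deg_le (X (Suc k) - X k) (- int k)"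
  shows "\<exists>f. deg_converges X f \<and> (\<forall>k. deg_le (X k - f) (- int k))"
proof -
  have step: "deg_le (X j - X k) (- int k)" if "k \<le> j" for j k
    using that
  proof (induction j rule: dec_induct)
    case (step j)
    have "deg_le ((X (Suc j) - X j) + (X j - X k)) (- int k)"
      using step assms[of j] by (intro deg_le_add) (auto elim: deg_le_mono)
    thus ?case by simp
  qed (simp add: deg_le_def zero_skew_series.rep_eq)
  obtain d where d: "deg_le (X 0) d" using deg_le_ex by blast
  \<comment> \<open>The coefficient at \<open>b\<close> is final as soon as \<open>- k < b\<close>,
    and \<open>nat (1 - b)\<close> is the first such \<open>k\<close>.\<close>
  define F where "F = (\<lambda>b. coeff_Q1 (X (nat (1 - b))) b)"
  have F: "coeff_Q1 (X k) b = F b" if "b > - int k" for k b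
  proof -
    have "nat (1 - b) \<le> k" using that by linarith
    hence "deg_le (X k - X (nat (1 - b))) (- int (nat (1 - b)))" by (rule step)
    thus ?thesis by (cases "b \<le> 1")
      (auto simp: F_def deg_le_def minus_skew_series.rep_eq)
  qed
  have "F b = 0" if "b > max 0 d" for b
    using that F[of 0 b] d by (auto simp: deg_le_def)
  hence "\<exists>N. \<forall>b>N. F b = 0" by blast
  hence coeff: "coeff_Q1 (Abs_skew_series F) = F"
    by (intro Abs_skew_series_inverse) simp
  have *: "deg_le (X k - Abs_skew_series F) (- int k)" for k
    unfolding deg_le_def minus_skew_series.rep_eq coeff using F by simp
  have "deg_converges X (Abs_skew_series F)"
    unfolding deg_converges_def
  proof
    fix e
    show "\<forall>\<^sub>F k in sequentially. deg_le (X k - Abs_skew_series F) e"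
      unfolding eventually_sequentially
    proof (intro exI[of _ "nat (- e)"] allI impI)
      fix k assume "nat (- e) \<le> k"
      thus "deg_le (X k - Abs_skew_series F) e" by (intro deg_le_mono[OF *]) linarith
    qed
  qed
  with * show ?thesis by blast
qed

text \<open>The inverse is the geometric series of \<open>g\<close>, which converges since
  \<open>g\<close> has negative degree.\<close>

lemma one_minus_inverse:
  assumes "deg_le g (- 1)"
  shows "\<exists>h. (1 - g) * h = 1 \<and> h * (1 - g) = 1 \<and> deg_le h 0"
proof -
  define S where "S = (\<lambda>n. \<Sum>i<n. g ^ i)"
  have "deg_le (S (Suc k) - S k) (- int k)" for k
    using deg_le_power[OF assms] by (simp add: S_def)
  then obtain h where h: "deg_converges S h" "\<And>k. deg_le (S k - h) (- int k)"
    using deg_converges_exists[of S] by blast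
  have g: "deg_converges (\<lambda>n. 1 - g ^ n) 1"
    unfolding deg_converges_def
  proof
    fix e
    have "deg_le (1 - g ^ k - 1) e" if "nat (- e) \<le> k" for k
    proof -
      have "deg_le (0 - g ^ k) (- int k)"
        using deg_le_power[OF assms] by (intro deg_le_diff) (auto simp: deg_le_def zero_skew_series.rep_eq)
      thus ?thesis using that by (auto elim: deg_le_mono)
    qed
    thus "\<forall>\<^sub>F k in sequentially. deg_le (1 - g ^ k - 1) e"
      unfolding eventually_sequentially by blast
  qed
  have "(1 - g) * S n = 1 - g ^ n" for n
  proof (induction n)
    case (Suc n)
    have "(1 - g) * S (Suc n) = (1 - g) * S n + (1 - g) * g ^ n"
      by (simp add: S_def distrib_left)
    also have "\<dots> = 1 - g ^ Suc n" unfolding Suc by (simp add: left_diff_distrib)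
    finally show ?case .
  qed (simp add: S_def)
  moreover have "deg_converges (\<lambda>n. (1 - g) * S n) ((1 - g) * h)"
    by (intro deg_converges_mult deg_converges_const h)
  ultimately have 1: "(1 - g) * h = 1"
    using deg_converges_unique g by simp
  have "S n * (1 - g) = 1 - g ^ n" for n
  proof (induction n)
    case (Suc n)
    have "S (Suc n) * (1 - g) = S n * (1 - g) + g ^ n * (1 - g)"
      by (simp add: S_def distrib_right)
    also have "\<dots> = 1 - g ^ Suc n" unfolding Suc by (simp add: right_diff_distrib power_commutes)
    finally show ?case .
  qed (simp add: S_def)
  moreover have "deg_converges (\<lambda>n. S n * (1 - g)) (h * (1 - g))"
    by (intro deg_converges_mult deg_converges_const h)
  ultimately have 2: "h * (1 - g) = 1"
    using deg_converges_unique g by simp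
  have "deg_le (S 0 - (S 0 - h)) 0"
    using h(2)[of 0] by (intro deg_le_diff) (auto simp: S_def deg_le_def zero_skew_series.rep_eq
      uminus_skew_series.rep_eq)
  with 1 2 show ?thesis by auto
qed

section \<open>The quantum Q-system and its conserved quantity\<close>

text \<open>This is \<open>(Q_2 + t Q_0) Q_1^(-1)\<close> in normal order.\<close>

definition C_elem :: skew_series where
  "C_elem = skew_monom (u_pow (- 2)) (- 1) 1 + skew_monom (u_pow (- 2)) 1 (- 1)
    - skew_monom (u_pow 2) (- 1) (- 1)"

lemma
  shows Qhat_0: "Qhat 0 = skew_monom 1 1 0"
    and Qhat_1: "Qhat 1 = skew_monom 1 0 1"
    and Qhat_system: "t_elem * Qhat (j + 1) * Qhat (j - 1) = Qhat j ^ 2 - 1"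
  using quantum_Q_system_Qhat by (auto simp: quantum_Q_system_def)

text \<open>Iterating the linear recurrence with \<open>C_elem\<close> from
  \<open>(Q_0, Q_1)\<close> solves the Q-system, so by uniqueness it yields \<open>Qhat\<close>. The
  relations are then the invariants stored in \<open>consecutive\<close>.\<close>

lemma
  shows Qhat_commute: "Qhat j * Qhat (j + 1) = scal (- 2) * (Qhat (j + 1) * Qhat j)"
    and C_Qhat: "C_elem * Qhat j = Qhat (j + 1) + scal (- 2) * Qhat (j - 1)"
    and Qhat_C: "Qhat j * C_elem = scal (- 2) * Qhat (j + 1) + Qhat (j - 1)"
proof -
  have t: "\<And>z. z * t_elem = t_elem * z" "t_elem * scal 2 = 1"
    by (rule t_elem_central) (simp add: t_elem_scal scal_mult)
  note con_def = consecutive_def[OF t, of C_elem]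
  define s where "s = (skew_monom 1 1 0, skew_monom 1 0 1)"
  have con: "consecutive t_elem C_elem s"
    unfolding con_def s_def prod.case
    by (simp add: C_elem_def t_elem_def skew_monom_mult u_pow_mult algebra_simps skew_monom_one)
  define P where "P = (\<lambda>j. iterate_pair t_elem (scal 2) C_elem s j)"
  have P_Suc: "P (j + 1) = (snd (P j), C_elem * snd (P j) - t_elem * fst (P j))" for j
    using iterate_pair_Suc[OF t, of C_elem s j] by (simp add: P_def step_up_def[OF t] case_prod_beta)
  have sys: "t_elem * fst (P (j + 1)) * fst (P (j - 1)) = fst (P j) ^ 2 - 1"
    "consecutive t_elem C_elem (fst (P (j - 1)), fst (P j))" for j
    unfolding P_def by (rule iterate_pair_Q_system[OF t con])+
  have "P 0 = s" by (simp add: P_def iterate_pair_def[OF t])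
  hence "fst (P 0) = skew_monom 1 1 0" "fst (P 1) = skew_monom 1 0 1"
    using P_Suc[of 0] by (simp_all add: s_def)
  hence "quantum_Q_system (\<lambda>j. fst (P j))"
    unfolding quantum_Q_system_def using sys(1) by simp
  hence P: "fst (P j) = Qhat j" for j
    using quantum_Q_system_unique[OF quantum_Q_system_Qhat Qhat_nonzero] by metis
  have 1: "Qhat (j - 1) * Qhat j = t_elem * Qhat j * Qhat (j - 1)"
    "Qhat j * C_elem = t_elem * C_elem * Qhat j - t_elem * t_elem * Qhat (j - 1) + Qhat (j - 1)" for j
    using sys(2)[of j] unfolding con_def prod.case P by auto
  show "Qhat j * Qhat (j + 1) = scal (- 2) * (Qhat (j + 1) * Qhat j)"
    using 1(1)[of "j + 1"] by (simp add: t_elem_scal mult.assoc)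
  have "fst (P (j + 1)) = C_elem * fst (P j) - t_elem * fst (P (j - 1))"
    using P_Suc[of j] P_Suc[of "j - 1"] by simp
  thus 2: "C_elem * Qhat j = Qhat (j + 1) + scal (- 2) * Qhat (j - 1)"
    by (simp add: P t_elem_scal)
  show "Qhat j * C_elem = scal (- 2) * Qhat (j + 1) + Qhat (j - 1)"
    using 1(2)[of j] 2 by (simp add: t_elem_scal mult.assoc algebra_simps)
qed

text \<open>This is the Q-system relation with the factors in increasing order, as the ordered
  products require. It comes from multiplying by \<open>Q_(j-1)\<close> on the right, commuting, and
  cancelling, as there are no zero divisors.\<close>

lemma Qhat_square: "Qhat j * Qhat j = scal 2 * (Qhat (j - 1) * Qhat (j + 1)) + scal 4"
proof -
  define x y z where "x = Qhat (j - 1)" and "y = Qhat j" and "z = Qhat (j + 1)"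
  have xy: "x * y = scal (- 2) * (y * x)"
    using Qhat_commute[of "j - 1"] by (simp add: x_def y_def)
  have sys: "scal (- 2) * (z * x) = y * y - 1"
    using Qhat_system[of j] by (simp add: x_def y_def z_def t_elem_scal power2_eq_square mult.assoc add.commute)
  have "scal (- 2) * (x * z) * x = x * (scal (- 2) * (z * x))"
    by (simp add: scal_pull mult.assoc)
  also have "\<dots> = x * y * y - x" unfolding sys by (simp add: algebra_simps)
  also have "x * y * y = scal (- 2) * (y * (x * y))" by (simp add: xy mult.assoc)
  also have "\<dots> = scal (- 4) * (y * y) * x"
    by (simp add: xy scal_pull scal_mult_left mult.assoc)
  finally have "(scal (- 2) * (x * z)) * x = (scal (- 4) * (y * y) - 1) * x"
    by (simp add: algebra_simps)
  hence "scal (- 2) * (x * z) = scal (- 4) * (y * y) - 1"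
    using Qhat_nonzero by (simp add: x_def)
  hence "scal 4 * (scal (- 2) * (x * z)) = scal 4 * (scal (- 4) * (y * y) - 1)" by simp
  thus ?thesis
    by (simp add: scal_mult_left right_diff_distrib x_def y_def z_def)
qed

text \<open>With \<open>x, y, z\<close> consecutive,
  \<open>z = t^(-1) y^2 (1 - y^(-2)) x^(-1)\<close>. The middle factor is inverted by a geometric
  series, as \<open>y^(-2)\<close> has negative degree.\<close>

lemma Qhat_unit:
  "deg_le (Qhat (int k)) (int k) \<and>
    (\<exists>R. Qhat (int k) * R = 1 \<and> R * Qhat (int k) = 1 \<and> deg_le R (- int k))"
proof (induction k rule: less_induct)
  case (less k)
  consider "k = 0" | "k = 1" | i where "k = i + 2"
    by (metis One_nat_def add_2_eq_Suc' not0_implies_Suc)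
  thus ?case
  proof cases
    case 1
    have "Qhat 0 * skew_monom 1 (- 1) 0 = 1" "skew_monom 1 (- 1) 0 * Qhat 0 = 1"
      by (simp_all add: Qhat_0 skew_monom_mult skew_monom_one)
    thus ?thesis using 1 by (auto simp: Qhat_0 deg_le_monom intro!: exI[of _ "skew_monom 1 (- 1) 0"])
  next
    case 2
    have "Qhat 1 * skew_monom 1 0 (- 1) = 1" "skew_monom 1 0 (- 1) * Qhat 1 = 1"
      by (simp_all add: Qhat_1 skew_monom_mult skew_monom_one)
    thus ?thesis using 2 by (auto simp: Qhat_1 deg_le_monom intro!: exI[of _ "skew_monom 1 0 (- 1)"])
  next
    case (3 i)
    define x y z where "x = Qhat (int i)" and "y = Qhat (int i + 1)" and "z = Qhat (int i + 2)"
    obtain Rx where Rx: "x * Rx = 1" "Rx * x = 1" "deg_le Rx (- int i)" and dx: "deg_le x (int i)"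
      using less[of i] 3 by (auto simp: x_def)
    obtain Ry where Ry: "y * Ry = 1" "Ry * y = 1" "deg_le Ry (- int (i + 1))"
      and dy: "deg_le y (int i + 1)"
      using less[of "i + 1"] 3 by (auto simp: y_def algebra_simps)
    have dRy2: "deg_le (Ry * Ry) (- 2 * int i - 2)"
      by (rule deg_le_mono[OF deg_le_mult[OF Ry(3) Ry(3)]]) simp
    hence "deg_le (Ry * Ry) (- 1)" by (rule deg_le_mono) simp
    then obtain h where h: "(1 - Ry * Ry) * h = 1" "h * (1 - Ry * Ry) = 1" "deg_le h 0"
      using one_minus_inverse by blast
    have sys: "scal (- 2) * (z * x) = y * y - 1"
      using Qhat_system[of "int i + 1"]
      by (simp add: x_def y_def z_def t_elem_scal power2_eq_square mult.assoc add.commute)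
    have "scal 2 * (y * y - 1) * Rx = scal 2 * (scal (- 2) * (z * x)) * Rx" unfolding sys ..
    also have "\<dots> = z" by (simp add: scal_mult_left mult.assoc Rx)
    finally have z: "z = scal 2 * ((y * y - 1) * Rx)" by (simp add: mult.assoc)
    have "deg_le ((y * y - 1) * Rx) (int i + 1 + (int i + 1) + (- int i))"
      by (intro deg_le_mult[OF _ Rx(3)] deg_le_diff deg_le_mult[OF dy dy] deg_le_one) simp
    hence dz: "deg_le z (int i + 2)" unfolding z by (intro deg_le_scal) simp
    have fact: "y * y - 1 = y * y * (1 - Ry * Ry)" "y * y - 1 = (1 - Ry * Ry) * (y * y)"
    proof -
      have "y * y * (Ry * Ry) = y * (y * Ry) * Ry" by (simp only: mult.assoc)
      thus "y * y - 1 = y * y * (1 - Ry * Ry)" by (simp add: right_diff_distrib Ry)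
      have "Ry * Ry * (y * y) = Ry * (Ry * y) * y" by (simp only: mult.assoc)
      thus "y * y - 1 = (1 - Ry * Ry) * (y * y)" by (simp add: left_diff_distrib Ry)
    qed
    have Rc: "Rx * (x * w) = w" "x * (Rx * w) = w" "Ry * (y * w) = w" "y * (Ry * w) = w"
      "h * ((1 - Ry * Ry) * w) = w" "(1 - Ry * Ry) * (h * w) = w" for w
      using Rx Ry h by (simp_all flip: mult.assoc)
    \<comment> \<open>This inverts the factorisation of \<open>z\<close> in reverse order:
      \<open>t x (1 - y^(-2))^(-1) y^(-2)\<close>.\<close>
    define R where "R = scal (- 2) * (x * (h * (Ry * Ry)))"
    have "z * R = (y * y - 1) * (Rx * (x * (h * (Ry * Ry))))"
      by (simp add: z R_def scal_pull scal_mult_left mult.assoc)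
    also have "\<dots> = (y * y - 1) * (h * (Ry * Ry))" unfolding Rc ..
    also have "\<dots> = y * (y * ((1 - Ry * Ry) * (h * (Ry * Ry))))"
      unfolding fact(1) by (simp only: mult.assoc)
    also have "\<dots> = 1" unfolding Rc Ry(1) ..
    finally have zR: "z * R = 1" .
    have "R * z = x * (h * (Ry * (Ry * ((y * y - 1) * Rx))))"
      by (simp add: z R_def scal_pull scal_mult_left mult.assoc)
    also have "(y * y - 1) * Rx = y * (y * ((1 - Ry * Ry) * Rx))"
      unfolding fact(1) by (simp only: mult.assoc)
    finally have Rz: "R * z = 1" unfolding Rc Rx(1) .
    have "deg_le (x * (h * (Ry * Ry))) (int i + (0 + (- 2 * int i - 2)))"
      by (intro deg_le_mult dx h(3) dRy2)
    hence "deg_le R (- int k)" unfolding R_def using 3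
      by (intro deg_le_scal) (simp add: deg_le_mono)
    moreover have "Qhat (int k) = z" by (simp add: z_def 3 add.commute)
    ultimately show ?thesis using zR Rz dz 3 by (auto simp: algebra_simps)
  qed
qed

section \<open>Inverses of the \<open>Qhat k\<close> and the limit \<open>zhat\<close>\<close>

lemma
  shows Qhat_inv_right: "Qhat (int k) * ring_inv (Qhat (int k)) = 1"
    and Qhat_inv_left: "ring_inv (Qhat (int k)) * Qhat (int k) = 1"
    and deg_Qhat_inv: "deg_le (ring_inv (Qhat (int k))) (- int k)"
proof -
  obtain R where R: "Qhat (int k) * R = 1" "R * Qhat (int k) = 1" "deg_le R (- int k)"
    using Qhat_unit by blast
  with ring_inv_unique[OF R(1,2)] show "Qhat (int k) * ring_inv (Qhat (int k)) = 1"
    "ring_inv (Qhat (int k)) * Qhat (int k) = 1" "deg_le (ring_inv (Qhat (int k))) (- int k)" by simp_all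
qed

definition zseq :: "nat \<Rightarrow> skew_series" where
  "zseq k = Qhat (int k) * ring_inv (Qhat (int k + 1))"

text \<open>The Q-system gives the difference exactly: it is
  \<open>t^(-1) Q_(k+2)^(-1) Q_(k+1)^(-1)\<close>.\<close>

lemma zseq_diff: "deg_le (zseq (Suc k) - zseq k) (- 2 * int k - 3)"
proof -
  define x y z where "x = Qhat (int k)" and "y = Qhat (int k + 1)" and "z = Qhat (int k + 2)"
  define Ry Rz where "Ry = ring_inv y" and "Rz = ring_inv z"
  have R: "y * Ry = 1" "Rz * z = 1" "z * Rz = 1" "deg_le Ry (- 1 - int k)" "deg_le Rz (- int k - 2)"
    using Qhat_inv_right[of "k + 1"] Qhat_inv_left[of "k + 2"] Qhat_inv_right[of "k + 2"]
      deg_Qhat_inv[of "k + 1"] deg_Qhat_inv[of "k + 2"]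
    by (simp_all add: y_def z_def Ry_def Rz_def algebra_simps)
  have Rc: "Rz * (z * w) = w" for w using R by (simp flip: mult.assoc)
  have yz: "y * z = scal (- 2) * (z * y)"
    using Qhat_commute[of "int k + 1"] by (simp add: y_def z_def add.commute)
  have "Rz * y = Rz * (y * z) * Rz" by (simp add: mult.assoc R)
  also have "\<dots> = scal (- 2) * (Rz * (z * (y * Rz)))"
    unfolding yz by (simp add: scal_pull mult.assoc)
  also have "\<dots> = scal (- 2) * (y * Rz)" unfolding Rc ..
  finally have Rzy: "Rz * y = scal (- 2) * (y * Rz)" .
  have sys: "scal (- 2) * (z * x) = y * y - 1"
    using Qhat_system[of "int k + 1"]
    by (simp add: x_def y_def z_def t_elem_scal power2_eq_square mult.assoc add.commute)
  have "x * Ry = scal 2 * (Rz * (scal (- 2) * (z * x) * Ry))"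
    by (simp add: scal_pull scal_mult_left mult.assoc Rc)
  also have "\<dots> = scal 2 * (Rz * y) - scal 2 * (Rz * Ry)"
    unfolding sys by (simp add: algebra_simps R)
  finally have "y * Rz - x * Ry = scal 2 * (Rz * Ry)"
    by (simp add: Rzy scal_mult_left)
  moreover have "zseq (Suc k) - zseq k = y * Rz - x * Ry"
    by (simp add: zseq_def x_def y_def z_def Ry_def Rz_def add.commute)
  moreover have "deg_le (scal 2 * (Rz * Ry)) (- int k - 2 + (- 1 - int k))"
    by (intro deg_le_scal deg_le_mult R)
  ultimately show ?thesis by (simp add: deg_le_mono)
qed

lemma
  shows zhat_converges: "deg_converges zseq zhat"
    and zhat_leading: "deg_le (zhat - zseq 0) (- 2)"
proof -
  have "deg_le (zseq (Suc k) - zseq k) (- int k)" for k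
    by (rule deg_le_mono[OF zseq_diff]) simp
  then obtain f where f: "deg_converges zseq f" "\<And>k. deg_le (zseq k - f) (- int k)"
    using deg_converges_exists[of zseq] by blast
  have "zhat = f" unfolding zhat_def
  proof (rule the_equality)
    show "coeffwise_limit (\<lambda>k. Qhat (int k) * ring_inv (Qhat (int k + 1))) f"
      using deg_converges_coeffwise_limit[OF f(1)] by (simp add: zseq_def[abs_def])
    thus "g = f" if "coeffwise_limit (\<lambda>k. Qhat (int k) * ring_inv (Qhat (int k + 1))) g" for g
      using coeffwise_limit_unique that by blast
  qed
  thus "deg_converges zseq zhat" using f by simp
  \<comment> \<open>The error bound for the limit is only \<open>- k\<close>. It suffices at
    \<open>k = 2\<close>, and the steps from 0 to 2 are estimated by
    \<open>zseq_diff\<close>.\<close>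
  have "deg_le ((zseq (Suc 1) - zseq 1) + (zseq (Suc 0) - zseq 0) - (zseq 2 - f)) (- 2)"
  proof (rule deg_le_diff, rule deg_le_add)
    show "deg_le (zseq (Suc 1) - zseq 1) (- 2)" by (rule deg_le_mono[OF zseq_diff]) simp
    show "deg_le (zseq (Suc 0) - zseq 0) (- 2)" by (rule deg_le_mono[OF zseq_diff]) simp
    show "deg_le (zseq 2 - f) (- 2)" using f(2)[of 2] by simp
  qed
  thus "deg_le (zhat - zseq 0) (- 2)"
    using \<open>zhat = f\<close> by (simp add: numeral_2_eq_2)
qed

text \<open>The relation \<open>C Q_(k+1) = Q_(k+2) + t Q_k\<close> is divided by
  \<open>Q_(k+2)\<close> on the right, and \<open>k\<close> tends to infinity.\<close>

lemma C_zhat: "C_elem * zhat = 1 + scal (- 2) * (zhat * zhat)"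
proof -
  have "C_elem * zseq (Suc k) = 1 + scal (- 2) * (zseq k * zseq (Suc k))" for k
  proof -
    define x y z where "x = Qhat (int k)" and "y = Qhat (int k + 1)" and "z = Qhat (int k + 2)"
    define Ry Rz where "Ry = ring_inv y" and "Rz = ring_inv z"
    have R: "Ry * y = 1" "z * Rz = 1"
      using Qhat_inv_left[of "k + 1"] Qhat_inv_right[of "k + 2"]
      by (simp_all add: y_def z_def Ry_def Rz_def algebra_simps)
    have Cy: "C_elem * y = z + scal (- 2) * x"
      using C_Qhat[of "int k + 1"] by (simp add: x_def y_def z_def add.commute)
    have "x * Ry * (y * Rz) = x * (Ry * y) * Rz" by (simp only: mult.assoc)
    hence "x * Ry * (y * Rz) = x * Rz" by (simp add: R)
    hence "C_elem * y * Rz = 1 + scal (- 2) * (x * Ry * (y * Rz))"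
      unfolding Cy by (simp only: R distrib_right mult.assoc)
    thus ?thesis
      by (simp add: zseq_def x_def y_def z_def Ry_def Rz_def algebra_simps)
  qed
  moreover have "deg_converges (\<lambda>k. C_elem * zseq (Suc k)) (C_elem * zhat)"
    by (intro deg_converges_mult deg_converges_const deg_converges_Suc zhat_converges)
  moreover have "deg_converges (\<lambda>k. 1 + scal (- 2) * (zseq k * zseq (Suc k))) (1 + scal (- 2) * (zhat * zhat))"
    by (intro deg_converges_add deg_converges_mult deg_converges_const deg_converges_Suc zhat_converges)
  ultimately show ?thesis using deg_converges_unique by simp
qed

section \<open>The constant term at \<open>Q\<^sub>0 = 1\<close>\<close>

lemma at_Q0_one_expand:
  "finite S \<Longrightarrow> Poly_Mapping.keys p \<subseteq> S \<Longrightarrow> at_Q0_one p = (\<Sum>a\<in>S. Poly_Mapping.lookup p a)"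
  unfolding at_Q0_one_def by (rule sum.mono_neutral_left) (auto simp: in_keys_iff)

lemma at_Q0_one_0 [simp]: "at_Q0_one 0 = 0"
  by (simp add: at_Q0_one_def)

lemma at_Q0_one_add: "at_Q0_one (p + r) = at_Q0_one p + at_Q0_one r"
proof -
  let ?S = "Poly_Mapping.keys p \<union> Poly_Mapping.keys r"
  have "at_Q0_one (p + r) = (\<Sum>a\<in>?S. Poly_Mapping.lookup (p + r) a)"
    by (rule at_Q0_one_expand) (auto simp: Poly_Mapping.keys_add)
  thus ?thesis
    using at_Q0_one_expand[of ?S p] at_Q0_one_expand[of ?S r]
    by (simp add: lookup_add sum.distrib)
qed

lemma at_Q0_one_uminus: "at_Q0_one (- p) = - at_Q0_one p"
  using at_Q0_one_add[of p "- p"] by (simp add: eq_neg_iff_add_eq_0 add.commute)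

lemma at_Q0_one_single_mult: "at_Q0_one (Poly_Mapping.single a c * p) = c * at_Q0_one p"
proof -
  have *: "at_Q0_one (Poly_Mapping.single a c) = c" for a :: int and c
    using at_Q0_one_expand[of "{a}" "Poly_Mapping.single a c"] by simp
  have sum: "at_Q0_one (\<Sum>x\<in>X. f x) = (\<Sum>x\<in>X. at_Q0_one (f x))" for X :: "int set" and f
    by (induction X rule: infinite_finite_induct) (auto simp: at_Q0_one_add)
  have "at_Q0_one (Poly_Mapping.single a c *
      (\<Sum>b\<in>Poly_Mapping.keys p. Poly_Mapping.single b (Poly_Mapping.lookup p b))) =
      c * (\<Sum>b\<in>Poly_Mapping.keys p. Poly_Mapping.lookup p b)"
    by (simp add: sum_distrib_left mult_single sum *)
  thus ?thesis by (simp add: at_Q0_one_def flip: poly_mapping_expand)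
qed

definition CT_one :: "skew_series \<Rightarrow> laurent" where
  "CT_one f = at_Q0_one (CT_Q1 f)"

lemma CT_one_add: "CT_one (f + g) = CT_one f + CT_one g"
  by (simp add: CT_one_def CT_Q1_def plus_skew_series.rep_eq at_Q0_one_add)

lemma CT_one_scal: "CT_one (scal e * f) = u_pow e * CT_one f"
  by (simp add: CT_one_def CT_Q1_def scal_def coeff_monom_mult_left at_Q0_one_single_mult)

text \<open>A power of \<open>Q_0\<close> on the left respects normal order and so becomes 1; to the
  right of \<open>Q_1\<close> it would leave a power of \<open>u\<close>.\<close>

lemma CT_one_monom_0: "CT_one (skew_monom c a 0 * f) = c * CT_one f"
  by (simp add: CT_one_def CT_Q1_def coeff_monom_mult_left at_Q0_one_single_mult)

lemma CT_one_deg: "deg_le f d \<Longrightarrow> d < 0 \<Longrightarrow> CT_one f = 0"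
  by (simp add: CT_one_def CT_Q1_def deg_le_def)

definition vanishing :: "skew_series set" where
  "vanishing = {f. \<forall>b\<le>0. at_Q0_one (coeff_Q1 f b) = 0}"

lemma vanishing_CT_one: "f \<in> vanishing \<Longrightarrow> CT_one f = 0"
  by (simp add: vanishing_def CT_one_def CT_Q1_def)

lemma at_Q0_one_coeff_mult_monom:
  "at_Q0_one (coeff_Q1 (f * skew_monom c a b) d) =
    u_pow (2 * a * (d - b)) * c * at_Q0_one (coeff_Q1 f (d - b))"
  using at_Q0_one_single_mult by (simp add: coeff_mult_monom mult.commute)

lemma vanishing_add: "f \<in> vanishing \<Longrightarrow> g \<in> vanishing \<Longrightarrow> f + g \<in> vanishing"
  by (simp add: vanishing_def plus_skew_series.rep_eq at_Q0_one_add)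

lemma vanishing_uminus: "f \<in> vanishing \<Longrightarrow> - f \<in> vanishing"
  by (simp add: vanishing_def uminus_skew_series.rep_eq at_Q0_one_uminus)

lemma vanishing_mult_monom:
  "f \<in> vanishing \<Longrightarrow> b \<ge> 0 \<Longrightarrow> f * skew_monom c a b \<in> vanishing"
  by (simp add: vanishing_def at_Q0_one_coeff_mult_monom)

text \<open>At \<open>Q_0 = 1\<close> the coefficient of \<open>f C\<close> at \<open>b\<close>
  combines those of \<open>f\<close> at \<open>b - 1\<close> and \<open>b + 1\<close>. The only
  dangerous one is at \<open>1\<close>, for \<open>b = 0\<close>, and there its factor
  \<open>u^(2b) - u^(-2b)\<close> is zero.\<close>

lemma vanishing_mult_C:
  assumes "f \<in> vanishing"
  shows "f * C_elem \<in> vanishing"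
  unfolding vanishing_def
proof safe
  fix b :: int assume b: "b \<le> 0"
  define F where "F = (\<lambda>b. at_Q0_one (coeff_Q1 f b))"
  have F: "F b = 0" if "b \<le> 0" for b using assms that by (simp add: vanishing_def F_def)
  have "at_Q0_one (coeff_Q1 (f * C_elem) b) =
      u_pow (- 2 * b) * F (b - 1) + (u_pow (2 * b) - u_pow (- 2 * b)) * F (b + 1)"
    unfolding C_elem_def diff_conv_add_uminus skew_monom_minus distrib_left
      plus_skew_series.rep_eq at_Q0_one_add at_Q0_one_coeff_mult_monom
    by (simp add: F_def u_pow_mult algebra_simps)
  also have "\<dots> = 0"
    using F[of "b - 1"] F[of "b + 1"] b by (cases "b = 0") auto
  finally show "at_Q0_one (coeff_Q1 (f * C_elem) b) = 0" .
qed

text \<open>The recurrence \<open>Q_(k+2) = C Q_(k+1) - t Q_k\<close> reduces the claim to the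
  monomials \<open>Q_0\<close> and \<open>Q_1\<close>. The induction keeps \<open>f\<close>
  arbitrary, since it is applied to \<open>f C\<close> as well.\<close>

lemma vanishing_mult_Qhat:
  assumes "f \<in> vanishing"
  shows "f * Qhat (int k) \<in> vanishing"
proof -
  have scal: "scal e * g \<in> vanishing" if "g \<in> vanishing" for e g
    using vanishing_mult_monom[OF that, of 0 "u_pow e" 0] by (simp add: scal_central flip: scal_def)
  have "f * Qhat (int k) \<in> vanishing \<and> f * Qhat (int k + 1) \<in> vanishing"
    using assms
  proof (induction k arbitrary: f)
    case 0
    thus ?case by (simp add: Qhat_0 Qhat_1 vanishing_mult_monom)
  next
    case (Suc k)
    have "Qhat (int k + 2) = C_elem * Qhat (int k + 1) + - (scal (- 2) * Qhat (int k))"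
      using C_Qhat[of "int k + 1"] by (simp add: add.commute)
    hence "f * Qhat (int k + 2) =
        f * C_elem * Qhat (int k + 1) + - (scal (- 2) * (f * Qhat (int k)))"
      by (simp add: distrib_left right_diff_distrib scal_pull mult.assoc)
    also have "\<dots> \<in> vanishing"
      using Suc.IH[of f] Suc.IH[of "f * C_elem"] Suc.prems vanishing_mult_C
      by (intro vanishing_add vanishing_uminus scal) auto
    finally show ?case using Suc.IH[of f] Suc.prems by (simp add: algebra_simps)
  qed
  thus ?thesis by simp
qed

section \<open>Recurrences for constant terms\<close>

text \<open>The range is half-open and may start at 0, because the recurrences at index 1 produce
  factors \<open>Q_0\<close>.\<close>

definition Q_prod :: "nat \<Rightarrow> nat \<Rightarrow> (nat \<Rightarrow> int) \<Rightarrow> skew_series" where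
  "Q_prod a b n = prod_list (map (\<lambda>i. Qhat (int i) ^ nat (n i)) [a..<b])"

lemma Q_prod_split: "a \<le> b \<Longrightarrow> b \<le> c \<Longrightarrow> Q_prod a c n = Q_prod a b n * Q_prod b c n"
  unfolding Q_prod_def using upt_add_eq_append[of a b "c - b"] by simp

lemma Q_prod_Cons: "a < b \<Longrightarrow> Q_prod a b n = Qhat (int a) ^ nat (n a) * Q_prod (Suc a) b n"
  by (simp add: Q_prod_def upt_conv_Cons)

lemma Q_prod_cong: "(\<And>i. a \<le> i \<Longrightarrow> i < b \<Longrightarrow> n i = n' i) \<Longrightarrow> Q_prod a b n = Q_prod a b n'"
  unfolding Q_prod_def by (intro arg_cong[of _ _ prod_list] map_cong) auto

lemma Q_prod_eq_1: "(\<And>i. a \<le> i \<Longrightarrow> i < b \<Longrightarrow> n i = 0) \<Longrightarrow> Q_prod a b n = 1"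
  using Q_prod_cong[of a b n "\<lambda>_. 0"] by (simp add: Q_prod_def map_replicate_const)

lemma Q_prod_split_at:
  assumes "1 \<le> j" "j < K"
  shows "Q_prod 0 (Suc K) n = Q_prod 0 (j - 1) n *
    (Qhat (int j - 1) ^ nat (n (j - 1)) * (Qhat (int j) ^ nat (n j) *
    (Qhat (int j + 1) ^ nat (n (j + 1)) * Q_prod (j + 2) (Suc K) n)))"
proof -
  have "Q_prod 0 (Suc K) n = Q_prod 0 (j - 1) n * Q_prod (j - 1) (Suc K) n"
    using assms by (intro Q_prod_split) auto
  also have "Q_prod (j - 1) (Suc K) n = Qhat (int (j - 1)) ^ nat (n (j - 1)) * Q_prod j (Suc K) n"
    using assms by (subst Q_prod_Cons) auto
  also have "Q_prod j (Suc K) n = Qhat (int j) ^ nat (n j) * Q_prod (j + 1) (Suc K) n"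
    using assms by (subst Q_prod_Cons) auto
  also have "Q_prod (j + 1) (Suc K) n = Qhat (int (j + 1)) ^ nat (n (j + 1)) * Q_prod (j + 2) (Suc K) n"
    using assms by (subst Q_prod_Cons) auto
  finally show ?thesis using assms by (simp add: of_nat_diff add.commute)
qed

lemma Qhat_power_commute:
  "Qhat (j + 1) ^ s * Qhat j = scal (2 * int s) * (Qhat j * Qhat (j + 1) ^ s)"
proof -
  define x y where "x = Qhat j" and "y = Qhat (j + 1)"
  have "scal 2 * (x * y) = y * x"
    by (simp add: x_def y_def Qhat_commute scal_mult_left)
  hence 1: "y * (x * w) = scal 2 * (x * (y * w))" for w
    by (metis mult.assoc)
  have "y ^ s * x = scal (2 * int s) * (x * y ^ s)"
  proof (induction s)
    case (Suc s)
    have "y ^ Suc s * x = y * (scal (2 * int s) * (x * y ^ s))"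
      by (simp add: Suc mult.assoc)
    also have "\<dots> = scal (2 * int s + 2) * (x * (y * y ^ s))"
      by (simp add: scal_pull 1 scal_mult_left)
    finally show ?case by (simp add: add.commute)
  qed simp
  thus ?thesis by (simp add: x_def y_def)
qed

text \<open>\<open>Qhat_square\<close> replaces the last two factors \<open>Q_j\<close>. The new
  \<open>Q_(j+1)\<close> is already in place, and moving \<open>Q_(j-1)\<close> left across
  \<open>n j - 2\<close> factors \<open>Q_j\<close> costs \<open>u^(2 (n j - 2))\<close>.\<close>

lemma Q_prod_recurrence:
  assumes j: "1 \<le> j" "j < K" and n: "\<And>i. n i \<ge> 0" "n j \<ge> 2"
  shows "Q_prod 0 (Suc K) n =
    scal (2 * n j - 2) * Q_prod 0 (Suc K)
      (\<lambda>i. n i + (unit_vec (j - 1) i + unit_vec (j + 1) i - 2 * unit_vec j i)) +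
    scal 4 * Q_prod 0 (Suc K) (\<lambda>i. n i - 2 * unit_vec j i)"
proof -
  define n' where "n' = (\<lambda>i. n i + (unit_vec (j - 1) i + unit_vec (j + 1) i - 2 * unit_vec j i))"
  define n'' where "n'' = (\<lambda>i. n i - 2 * unit_vec j i)"
  define x y w where "x = Qhat (int j - 1)" and "y = Qhat (int j)" and "w = Qhat (int j + 1)"
  define a s c where "a = nat (n (j - 1))" and "s = nat (n j - 2)" and "c = nat (n (j + 1))"
  define L R where "L = Q_prod 0 (j - 1) n" and "R = Q_prod (j + 2) (Suc K) n"
  have L: "Q_prod 0 (j - 1) n' = L" "Q_prod 0 (j - 1) n'' = L"
    unfolding L_def by (intro Q_prod_cong; auto simp: n'_def n''_def unit_vec_def)+
  have R: "Q_prod (j + 2) (Suc K) n' = R" "Q_prod (j + 2) (Suc K) n'' = R"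
    unfolding R_def by (intro Q_prod_cong; auto simp: n'_def n''_def unit_vec_def)+
  have e: "nat (n j) = s + 2" "nat (n' (j - 1)) = Suc a" "nat (n' j) = s" "nat (n' (j + 1)) = Suc c"
    "nat (n'' (j - 1)) = a" "nat (n'' j) = s" "nat (n'' (j + 1)) = c"
    using j n(1)[of "j - 1"] n(1)[of "j + 1"] n(2)
    by (auto simp: n'_def n''_def unit_vec_def a_def s_def c_def)
  have y2: "y * y = scal 2 * (x * w) + scal 4"
    using Qhat_square[of "int j"] by (simp add: x_def y_def w_def)
  have "y ^ (s + 2) = y ^ s * (y * y)" by (simp only: power_add power2_eq_square)
  also have "\<dots> = scal 2 * (y ^ s * x * w) + scal 4 * y ^ s"
    unfolding y2 by (simp add: distrib_left scal_pull scal_central mult.assoc)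
  also have "y ^ s * x = scal (2 * int s) * (x * y ^ s)"
    using Qhat_power_commute[of "int j - 1" s] by (simp add: x_def y_def)
  finally have ys: "y ^ (s + 2) = scal (2 * int s + 2) * (x * (y ^ s * w)) + scal 4 * y ^ s"
    by (simp add: scal_mult_left mult.assoc add.commute)
  have ns: "2 * n j - 2 = 2 * int s + 2" using n(2) by (simp add: s_def)
  have "Q_prod 0 (Suc K) n = L * (x ^ a * (y ^ (s + 2) * (w ^ c * R)))"
    unfolding Q_prod_split_at[OF j, of n] e by (simp add: L_def R_def x_def y_def w_def a_def c_def)
  also have "\<dots> = scal (2 * int s + 2) * (L * (x ^ a * (x * (y ^ s * (w * (w ^ c * R)))))) +
      scal 4 * (L * (x ^ a * (y ^ s * (w ^ c * R))))"
    unfolding ys by (simp add: distrib_left distrib_right scal_pull mult.assoc)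
  also have "L * (x ^ a * (x * (y ^ s * (w * (w ^ c * R))))) = L * (x ^ Suc a * (y ^ s * (w ^ Suc c * R)))"
    by (simp add: power_Suc2 mult.assoc) (simp add: power_commutes flip: mult.assoc)
  also have "\<dots> = Q_prod 0 (Suc K) n'"
    unfolding Q_prod_split_at[OF j, of n'] e L R x_def y_def w_def ..
  also have "L * (x ^ a * (y ^ s * (w ^ c * R))) = Q_prod 0 (Suc K) n''"
    unfolding Q_prod_split_at[OF j, of n''] e L R x_def y_def w_def ..
  finally show ?thesis by (simp only: ns n'_def n''_def)
qed

text \<open>The last factor absorbs \<open>C\<close> by \<open>Q_k C = t Q_(k+1) + Q_(k-1)\<close>,
  and \<open>Q_(k-1)\<close> then moves left across the remaining factors
  \<open>Q_k\<close>.\<close>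

lemma Q_prod_mult_C:
  assumes k: "1 \<le> k" "k < K" and N: "\<And>i. N i \<ge> 0" "N k \<ge> 1" "\<And>i. k < i \<Longrightarrow> i \<le> K \<Longrightarrow> N i = 0"
  shows "Q_prod 0 (Suc K) N * C_elem =
    scal (- 2) * Q_prod 0 (Suc K) (\<lambda>i. N i + (unit_vec (k + 1) i - unit_vec k i)) +
    scal (2 * N k - 2) * Q_prod 0 (Suc K) (\<lambda>i. N i + (unit_vec (k - 1) i - unit_vec k i))"
proof -
  define n' where "n' = (\<lambda>i. N i + (unit_vec (k + 1) i - unit_vec k i))"
  define n'' where "n'' = (\<lambda>i. N i + (unit_vec (k - 1) i - unit_vec k i))"
  define x y w where "x = Qhat (int k - 1)" and "y = Qhat (int k)" and "w = Qhat (int k + 1)"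
  define a s where "a = nat (N (k - 1))" and "s = nat (N k - 1)"
  define L where "L = Q_prod 0 (k - 1) N"
  have L: "Q_prod 0 (k - 1) n' = L" "Q_prod 0 (k - 1) n'' = L"
    unfolding L_def by (intro Q_prod_cong; auto simp: n'_def n''_def unit_vec_def)+
  have R: "Q_prod (k + 2) (Suc K) N = 1" "Q_prod (k + 2) (Suc K) n' = 1" "Q_prod (k + 2) (Suc K) n'' = 1"
    by (intro Q_prod_eq_1; auto simp: n'_def n''_def unit_vec_def N)+
  have e: "nat (N k) = Suc s" "nat (N (k + 1)) = 0"
    "nat (n' (k - 1)) = a" "nat (n' k) = s" "nat (n' (k + 1)) = 1"
    "nat (n'' (k - 1)) = Suc a" "nat (n'' k) = s" "nat (n'' (k + 1)) = 0"
    using k N(1)[of "k - 1"] N(3)[of "k + 1"] N(2)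
    by (auto simp: n'_def n''_def unit_vec_def a_def s_def)
  have yC: "y * C_elem = scal (- 2) * w + x"
    using Qhat_C[of "int k"] by (simp add: x_def y_def w_def)
  have yx: "y ^ s * x = scal (2 * int s) * (x * y ^ s)"
    using Qhat_power_commute[of "int k - 1" s] by (simp add: x_def y_def)
  have ns: "2 * N k - 2 = 2 * int s" using N(2) by (simp add: s_def)
  have "Q_prod 0 (Suc K) N * C_elem = L * (x ^ a * (y ^ s * (y * C_elem)))"
    unfolding Q_prod_split_at[OF k, of N] e R
    by (simp add: L_def x_def y_def w_def a_def power_Suc2 mult.assoc del: power_Suc)
  also have "\<dots> = scal (- 2) * (L * (x ^ a * (y ^ s * w))) + L * (x ^ a * (y ^ s * x))"
    unfolding yC by (simp add: distrib_left scal_pull)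
  also have "L * (x ^ a * (y ^ s * x)) = scal (2 * int s) * (L * (x ^ Suc a * y ^ s))"
    unfolding yx by (simp add: scal_pull power_Suc2 mult.assoc del: power_Suc)
  also have "L * (x ^ a * (y ^ s * w)) = Q_prod 0 (Suc K) n'"
    unfolding Q_prod_split_at[OF k, of n'] e L R by (simp add: x_def y_def w_def)
  also have "L * (x ^ Suc a * y ^ s) = Q_prod 0 (Suc K) n''"
    unfolding Q_prod_split_at[OF k, of n''] e L R by (simp add: x_def y_def w_def)
  finally show ?thesis by (simp only: ns n'_def n''_def)
qed

lemma C_zhat_power: "C_elem * zhat ^ Suc r = zhat ^ r + scal (- 2) * zhat ^ Suc (Suc r)"
proof -
  have "C_elem * zhat ^ Suc r = C_elem * zhat * zhat ^ r" by (simp add: mult.assoc)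
  thus ?thesis unfolding C_zhat by (simp add: distrib_right mult.assoc)
qed

section \<open>Normalised constant terms\<close>

lemma CT_one_Qhat_0_power: "CT_one (Qhat 0 ^ c * f) = CT_one f"
proof (induction c)
  case (Suc c)
  have "CT_one (Qhat 0 ^ Suc c * f) = CT_one (Qhat 0 * (Qhat 0 ^ c * f))" by (simp add: mult.assoc)
  also have "\<dots> = CT_one (Qhat 0 ^ c * f)" unfolding Qhat_0 by (simp add: CT_one_monom_0)
  finally show ?case using Suc by simp
qed simp

lemma Qhat_1_Qhat_0_power: "Qhat 1 * Qhat 0 ^ c = scal (2 * int c) * (Qhat 0 ^ c * Qhat 1)"
proof (induction c)
  case (Suc c)
  have 1: "Qhat 1 * Qhat 0 = scal 2 * (Qhat 0 * Qhat 1)"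
    using Qhat_power_commute[of 0 1] by simp
  have "Qhat 1 * Qhat 0 ^ Suc c = (Qhat 1 * Qhat 0 ^ c) * Qhat 0"
    by (simp add: power_Suc2 mult.assoc del: power_Suc)
  also have "\<dots> = scal (2 * int c) * (Qhat 0 ^ c * (Qhat 1 * Qhat 0))"
    unfolding Suc by (simp add: mult.assoc)
  also have "\<dots> = scal (2 * int (Suc c)) * (Qhat 0 ^ Suc c * Qhat 1)"
    unfolding 1 by (simp add: scal_pull scal_mult_left power_Suc2 mult.assoc algebra_simps del: power_Suc)
  finally show ?case .
qed simp

text \<open>The power \<open>r\<close> of \<^const>\<open>zhat\<close> is \<open>l + 1\<close>. The value does not depend on \<open>n 0\<close>.\<close>

definition CT_value :: "nat \<Rightarrow> nat \<Rightarrow> (nat \<Rightarrow> int) \<Rightarrow> laurent" where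
  "CT_value K r n = u_pow (- 1 - int r - 2 * (\<Sum>i=0..K. n i) - bilin_A K n n) *
     CT_one (Qhat 1 * (Q_prod 0 (Suc K) n * zhat ^ r))"

text \<open>Moving \<open>Q_0^(n 0)\<close> to the left of \<open>Q_1\<close> produces
  \<open>u^(2 n 0)\<close>, which cancels the contribution of index 0 to the prefactor.\<close>

lemma CT_value_drop_0:
  assumes "n 0 \<ge> 0"
  shows "CT_value K r n = u_pow (- 1 - int r - 2 * (\<Sum>i=1..K. n i) - bilin_A K n n) *
     CT_one (Qhat 1 * (Q_prod 1 (Suc K) n * zhat ^ r))"
proof -
  have "Qhat 1 * (Q_prod 0 (Suc K) n * zhat ^ r) =
      Qhat 1 * Qhat 0 ^ nat (n 0) * (Q_prod 1 (Suc K) n * zhat ^ r)"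
    by (simp add: Q_prod_Cons mult.assoc)
  also have "\<dots> = scal (2 * n 0) * (Qhat 0 ^ nat (n 0) * (Qhat 1 * (Q_prod 1 (Suc K) n * zhat ^ r)))"
    unfolding Qhat_1_Qhat_0_power using assms by (simp add: mult.assoc)
  finally have "CT_one (Qhat 1 * (Q_prod 0 (Suc K) n * zhat ^ r)) =
      u_pow (2 * n 0) * CT_one (Qhat 1 * (Q_prod 1 (Suc K) n * zhat ^ r))"
    by (simp add: CT_one_scal CT_one_Qhat_0_power)
  moreover have "(\<Sum>i=0..K. n i) = n 0 + (\<Sum>i=1..K. n i)"
    by (simp add: sum.atLeast_Suc_atMost)
  ultimately show ?thesis
    by (simp add: CT_value_def u_pow_mult algebra_simps flip: mult.assoc)
qed

lemma sum_unit_vec: "a \<le> K \<Longrightarrow> (\<Sum>i=0..K. unit_vec a i) = 1"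
  by (simp add: unit_vec_def)

text \<open>The normalising power of \<open>u\<close> absorbs the scalars of
  \<open>Q_prod_recurrence\<close>, so that the coefficients become those of
  \<open>M_sum_recurrence\<close>.\<close>

lemma CT_value_recurrence:
  assumes j: "1 \<le> j" "j < K" and n: "\<And>i. n i \<ge> 0" "n j \<ge> 2"
  shows "CT_value K r n =
    CT_value K r (\<lambda>i. n i + (unit_vec (j - 1) i + unit_vec (j + 1) i - 2 * unit_vec j i)) +
    q_pow (int j - A_apply K n j) * CT_value K r (\<lambda>i. n i - 2 * unit_vec j i)"
proof -
  define n' where "n' = (\<lambda>i. n i + (unit_vec (j - 1) i + unit_vec (j + 1) i - 2 * unit_vec j i))"
  define n'' where "n'' = (\<lambda>i. n i - 2 * unit_vec j i)"
  define e where "e = (\<lambda>n. - 1 - int r - 2 * (\<Sum>i=0..K. n i) - bilin_A K n n)"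
  have "(\<Sum>i=0..K. n' i) = (\<Sum>i=0..K. n i)"
    unfolding n'_def sum.distrib sum_subtractf sum_distrib_left[symmetric]
    using j by (simp add: sum_unit_vec)
  moreover have "bilin_A K n' n' = bilin_A K n n - 2 * n j + 2"
    using j A_apply_second_difference[of j K n] unfolding n'_def
    by (simp add: bilin_A_simps A_apply_simps)
  ultimately have e': "e n' = e n + (2 * n j - 2)" by (simp add: e_def)
  have "(\<Sum>i=0..K. n'' i) = (\<Sum>i=0..K. n i) - 2"
    unfolding n''_def sum_subtractf sum_distrib_left[symmetric]
    using j by (simp add: sum_unit_vec)
  moreover have "bilin_A K n'' n'' = bilin_A K n n - 4 * A_apply K n j + 4 * int j"
    using j unfolding n''_def by (simp add: bilin_A_simps A_apply_simps)
  ultimately have e'': "e n + 4 = 4 * (int j - A_apply K n j) + e n''" by (simp add: e_def)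
  have "Qhat 1 * (Q_prod 0 (Suc K) n * zhat ^ r) =
     scal (2 * n j - 2) * (Qhat 1 * (Q_prod 0 (Suc K) n' * zhat ^ r)) +
     scal 4 * (Qhat 1 * (Q_prod 0 (Suc K) n'' * zhat ^ r))"
    unfolding Q_prod_recurrence[of j K n, OF j n] n'_def n''_def
    by (simp add: distrib_left distrib_right scal_pull mult.assoc)
  hence "CT_value K r n =
     u_pow (e n) * u_pow (2 * n j - 2) * CT_one (Qhat 1 * (Q_prod 0 (Suc K) n' * zhat ^ r)) +
     u_pow (e n) * u_pow 4 * CT_one (Qhat 1 * (Q_prod 0 (Suc K) n'' * zhat ^ r))"
    by (simp add: CT_value_def e_def CT_one_add CT_one_scal distrib_left mult.assoc)
  also have "u_pow (e n) * u_pow (2 * n j - 2) = u_pow (e n')" unfolding u_pow_mult e' ..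
  also have "u_pow (e n) * u_pow 4 = q_pow (int j - A_apply K n j) * u_pow (e n'')"
    unfolding u_pow_mult e'' q_pow_def ..
  finally show ?thesis
    unfolding n'_def[symmetric] n''_def[symmetric]
    by (simp add: CT_value_def e_def mult.assoc)
qed

text \<open>\<open>C\<close> is inserted between the product and \<open>z^(r+1)\<close>. Acting to
  the left it changes \<open>N\<close>, acting to the right it changes the power of
  \<open>z\<close>.\<close>

lemma CT_value_level_recurrence:
  assumes k: "1 \<le> k" "k < K" and N: "\<And>i. N i \<ge> 0" "N k \<ge> 1" "\<And>i. k < i \<Longrightarrow> i \<le> K \<Longrightarrow> N i = 0"
  shows "CT_value K (Suc r) (\<lambda>i. N i + (unit_vec (k + 1) i - unit_vec k i)) +
      CT_value K (Suc r) (\<lambda>i. N i + (unit_vec (k - 1) i - unit_vec k i)) =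
    CT_value K r N + CT_value K (Suc (Suc r)) N"
proof -
  define n' where "n' = (\<lambda>i. N i + (unit_vec (k + 1) i - unit_vec k i))"
  define n'' where "n'' = (\<lambda>i. N i + (unit_vec (k - 1) i - unit_vec k i))"
  define e where "e = (\<lambda>r n. - 1 - int r - 2 * (\<Sum>i=0..K. n i) - bilin_A K n n)"
  define f where "f = (\<lambda>r n. CT_one (Qhat 1 * (Q_prod 0 (Suc K) n * zhat ^ r)))"
  have CT: "CT_value K r n = u_pow (e r n) * f r n" for r n
    by (simp add: CT_value_def e_def f_def)
  have AN: "A_apply K N (k + 1) = A_apply K N K" "A_apply K N k = A_apply K N K"
    by (rule A_apply_eventually_const[of k]; use N(3) k in simp)+
  have s: "(\<Sum>i=0..K. n' i) = (\<Sum>i=0..K. N i)" "(\<Sum>i=0..K. n'' i) = (\<Sum>i=0..K. N i)"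
    unfolding n'_def n''_def sum.distrib sum_subtractf
    using k by (simp_all add: sum_unit_vec)
  have "bilin_A K n' n' = bilin_A K N N + 1"
    using k AN unfolding n'_def by (simp add: bilin_A_simps A_apply_simps)
  moreover have "bilin_A K n'' n'' = bilin_A K N N - 2 * N k + 1"
    using k AN A_apply_second_difference[of k K N] unfolding n''_def
    by (simp add: bilin_A_simps A_apply_simps)
  \<comment> \<open>Relative to \<open>e (Suc r) N + 1\<close> the four exponents differ by exactly
    the scalars in the two expansions.\<close>
  ultimately have e: "e (Suc r) n' = e (Suc r) N + 1 + (- 2)"
      "e (Suc r) n'' = e (Suc r) N + 1 + (2 * N k - 2)"
      "e r N = e (Suc r) N + 1" "e (Suc (Suc r)) N = e (Suc r) N + 1 + (- 2)"
    by (simp_all add: e_def s)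
  have "Qhat 1 * (Q_prod 0 (Suc K) N * zhat ^ r) +
      scal (- 2) * (Qhat 1 * (Q_prod 0 (Suc K) N * zhat ^ Suc (Suc r))) =
      Qhat 1 * (Q_prod 0 (Suc K) N * (C_elem * zhat ^ Suc r))"
    unfolding C_zhat_power by (simp only: distrib_left scal_left_commute)
  also have "\<dots> = Qhat 1 * (Q_prod 0 (Suc K) N * C_elem * zhat ^ Suc r)"
    by (simp only: mult.assoc)
  also have "Q_prod 0 (Suc K) N * C_elem =
      scal (- 2) * Q_prod 0 (Suc K) n' + scal (2 * N k - 2) * Q_prod 0 (Suc K) n''"
    unfolding n'_def n''_def by (rule Q_prod_mult_C[OF k]) (use N in auto)
  also have "Qhat 1 * (\<dots> * zhat ^ Suc r) =
      scal (- 2) * (Qhat 1 * (Q_prod 0 (Suc K) n' * zhat ^ Suc r)) +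
      scal (2 * N k - 2) * (Qhat 1 * (Q_prod 0 (Suc K) n'' * zhat ^ Suc r))"
    by (simp only: distrib_left distrib_right scal_left_commute mult.assoc)
  finally have "f r N + u_pow (- 2) * f (Suc (Suc r)) N =
      u_pow (- 2) * f (Suc r) n' + u_pow (2 * N k - 2) * f (Suc r) n''"
    unfolding f_def by (metis CT_one_add CT_one_scal)
  hence "u_pow (e (Suc r) N + 1) * (f r N + u_pow (- 2) * f (Suc (Suc r)) N) =
      u_pow (e (Suc r) N + 1) * (u_pow (- 2) * f (Suc r) n' + u_pow (2 * N k - 2) * f (Suc r) n'')"
    by simp
  thus ?thesis
    unfolding CT n'_def[symmetric] n''_def[symmetric] e
    by (simp only: distrib_left u_pow_mult mult.assoc[symmetric])
qed

text \<open>The leading term of \<open>z\<close> is \<open>Q_0 Q_1^(-1)\<close>. Hence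
  \<open>Q_1 z^r\<close> has negative degree for \<open>r \<ge> 2\<close>, while
  \<open>r = 1\<close> leaves \<open>Q_1 Q_0 Q_1^(-1) = u^2 Q_0\<close>.\<close>

lemma CT_one_Qhat_1_zhat_power: "CT_one (Qhat 1 * zhat ^ r) = (if r = 1 then u_pow 2 else 0)"
proof -
  have dz: "deg_le zhat (- 1)"
  proof -
    have "deg_le (zseq 0) (0 + (- 1))"
      using Qhat_unit[of 0] deg_Qhat_inv[of 1] unfolding zseq_def by (intro deg_le_mult) auto
    moreover have "deg_le (zhat - zseq 0) (- 1)" by (rule deg_le_mono[OF zhat_leading]) simp
    ultimately have "deg_le ((zhat - zseq 0) + zseq 0) (- 1)" by (intro deg_le_add) auto
    thus ?thesis by simp
  qed
  have d1: "deg_le (Qhat 1) 1" using Qhat_unit[of 1] by simp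
  consider "r = 0" | "r = 1" | "r \<ge> 2" by linarith
  thus ?thesis
  proof cases
    case 1
    have "Qhat 1 \<in> vanishing"
      by (auto simp: Qhat_1 vanishing_def coeff_Q1_monom)
    thus ?thesis using 1 by (simp add: vanishing_CT_one)
  next
    case 2
    have "ring_inv (Qhat 1) = skew_monom 1 0 (- 1)"
      by (rule ring_inv_unique) (simp_all add: Qhat_1 skew_monom_mult skew_monom_one)
    hence "Qhat 1 * zseq 0 = skew_monom (u_pow 2) 1 0"
      by (simp add: zseq_def Qhat_0 Qhat_1 skew_monom_mult)
    hence "Qhat 1 * zhat = skew_monom (u_pow 2) 1 0 * 1 + Qhat 1 * (zhat - zseq 0)"
      by (simp add: right_diff_distrib)
    hence "CT_one (Qhat 1 * zhat) = u_pow 2 * CT_one 1 + CT_one (Qhat 1 * (zhat - zseq 0))"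
      by (simp only: CT_one_add CT_one_monom_0)
    moreover have "CT_one (Qhat 1 * (zhat - zseq 0)) = 0"
      by (rule CT_one_deg[OF deg_le_mult[OF d1 zhat_leading]]) simp
    moreover have "CT_one 1 = 1"
      by (simp add: CT_one_def CT_Q1_def one_skew_series.rep_eq at_Q0_one_def)
    ultimately show ?thesis using 2 by simp
  next
    case 3
    have "deg_le (Qhat 1 * zhat ^ r) (1 + (- int r))"
      by (intro deg_le_mult d1 deg_le_power dz)
    thus ?thesis using 3 CT_one_deg[of _ "1 + (- int r)"] by simp
  qed
qed

text \<open>This is the analogue of the level recurrence at \<open>k = 0\<close>, obtained by
  inserting \<open>C\<close> after \<open>Q_1 Q_0\<close>. The unwanted term contains
  \<open>Q_1 Q_(-1)\<close>, a multiple of \<open>Q_0^2 - 1\<close>.\<close>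

lemma CT_one_Qhat_1_square:
  "CT_one (Qhat 1 * (Qhat 1 * zhat ^ Suc r)) =
    u_pow 4 * (CT_one (Qhat 1 * zhat ^ r) + u_pow (- 2) * CT_one (Qhat 1 * zhat ^ Suc (Suc r)))"
proof -
  let ?z = "zhat ^ Suc r"
  have Q0C: "Qhat 0 * C_elem = scal (- 2) * Qhat 1 + Qhat (- 1)"
    using Qhat_C[of 0] by simp
  have "scal (- 2) * (Qhat 1 * Qhat (- 1)) = Qhat 0 * Qhat 0 - 1"
    using Qhat_system[of 0] by (simp add: t_elem_scal power2_eq_square mult.assoc)
  hence "scal 2 * (scal (- 2) * (Qhat 1 * Qhat (- 1))) = scal 2 * (Qhat 0 * Qhat 0 - 1)" by simp
  hence Qm: "Qhat 1 * Qhat (- 1) = scal 2 * (Qhat 0 * Qhat 0 - 1)"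
    by (simp add: scal_mult_left)
  \<comment> \<open>Standing on the left, \<open>Q_0^2 - 1\<close> vanishes at
    \<open>Q_0 = 1\<close>.\<close>
  have "CT_one (Qhat 0 ^ 2 * ?z + - ?z) + CT_one ?z = CT_one (Qhat 0 ^ 2 * ?z)"
    by (simp only: CT_one_add[symmetric]) simp
  hence "CT_one ((Qhat 0 * Qhat 0 - 1) * ?z) = 0"
    unfolding CT_one_Qhat_0_power by (simp add: left_diff_distrib power2_eq_square)
  hence Qm0: "CT_one (Qhat 1 * (Qhat (- 1) * ?z)) = 0"
    by (simp only: mult.assoc[symmetric] Qm) (simp only: mult.assoc CT_one_scal, simp)
  have "CT_one (Qhat 1 * (Qhat 0 * (C_elem * ?z))) = u_pow (- 2) * CT_one (Qhat 1 * (Qhat 1 * ?z))"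
  proof -
    have "Qhat 1 * (Qhat 0 * (C_elem * ?z)) = Qhat 1 * (Qhat 0 * C_elem * ?z)"
      by (simp only: mult.assoc)
    also have "\<dots> = scal (- 2) * (Qhat 1 * (Qhat 1 * ?z)) + Qhat 1 * (Qhat (- 1) * ?z)"
      unfolding Q0C by (simp only: distrib_left distrib_right scal_left_commute mult.assoc)
    finally show ?thesis by (simp only: CT_one_add CT_one_scal Qm0) simp
  qed
  moreover have "CT_one (Qhat 1 * (Qhat 0 * (C_elem * ?z))) =
      u_pow 2 * (CT_one (Qhat 1 * zhat ^ r) + u_pow (- 2) * CT_one (Qhat 1 * zhat ^ Suc (Suc r)))"
  proof -
    have "Qhat 1 * (Qhat 0 * (C_elem * ?z)) = Qhat 1 * Qhat 0 ^ 1 * (C_elem * ?z)"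
      by (simp only: mult.assoc power_one_right)
    also have "\<dots> = scal 2 * (Qhat 0 ^ 1 * (Qhat 1 * (C_elem * ?z)))"
      unfolding Qhat_1_Qhat_0_power by (simp add: mult.assoc)
    also have "Qhat 1 * (C_elem * ?z) = Qhat 1 * zhat ^ r + scal (- 2) * (Qhat 1 * zhat ^ Suc (Suc r))"
      unfolding C_zhat_power by (simp only: distrib_left scal_left_commute)
    finally show ?thesis by (simp only: CT_one_add CT_one_scal CT_one_Qhat_0_power)
  qed
  ultimately have "u_pow 2 * (u_pow (- 2) * CT_one (Qhat 1 * (Qhat 1 * ?z))) = u_pow 2 * (u_pow 2 *
      (CT_one (Qhat 1 * zhat ^ r) + u_pow (- 2) * CT_one (Qhat 1 * zhat ^ Suc (Suc r))))" by simp
  thus ?thesis by (simp add: u_pow_mult flip: mult.assoc)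
qed

text \<open>Without a power of \<open>z\<close> the series is \<open>Q_1\<close> times factors
  \<open>Qhat i\<close> on its right, and it never leaves \<open>vanishing\<close>.\<close>

lemma CT_value_0: "CT_value K 0 n = 0"
proof -
  have "Qhat 1 \<in> vanishing"
    by (auto simp: Qhat_1 vanishing_def coeff_Q1_monom)
  moreover have "f * prod_list (map (\<lambda>i. Qhat (int i) ^ nat (n i)) is) \<in> vanishing"
    if "f \<in> vanishing" for f "is"
    using that
  proof (induction "is" arbitrary: f)
    case (Cons i "is")
    have "f * Qhat (int i) ^ c \<in> vanishing" for c
      using Cons.prems vanishing_mult_Qhat
      by (induction c) (simp_all add: power_Suc2 flip: mult.assoc del: power_Suc)
    thus ?case using Cons.IH by (simp add: mult.assoc[symmetric])
  qed simp
  ultimately show ?thesis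
    unfolding CT_value_def Q_prod_def power_0 mult_1_right by (simp only: vanishing_CT_one mult_zero_right)
qed

section \<open>Comparison\<close>

lemma weight_unit_vec: "a \<le> K \<Longrightarrow> (\<Sum>i=1..K. int i * unit_vec a i) = int a"
  using A_apply_top[of K K "unit_vec a"] by (simp add: A_apply_unit_vec)

lemma CT_value_eq_M_sum:
  fixes n :: "nat \<Rightarrow> int"
  assumes "\<And>i. n i \<ge> 0" "(\<Sum>i=1..K. int i * n i) + 3 \<le> int K"
  shows "CT_value K r n = M_sum K (int r - 1) n"
  using assms
\<comment> \<open>The induction is on the weight for fixed \<open>K\<close>; \<open>r\<close> is
  arbitrary because the level recurrence shifts it.\<close>
proof (induction "nat (\<Sum>i=1..K. int i * n i)" arbitrary: n r rule: less_induct)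
  case (less n r)
  define wt where "wt = (\<lambda>n :: nat \<Rightarrow> int. \<Sum>i=1..K. int i * n i)"
  have wt_add: "wt (\<lambda>i. x i + y i) = wt x + wt y"
    and wt_diff: "wt (\<lambda>i. x i - y i) = wt x - wt y"
    and wt_scale: "wt (\<lambda>i. 2 * x i) = 2 * wt x" for x y
    by (simp_all add: wt_def distrib_left right_diff_distrib sum.distrib sum_subtractf
        sum_distrib_left mult.left_commute)
  have wt_unit: "wt (unit_vec a) = int a" if "a \<le> K" for a
    unfolding wt_def using that by (rule weight_unit_vec)
  note wt_simps = wt_add wt_diff wt_scale wt_unit
  have nonneg: "n i \<ge> 0" for i by (rule less.prems(1))
  have size: "wt n + 3 \<le> int K" using less.prems(2) by (simp add: wt_def)
  have wt_nonneg: "wt x \<ge> 0" if "\<And>i. x i \<ge> 0" for x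
    unfolding wt_def using that by (intro sum_nonneg) auto
  have wt_ge: "int i * n i \<le> wt n" if "1 \<le> i" "i \<le> K" for i
    unfolding wt_def using that nonneg by (intro member_le_sum) auto
  have IH: "CT_value K r x = M_sum K (int r - 1) x" if "\<And>i. x i \<ge> 0" "wt x < wt n" for x r
    using that size wt_nonneg[of x] by (intro less.hyps) (auto simp: wt_def)
  have K: "1 \<le> K" using size wt_nonneg[of n, OF nonneg] by linarith
  show ?case
  proof (cases "r = 0")
    case True
    thus ?thesis using K by (simp add: CT_value_0 M_sum_negative)
  next
    case False
    then obtain r' where r: "r = Suc r'" by (cases r) auto
    \<comment> \<open>The raised vector has weight \<open>wt N + 1\<close>, possibly that of
      \<open>n\<close>, so the induction hypothesis need not reach it. The other three terms of the
      level recurrence have weight at most \<open>wt N\<close>.\<close>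
    have raise: "CT_value K r (\<lambda>i. N i + (unit_vec (k + 1) i - unit_vec k i)) =
        M_sum K (int r - 1) (\<lambda>i. N i + (unit_vec (k + 1) i - unit_vec k i))"
      if k: "1 \<le> k" "k + 3 \<le> K" and N: "\<And>i. N i \<ge> 0" "N k \<ge> 1" "\<And>i. k < i \<Longrightarrow> i \<le> K \<Longrightarrow> N i = 0"
        and wtN: "wt N < wt n" for k N
    proof -
      let ?N' = "\<lambda>i. N i + (unit_vec (k - 1) i - unit_vec k i)"
      have N': "?N' i \<ge> 0" for i using N(1)[of i] N(2) by (auto simp: unit_vec_def)
      have "wt ?N' < wt n" using wtN k by (simp add: wt_simps)
      hence 1: "CT_value K r ?N' = M_sum K (int r - 1) ?N'" using N' by (intro IH)
      have 2: "CT_value K r' N = M_sum K (int r' - 1) N"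
        "CT_value K (Suc (Suc r')) N = M_sum K (int (Suc (Suc r')) - 1) N"
        using N(1) wtN by (intro IH; simp)+
      have 3: "M_sum K (int r - 1) (\<lambda>i. N i + (unit_vec (k + 1) i - unit_vec k i)) + M_sum K (int r - 1) ?N' =
          M_sum K (int r - 1 - 1) N + M_sum K (int r - 1 + 1) N"
        by (rule M_sum_level_recurrence) (use k N wtN size r in \<open>auto simp: wt_def\<close>)
      have "CT_value K r (\<lambda>i. N i + (unit_vec (k + 1) i - unit_vec k i)) + CT_value K r ?N' =
          CT_value K r' N + CT_value K (Suc (Suc r')) N"
        unfolding r by (rule CT_value_level_recurrence) (use k N in auto)
      also have "\<dots> = M_sum K (int r - 1 - 1) N + M_sum K (int r - 1 + 1) N"
        unfolding 2 by (simp add: r add.commute)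
      finally show ?thesis unfolding 1 3[symmetric] by simp
    qed
    show ?thesis
    proof (cases "wt n \<ge> 2")
      case True
      define S where "S = {i\<in>{1..K}. n i \<noteq> 0}"
      have "S \<noteq> {}"
      proof
        assume "S = {}"
        hence "wt n = 0" unfolding wt_def by (intro sum.neutral) (auto simp: S_def)
        thus False using True by simp
      qed
      define b where "b = Max S"
      have "finite S" by (simp add: S_def)
      have "b \<in> S" unfolding b_def by (rule Max_in[OF \<open>finite S\<close> \<open>S \<noteq> {}\<close>])
      hence b: "1 \<le> b" "b \<le> K" "n b \<ge> 1" using nonneg[of b] by (auto simp: S_def)
      have above: "n i = 0" if "b < i" "i \<le> K" for i
      proof (rule ccontr)
        assume "n i \<noteq> 0"
        hence "i \<in> S" using that by (simp add: S_def)
        thus False using Max_ge[OF \<open>finite S\<close>, of i] that by (simp add: b_def)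
      qed
      have "int b * 1 \<le> int b * n b" using b by (intro mult_left_mono) auto
      hence "int b \<le> wt n" using wt_ge[of b] b by linarith
      hence bK: "b + 3 \<le> K" using size by linarith
      let ?N = "\<lambda>i. n i + (unit_vec (b - 1) i - unit_vec b i)"
      have N: "?N i \<ge> 0" for i using nonneg[of i] b by (auto simp: unit_vec_def)
      have wtN: "wt ?N < wt n" using b by (simp add: wt_simps)
      show ?thesis
      proof (cases "n b = 1")
        case True
        \<comment> \<open>For \<open>b = 1\<close> the weight would be 1. So \<open>b - 1\<close> is
          a genuine index, and \<open>n\<close> itself is raised from \<open>?N\<close> at
          \<open>b - 1\<close>.\<close>
        have "b \<noteq> 1"
        proof
          assume "b = 1"
          have "wt n = (\<Sum>i=1..K. if i = 1 then 1 else 0)"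
            unfolding wt_def using above True \<open>b = 1\<close> by (intro sum.cong) auto
          thus False using \<open>wt n \<ge> 2\<close> K by simp
        qed
        hence b2: "2 \<le> b" using b by simp
        have "?N i = 0" if "b - 1 < i" "i \<le> K" for i
          using that above[of i] True by (cases "i = b") (auto simp: unit_vec_def)
        moreover have "?N (b - 1) \<ge> 1" using b2 nonneg[of "b - 1"] by (auto simp: unit_vec_def)
        moreover have "(\<lambda>i. ?N i + (unit_vec (b - 1 + 1) i - unit_vec (b - 1) i)) = n"
          using b2 by auto
        ultimately show ?thesis using raise[of "b - 1" ?N] b2 bK N wtN by simp
      next
        case False
        hence nb: "n b \<ge> 2" using b by simp
        let ?n' = "\<lambda>i. n i + (unit_vec (b - 1) i + unit_vec (b + 1) i - 2 * unit_vec b i)"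
        let ?n'' = "\<lambda>i. n i - 2 * unit_vec b i"
        have "?N i = 0" if "b < i" "i \<le> K" for i
          using that above[of i] by (auto simp: unit_vec_def)
        moreover have "?N b \<ge> 1" using b nb by (auto simp: unit_vec_def)
        \<comment> \<open>\<open>?n'\<close> has the same weight as \<open>n\<close>; it is obtained
          from the lighter \<open>?N\<close> by \<open>raise\<close>.\<close>
        moreover have "(\<lambda>i. ?N i + (unit_vec (b + 1) i - unit_vec b i)) = ?n'" by auto
        ultimately have "CT_value K r ?n' = M_sum K (int r - 1) ?n'"
          using raise[of b ?N] b bK N wtN by simp
        moreover have "CT_value K r ?n'' = M_sum K (int r - 1) ?n''"
        proof (rule IH)
          show "?n'' i \<ge> 0" for i using nonneg[of i] nb by (auto simp: unit_vec_def)
          show "wt ?n'' < wt n" using b by (simp add: wt_simps)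
        qed
        ultimately show ?thesis
          using CT_value_recurrence[of b K n r] M_sum_recurrence[of b K n "int r - 1"] b bK nb nonneg
          by simp
      qed
    next
      case False
      hence le1: "wt n \<le> 1" by simp
      \<comment> \<open>Up to the entry at 0, which \<open>CT_value_drop_0\<close> removes, only
        \<open>n = 0\<close> and the unit vector at 1 remain on \<open>{1..K}\<close>.\<close>
      have zero: "n i = 0" if "2 \<le> i" "i \<le> K" for i
      proof (rule ccontr)
        assume "n i \<noteq> 0"
        hence "int i * 1 \<le> int i * n i" using nonneg[of i] by (intro mult_left_mono) auto
        thus False using wt_ge[of i] that le1 by linarith
      qed
      have single: "(\<Sum>i=1..K. f i * n i) = f 1 * n 1" for f
      proof -
        have "(\<Sum>i=1..K. f i * n i) = (\<Sum>i=1..K. if i = 1 then f i * n i else 0)"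
          using zero by (intro sum.cong) auto
        thus ?thesis using K by simp
      qed
      have wt1: "wt n = n 1" unfolding wt_def single by simp
      have sum1: "(\<Sum>i=1..K. n i) = n 1" using single[of "\<lambda>_. 1"] by simp
      have A1: "A_apply K n 1 = n 1"
        unfolding A_apply_def single by simp
      have Q1: "bilin_A K n n = n 1 * n 1"
        unfolding bilin_A_apply_left using single[of "A_apply K n"] A1 by simp
      have M: "M_sum K (int r - 1) n = (if int r - 1 = n 1 then 1 else 0)"
        using M_sum_base[of n K "int r - 1"] nonneg K r le1 wt1 by (simp add: wt_def)
      have P: "Q_prod 1 (Suc K) n = Qhat 1 ^ nat (n 1)"
        using Q_prod_Cons[of 1 "Suc K" n] Q_prod_eq_1[of 2 "Suc K" n] zero K
        by (simp add: numeral_2_eq_2)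
      have CT: "CT_value K r n = u_pow (- 1 - int r - 2 * n 1 - n 1 * n 1) *
          CT_one (Qhat 1 * (Qhat 1 ^ nat (n 1) * zhat ^ r))"
        using CT_value_drop_0[of n K r] nonneg[of 0] unfolding P sum1 Q1 by simp
      consider "n 1 = 0" | "n 1 = 1" using nonneg[of 1] le1 wt1 by linarith
      thus ?thesis
      proof cases
        case 1
        thus ?thesis unfolding CT M using CT_one_Qhat_1_zhat_power[of r]
          by (simp add: u_pow_mult)
      next
        case 2
        have "CT_one (Qhat 1 * (Qhat 1 * zhat ^ r)) = (if r = 2 then u_pow 6 else 0)"
          unfolding r CT_one_Qhat_1_square CT_one_Qhat_1_zhat_power
          by (simp add: u_pow_mult)
        thus ?thesis unfolding CT M 2 by (simp add: u_pow_mult)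
      qed
    qed
  qed
qed

theorem theorem4p15:
  fixes l k :: nat and n :: "nat \<Rightarrow> nat"
  assumes "k \<ge> 1"
    and "\<And>i. i \<notin> {1..k} \<Longrightarrow> n i = 0"
    and "(\<Sum>i=1..k. i * n i) \<le> 2 * k"
  shows
    "fermionic_sum k l n =
       u_pow (- 2 * (\<Sum>i=1..k. int (n i)) - (int l + bilin_A k (\<lambda>i. int (n i)) (\<lambda>i. int (n i)))) *
       at_Q0_one (CT_Q1 (Qhat 1 * ring_inv (Qhat 0) *
         prod_list (map (\<lambda>i. Qhat (int i) ^ n i) [1..<Suc k]) * zhat ^ (l + 1)))
     \<and> (\<forall>k'. k' \<ge> 1 \<and> (\<forall>i. i \<notin> {1..k'} \<longrightarrow> n i = 0) \<and> (\<Sum>i=1..k'. i * n i) \<le> 2 * k' \<longrightarrow>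
          fermionic_sum k' l n = fermionic_sum k l n)
     \<and> fermionic_sum k l n = fermionic_sum_full l n"
proof (intro conjI allI impI)
  let ?n = "\<lambda>i. int (n i)"
  \<comment> \<open>The weight is at most \<open>2 * k\<close>, so this \<open>K\<close> leaves the
    margin 3 demanded by \<open>CT_value_eq_M_sum\<close>.\<close>
  define K where "K = 2 * k + 3"
  have K: "k \<le> K" by (simp add: K_def)
  \<comment> \<open>Each admissible \<open>k'\<close> is compared with the untruncated sum, which
    does not involve \<open>k'\<close>; independence of \<open>k\<close> follows.\<close>
  have full: "fermionic_sum k' l n = fermionic_sum_full l n"
    if "k' \<ge> 1" "\<forall>i. i \<notin> {1..k'} \<longrightarrow> n i = 0" "(\<Sum>i=1..k'. i * n i) \<le> 2 * k'" for k'
    using that fermionic_sum_eq[of k' l n] fermionic_sum_full_eq[of k' n l] by simp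
  show "fermionic_sum k l n = fermionic_sum_full l n" using full[of k] assms by blast
  thus "fermionic_sum k' l n = fermionic_sum k l n"
    if "k' \<ge> 1 \<and> (\<forall>i. i \<notin> {1..k'} \<longrightarrow> n i = 0) \<and> (\<Sum>i=1..k'. i * n i) \<le> 2 * k'" for k'
    using full[of k'] that by simp
  have restrict: "(\<Sum>i=1..K. f i * ?n i) = (\<Sum>i=1..k. f i * ?n i)" for f
    using K assms(2) by (intro sum.mono_neutral_right) auto
  have "int (\<Sum>i=1..k. i * n i) \<le> int (2 * k)"
    using assms(3) by (simp only: of_nat_le_iff)
  hence size: "(\<Sum>i=1..K. int i * ?n i) + 3 \<le> int K" unfolding restrict by (simp add: K_def)
  have "fermionic_sum k l n = M_sum k (int l) ?n" by (rule fermionic_sum_eq)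
  also have "\<dots> = M_sum K (int l) ?n" using M_sum_extend[OF assms K] by simp
  also have "\<dots> = CT_value K (Suc l) ?n"
    using CT_value_eq_M_sum[of ?n K "Suc l"] size by simp
  also have "\<dots> = u_pow (- 1 - int (Suc l) - 2 * (\<Sum>i=1..K. ?n i) - bilin_A K ?n ?n) *
      CT_one (Qhat 1 * (Q_prod 1 (Suc K) ?n * zhat ^ Suc l))"
    by (rule CT_value_drop_0) simp
  also have "(\<Sum>i=1..K. ?n i) = (\<Sum>i=1..k. ?n i)" using restrict[of "\<lambda>_. 1"] by simp
  also have "bilin_A K ?n ?n = bilin_A k ?n ?n"
    by (rule bilin_A_extend[OF K]) (simp_all add: assms(2))
  also have "Q_prod 1 (Suc K) ?n = Q_prod 1 (Suc k) ?n"
  proof -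
    have "Q_prod (Suc k) (Suc K) ?n = 1" by (rule Q_prod_eq_1) (simp add: assms(2))
    thus ?thesis using Q_prod_split[of 1 "Suc k" "Suc K" ?n] K by simp
  qed
  also have "CT_one (Qhat 1 * (Q_prod 1 (Suc k) ?n * zhat ^ Suc l)) =
      u_pow 2 * CT_one (Qhat 1 * ring_inv (Qhat 0) * Q_prod 1 (Suc k) ?n * zhat ^ (l + 1))"
  proof -
    have "ring_inv (Qhat 0) = skew_monom 1 (- 1) 0"
      by (rule ring_inv_unique) (simp_all add: Qhat_0 skew_monom_mult skew_monom_one)
    \<comment> \<open>Moving \<open>Q_0^(-1)\<close> to the left costs \<open>u^(-2)\<close>. This
      turns the offset \<open>- 1 - r = - 2 - l\<close> of \<open>CT_value\<close> into
      \<open>- l\<close>.\<close>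
    hence "Qhat 1 * ring_inv (Qhat 0) = skew_monom (u_pow (- 2)) (- 1) 0 * Qhat 1"
      by (simp add: Qhat_1 skew_monom_mult)
    hence "CT_one (Qhat 1 * ring_inv (Qhat 0) * Q_prod 1 (Suc k) ?n * zhat ^ (l + 1)) =
        u_pow (- 2) * CT_one (Qhat 1 * (Q_prod 1 (Suc k) ?n * zhat ^ Suc l))"
      by (simp add: mult.assoc CT_one_monom_0)
    thus ?thesis by (simp add: u_pow_mult flip: mult.assoc)
  qed
  finally show "fermionic_sum k l n =
       u_pow (- 2 * (\<Sum>i=1..k. int (n i)) - (int l + bilin_A k (\<lambda>i. int (n i)) (\<lambda>i. int (n i)))) *
       at_Q0_one (CT_Q1 (Qhat 1 * ring_inv (Qhat 0) *
         prod_list (map (\<lambda>i. Qhat (int i) ^ n i) [1..<Suc k]) * zhat ^ (l + 1)))"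
    by (simp only: CT_one_def Q_prod_def nat_int mult.assoc[symmetric] u_pow_mult)
      (simp add: algebra_simps)
qed

end
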